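(* The theory $\mathcal{M}^*(PIT)$ is categorical; that is, it is consistent (it has a model) and any two of its models are isomorphic.
   Context: Reasoning takes place in ordinary set theory (ZFC); models are taken in the full set-theoretic sense. A model of $\mathcal{M}^*(PIT)$ consists of a set $\mathbb{S}$ (of "sounds"), a binary relation $*$ on $\mathbb{S}$ ("lower-pitched"), a binary relation $\cong$ ("congruence") on intervals, a binary relation $\simeq$ on $\mathbb{S}$ ("equitonal") and a set $\mathbb{I}^*$ of intervals ("harmonic" intervals), satisfying the axioms below. Pitch. Write $x\sim y$ iff neither $x*y$ nor $y*x$. (1) $\neg(x*x)$ for all $x$. (2) $*$ is transitive. (3) There are $x,y$ with $x*y$ or $y*x$. (4) If $x*y$, then no $z$ satisfies both $x\sim z$ and $y\sim z$. (5) For every $x$ there are $a,b$ with $a*x$ and $x*b$; and if $x*y$ there is $a$ with $x*a$ and $a*y$. Then $\sim$ is an equivalence relation; $\tilde{x}$ is the class of $x$. Intervals. $[a,b]:=(\tilde a,\tilde b)$, $[a,b]^{-1}:=[b,a]$, $\mathbb{I}:=(\mathbb{S}/\sim)\times(\mathbb{S}/\sim)$, and $\cong$ is a binary relation on $\mathbb{I}$. (6) $\cong$ is reflexive. (7) $\cong$ is transitive. (8) For all $x,y,a$ there is $b$ with $[x,y]\cong[a,b]$, and any $b'$ with $[x,y]\cong[a,b']$ satisfies $b\sim b'$. (9) If $a*b$: $[a,b]\cong[c,d]$ implies $c*d$; and $[a,b]\cong[c,d]$ iff $[b,a]\cong[d,c]$. (10) If $a*b$ and $b*c$: $[a,b]\cong[a',b']$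 and $[b,c]\cong[b',c']$ imply $[a,c]\cong[a',c']$; and $[a,b]\cong[a',b']^{-1}$ and $[b,c]\cong[b',c']^{-1}$ imply $[a,c]\cong[a',c']^{-1}$. (11) (Dedekind) If $\mathbb{S}$ is partitioned into two nonempty sets $P,Q$ such that no sound of $Q$ is lower-pitched than a sound of $P$, there is $\theta\in\mathbb{S}$ such that every $s*\theta$ lies in $P$ and every $s$ with $\theta*s$ lies in $Q$. Tonality. (15) $x\sim y$ implies $x\simeq y$; and $x\simeq z$, $y\simeq z$ imply $x\simeq y$. Then $\simeq$ is an equivalence relation; $\hat s$ is the class of $s$. A sound minimal with respect to $*$ in $\{x: x\simeq s,\ s*x\}$, when it exists, is denoted $s^*$ (unique up to $\sim$), and $[s,s^*]$ is called an octave interval. An octave interval exists. (16) Every interval congruent to an octave interval is an octave interval. Measure and frequency. Under these axioms all octave intervals are congruent and there is a unique $|\cdot|:\mathbb{I}\to\mathbb{R}^+$ such that octave intervals have measure $2$, $|[a,b]|>1$ iff $a*b$, $|[a,b]|=1$ iff $a\sim b$, $|[a,b]|<1$ iff $b*a$, $|[a,b]|=|[c,d]|$ iff $[a,b]\cong[c,d]$, and $|[a,c]|=|[a,b]|\cdot|[b,c]|$; it is onto. A sound $x_0$ and real numbers $f_0,\iota_0>0$ are given once and for all, and the frequency of sounds is $f:\mathbb{S}\to\mathbb{R}^+$, $f(x)=f_0\cdot|[x_0,x]|$. Loudness and colour. Let $C_p(\mathbb{R})$ be the set of nonconstant periodic continuous functions $\mathbb{R}\to\mathbb{R}$; for $g\in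 C_p(\mathbb{R})$ let $T_g$ be its least positive period and $A_g=\max g-\min g$. (12) There is $\iota:\mathbb{S}\to\mathbb{R}^+$ with $\iota(x_0)=\iota_0$ such that for every $r\in\mathbb{R}^+$ and $s\in\mathbb{S}$ there is $x\sim s$ with $\iota(x)=r$. (13') There is $\Gamma:\mathbb{S}\to C_p(\mathbb{R})$, onto $C_p(\mathbb{R})$, with $T_{\Gamma(x)}=f(x)$ and $A_{\Gamma(x)}=\iota(x)$ for all $x$. (14) $\Gamma(x)=\Gamma(y)$ implies $x=y$. Harmony. Put $|\mathbb{I}^*|=\{|I|:I\in\mathbb{I}^*\}$. (17) If $a*b$, $[a,b]\cong[c,d]$ and $[a,b]$ is harmonic, then $[c,d]$ is harmonic; and if $[a,b]$ is harmonic with $a\not\sim b$, then $[b,a]$ is harmonic. (18) If $I,J$ are harmonic, $|I|>1$ and $|J|\neq1$, then every interval of measure $|I|\cdot|J|$ is harmonic. (19) There is $\alpha>1$ such that no $\beta\in|\mathbb{I}^*|$ satisfies $1<\beta<\alpha$. Put $\varepsilon:=\inf\{r\in|\mathbb{I}^*|:r>1\}$. A scale is a triple $(\hat s,(r_i)_{i=1}^m,(r'_i)_{i=1}^n)$ with $s\in\mathbb{S}$, $r_i\in|\mathbb{I}^*|$, $r_i>1$, $r'_i\in|\mathbb{I}^*|$, $r'_i<1$, $\prod r_i=2$, $\prod r'_i=1/2$; its tonic is $\hat s$. It is heptatonic if $m=n=7$, and compatible if $m=n$ and $r'_i=r_{n-i+1}^{-1}$ for all $i$. Its ascendent (descendent)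 mode is $\{r_i\}$ ($\{r'_i\}$); a mode is maximally even if it is contained in $\{\varepsilon^k,\varepsilon^{k+1}\}$ for some integer $k$. Let $s_0=s'_0=s$, $|[s_{i-1},s_i]|=r_i$, $|[s'_{j-1},s'_j]|=r'_j$; the ascendent components set is $\{\hat s_i:0\le i\le m\}$. The ascendent (descendent) module has the sensible if $r_m=\varepsilon$ ($r_n'^{-1}=\varepsilon$). A tetrachord is a triple $(r_{k-1},r_k,r_{k+1})$ with $1<k<m$, with components $\hat s_{k-2},\hat s_{k-1},\hat s_k,\hat s_{k+1}$, or a triple $(r'_{l-1},r'_l,r'_{l+1})$ with $1<l<n$, with components $\hat s'_{l-2},\dots,\hat s'_{l+1}$; two tetrachords are disjoint if their sets of components have no common element except possibly $\hat s$. A triad is $(x,y,z)$ with $x*y$, $y*z$ and $[x,y],[y,z]$ harmonic; it is major if $|[x,y]|=\varepsilon\,|[y,z]|$ and $[x,z]$ is harmonic of measure $\varepsilon\cdot 2^{1/2}$. A triad $(x,y,z)$ is scale-based on the tonic of a compatible scale if $\hat s,\hat u,\hat v$ all lie in the ascendent components set, where $|[s,u]|=|[x,y]|$ and $|[u,v]|=|[y,z]|$. (20) There exist harmonic intervals of measure greater than $1$, and a heptatonic compatible scale with maximally even mode, whose ascendent module has the sensible and whose descendent module does not, having two disjoint and equal tetrachords, and such that a major triad is scale-based on its tonic. An isomorphism between two models is a bijection $h$ between their sets of sounds preserving the undefined concepts in both directions: $*$, $\cong$ (via $[a,b]\mapsto[h(a),h(b)]$), $\simeq$, and harmonicity of intervals.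 *)

theory Defs
  imports "HOL-Analysis.Analysis"
begin

(* All relations are sets of pairs, and pit_wf confines them to the carrier.  Intervals are pairs of
   pitch classes.  The sound x_0 is a component of a structure, but isomorphisms need not
   preserve it. *)
record 'a pit_structure =
  sounds :: "'a set"
  lower :: "('a \<times> 'a) set"
  icong :: "(('a set \<times> 'a set) \<times> ('a set \<times> 'a set)) set"
  equitonal :: "('a \<times> 'a) set"
  harmonic :: "('a set \<times> 'a set) set"
  base_sound :: 'a

definition same_pitch :: "'a pit_structure \<Rightarrow> ('a \<times> 'a) set" where
  "same_pitch M = {(x, y) \<in> sounds M \<times> sounds M. (x, y) \<notin> lower M \<and> (y, x) \<notin> lower M}"

definition intervals :: "'a pit_structure \<Rightarrow> ('a set \<times> 'a set) set" where
  "intervals M = (sounds M // same_pitch M) \<times> (sounds M // same_pitch M)"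

definition ival :: "'a pit_structure \<Rightarrow> 'a \<Rightarrow> 'a \<Rightarrow> 'a set \<times> 'a set" where
  "ival M a b = (same_pitch M `` {a}, same_pitch M `` {b})"

definition pit_wf :: "'a pit_structure \<Rightarrow> bool" where
  "pit_wf M \<longleftrightarrow>
     lower M \<subseteq> sounds M \<times> sounds M \<and>
     icong M \<subseteq> intervals M \<times> intervals M \<and>
     equitonal M \<subseteq> sounds M \<times> sounds M \<and>
     harmonic M \<subseteq> intervals M \<and>
     base_sound M \<in> sounds M"

definition pitch_axioms :: "'a pit_structure \<Rightarrow> bool" where
  "pitch_axioms M \<longleftrightarrow>
     (\<forall>x\<in>sounds M. (x, x) \<notin> lower M) \<and>
     trans (lower M) \<and>
     (\<exists>x\<in>sounds M. \<exists>y\<in>sounds M. (x, y) \<in> lower M \<or> (y, x) \<in> lower M) \<and>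
     (\<forall>x\<in>sounds M. \<forall>y\<in>sounds M. (x, y) \<in> lower M \<longrightarrow>
        \<not> (\<exists>z\<in>sounds M. (x, z) \<in> same_pitch M \<and> (y, z) \<in> same_pitch M)) \<and>
     (\<forall>x\<in>sounds M. \<exists>a\<in>sounds M. \<exists>b\<in>sounds M. (a, x) \<in> lower M \<and> (x, b) \<in> lower M) \<and>
     (\<forall>x\<in>sounds M. \<forall>y\<in>sounds M. (x, y) \<in> lower M \<longrightarrow>
        (\<exists>a\<in>sounds M. (x, a) \<in> lower M \<and> (a, y) \<in> lower M))"

definition interval_axioms :: "'a pit_structure \<Rightarrow> bool" where
  "interval_axioms M \<longleftrightarrow>
     (\<forall>I\<in>intervals M. (I, I) \<in> icong M) \<and>
     trans (icong M) \<and>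
     (\<forall>x\<in>sounds M. \<forall>y\<in>sounds M. \<forall>a\<in>sounds M. \<exists>b\<in>sounds M.
        (ival M x y, ival M a b) \<in> icong M \<and>
        (\<forall>b'\<in>sounds M. (ival M x y, ival M a b') \<in> icong M \<longrightarrow> (b, b') \<in> same_pitch M)) \<and>
     (\<forall>a\<in>sounds M. \<forall>b\<in>sounds M. \<forall>c\<in>sounds M. \<forall>d\<in>sounds M. (a, b) \<in> lower M \<longrightarrow>
        ((ival M a b, ival M c d) \<in> icong M \<longrightarrow> (c, d) \<in> lower M) \<and>
        ((ival M a b, ival M c d) \<in> icong M \<longleftrightarrow> (ival M b a, ival M d c) \<in> icong M)) \<and>
     (\<forall>a\<in>sounds M. \<forall>b\<in>sounds M. \<forall>c\<in>sounds M.
      \<forall>a'\<in>sounds M. \<forall>b'\<in>sounds M. \<forall>c'\<in>sounds M.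
        (a, b) \<in> lower M \<and> (b, c) \<in> lower M \<longrightarrow>
        ((ival M a b, ival M a' b') \<in> icong M \<and> (ival M b c, ival M b' c') \<in> icong M \<longrightarrow>
           (ival M a c, ival M a' c') \<in> icong M) \<and>
        ((ival M a b, ival M b' a') \<in> icong M \<and> (ival M b c, ival M c' b') \<in> icong M \<longrightarrow>
           (ival M a c, ival M c' a') \<in> icong M))"

definition dedekind_axiom :: "'a pit_structure \<Rightarrow> bool" where
  "dedekind_axiom M \<longleftrightarrow>
     (\<forall>P Q. P \<union> Q = sounds M \<and> P \<inter> Q = {} \<and> P \<noteq> {} \<and> Q \<noteq> {} \<and>
        \<not> (\<exists>q\<in>Q. \<exists>p\<in>P. (q, p) \<in> lower M) \<longrightarrow>
        (\<exists>\<theta>\<in>sounds M. \<forall>s\<in>sounds M.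
           ((s, \<theta>) \<in> lower M \<longrightarrow> s \<in> P) \<and> ((\<theta>, s) \<in> lower M \<longrightarrow> s \<in> Q)))"

definition equitonal_above :: "'a pit_structure \<Rightarrow> 'a \<Rightarrow> 'a set" where
  "equitonal_above M s = {x \<in> sounds M. (x, s) \<in> equitonal M \<and> (s, x) \<in> lower M}"

definition octave_intervals :: "'a pit_structure \<Rightarrow> ('a set \<times> 'a set) set" where
  "octave_intervals M =
     {ival M s t | s t. s \<in> sounds M \<and> t \<in> equitonal_above M s \<and>
        \<not> (\<exists>y\<in>equitonal_above M s. (y, t) \<in> lower M)}"

definition tone :: "'a pit_structure \<Rightarrow> 'a \<Rightarrow> 'a set" where
  "tone M s = equitonal M `` {s}"

definition tonality_axioms :: "'a pit_structure \<Rightarrow> bool" where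
  "tonality_axioms M \<longleftrightarrow>
     same_pitch M \<subseteq> equitonal M \<and>
     (\<forall>x\<in>sounds M. \<forall>y\<in>sounds M. \<forall>z\<in>sounds M.
        (x, z) \<in> equitonal M \<and> (y, z) \<in> equitonal M \<longrightarrow> (x, y) \<in> equitonal M) \<and>
     octave_intervals M \<noteq> {} \<and>
     (\<forall>I\<in>octave_intervals M. \<forall>J\<in>intervals M. (J, I) \<in> icong M \<longrightarrow> J \<in> octave_intervals M)"

definition is_imeasure :: "'a pit_structure \<Rightarrow> ('a set \<times> 'a set \<Rightarrow> real) \<Rightarrow> bool" where
  "is_imeasure M \<mu> \<longleftrightarrow>
     (\<forall>I\<in>intervals M. \<mu> I > 0) \<and>
     (\<forall>I\<in>octave_intervals M. \<mu> I = 2) \<and>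
     (\<forall>a\<in>sounds M. \<forall>b\<in>sounds M.
        (\<mu> (ival M a b) > 1 \<longleftrightarrow> (a, b) \<in> lower M) \<and>
        (\<mu> (ival M a b) = 1 \<longleftrightarrow> (a, b) \<in> same_pitch M) \<and>
        (\<mu> (ival M a b) < 1 \<longleftrightarrow> (b, a) \<in> lower M)) \<and>
     (\<forall>I\<in>intervals M. \<forall>J\<in>intervals M. \<mu> I = \<mu> J \<longleftrightarrow> (I, J) \<in> icong M) \<and>
     (\<forall>a\<in>sounds M. \<forall>b\<in>sounds M. \<forall>c\<in>sounds M.
        \<mu> (ival M a c) = \<mu> (ival M a b) * \<mu> (ival M b c))"

(* The pitch, interval, Dedekind and tonality axioms give exactly one such function on the
   intervals; extensionality fixes its irrelevant values off the intervals. *)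
definition imeasure :: "'a pit_structure \<Rightarrow> 'a set \<times> 'a set \<Rightarrow> real" where
  "imeasure M = (THE \<mu>. \<mu> \<in> extensional (intervals M) \<and> is_imeasure M \<mu>)"

definition frequency :: "real \<Rightarrow> 'a pit_structure \<Rightarrow> 'a \<Rightarrow> real" where
  "frequency f0 M x = f0 * imeasure M (ival M (base_sound M) x)"

definition periodic_continuous :: "(real \<Rightarrow> real) set" where
  "periodic_continuous =
     {g. continuous_on UNIV g \<and> \<not> g constant_on UNIV \<and> (\<exists>p>0. \<forall>t. g (t + p) = g t)}"

definition least_period :: "(real \<Rightarrow> real) \<Rightarrow> real" where
  "least_period g = (LEAST p. p > 0 \<and> (\<forall>t. g (t + p) = g t))"

definition amplitude :: "(real \<Rightarrow> real) \<Rightarrow> real" where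
  "amplitude g = (GREATEST y. y \<in> range g) - (LEAST y. y \<in> range g)"

definition loudness_colour_axioms :: "real \<Rightarrow> real \<Rightarrow> 'a pit_structure \<Rightarrow> bool" where
  "loudness_colour_axioms f0 \<iota>0 M \<longleftrightarrow>
     (\<exists>\<iota> \<Gamma>.
        (\<forall>x\<in>sounds M. \<iota> x > (0::real)) \<and>
        \<iota> (base_sound M) = \<iota>0 \<and>
        (\<forall>r>0. \<forall>s\<in>sounds M. \<exists>x\<in>sounds M. (x, s) \<in> same_pitch M \<and> \<iota> x = r) \<and>
        \<Gamma> ` sounds M = periodic_continuous \<and>
        (\<forall>x\<in>sounds M. least_period (\<Gamma> x) = frequency f0 M x \<and> amplitude (\<Gamma> x) = \<iota> x) \<and>
        (\<forall>x\<in>sounds M. \<forall>y\<in>sounds M. \<Gamma> x = \<Gamma> y \<longrightarrow> x = y))"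

definition harmonic_measures :: "'a pit_structure \<Rightarrow> real set" where
  "harmonic_measures M = imeasure M ` harmonic M"

definition harmony_axioms :: "'a pit_structure \<Rightarrow> bool" where
  "harmony_axioms M \<longleftrightarrow>
     (\<forall>a\<in>sounds M. \<forall>b\<in>sounds M. \<forall>c\<in>sounds M. \<forall>d\<in>sounds M.
        (a, b) \<in> lower M \<and> (ival M a b, ival M c d) \<in> icong M \<and> ival M a b \<in> harmonic M \<longrightarrow>
        ival M c d \<in> harmonic M) \<and>
     (\<forall>a\<in>sounds M. \<forall>b\<in>sounds M.
        ival M a b \<in> harmonic M \<and> (a, b) \<notin> same_pitch M \<longrightarrow> ival M b a \<in> harmonic M) \<and>
     (\<forall>I\<in>harmonic M. \<forall>J\<in>harmonic M. imeasure M I > 1 \<and> imeasure M J \<noteq> 1 \<longrightarrow>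
        (\<forall>K\<in>intervals M. imeasure M K = imeasure M I * imeasure M J \<longrightarrow> K \<in> harmonic M)) \<and>
     (\<exists>\<alpha>>1. \<not> (\<exists>\<beta>\<in>harmonic_measures M. 1 < \<beta> \<and> \<beta> < \<alpha>))"

definition semitone :: "'a pit_structure \<Rightarrow> real" where
  "semitone M = Inf {r \<in> harmonic_measures M. r > 1}"

(* The entry r_i of the informal sequence is the list element rs ! (i - 1). *)
type_synonym 'a scale = "'a set \<times> real list \<times> real list"

fun is_scale :: "'a pit_structure \<Rightarrow> 'a scale \<Rightarrow> bool" where
  "is_scale M (T, rs, rs') \<longleftrightarrow>
     (\<exists>s\<in>sounds M. T = tone M s) \<and>
     (\<forall>r\<in>set rs. r \<in> harmonic_measures M \<and> r > 1) \<and>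
     (\<forall>r\<in>set rs'. r \<in> harmonic_measures M \<and> r < 1) \<and>
     prod_list rs = 2 \<and> prod_list rs' = 1 / 2"

fun heptatonic :: "'a scale \<Rightarrow> bool" where
  "heptatonic (T, rs, rs') \<longleftrightarrow> length rs = 7 \<and> length rs' = 7"

fun compatible :: "'a scale \<Rightarrow> bool" where
  "compatible (T, rs, rs') \<longleftrightarrow>
     length rs = length rs' \<and>
     (\<forall>i<length rs'. rs' ! i = inverse (rs ! (length rs' - 1 - i)))"

fun asc_mode :: "'a scale \<Rightarrow> real set" where
  "asc_mode (T, rs, rs') = set rs"

fun desc_mode :: "'a scale \<Rightarrow> real set" where
  "desc_mode (T, rs, rs') = set rs'"

definition maximally_even :: "'a pit_structure \<Rightarrow> real set \<Rightarrow> bool" where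
  "maximally_even M A \<longleftrightarrow>
     (\<exists>k::int. A \<subseteq> {semitone M powi k, semitone M powi (k + 1)})"

fun asc_sensible :: "'a pit_structure \<Rightarrow> 'a scale \<Rightarrow> bool" where
  "asc_sensible M (T, rs, rs') \<longleftrightarrow> last rs = semitone M"

fun desc_sensible :: "'a pit_structure \<Rightarrow> 'a scale \<Rightarrow> bool" where
  "desc_sensible M (T, rs, rs') \<longleftrightarrow> inverse (last rs') = semitone M"

(* Sounds s_0, ..., s_m with s_0 in the tonic T and successive interval measures rs. *)
definition note_seq :: "'a pit_structure \<Rightarrow> 'a set \<Rightarrow> real list \<Rightarrow> 'a list \<Rightarrow> bool" where
  "note_seq M T rs ss \<longleftrightarrow>
     length ss = length rs + 1 \<and> set ss \<subseteq> sounds M \<and> ss ! 0 \<in> T \<and>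
     (\<forall>i<length rs. imeasure M (ival M (ss ! i) (ss ! (i + 1))) = rs ! i)"

(* The tones of the s_i with index in A; they do not depend on the chosen note sequence. *)
definition components :: "'a pit_structure \<Rightarrow> 'a set \<Rightarrow> real list \<Rightarrow> nat set \<Rightarrow> 'a set set" where
  "components M T rs A = {tone M (ss ! i) | ss i. note_seq M T rs ss \<and> i \<in> A}"

fun asc_components :: "'a pit_structure \<Rightarrow> 'a scale \<Rightarrow> 'a set set" where
  "asc_components M (T, rs, rs') = components M T rs {0..length rs}"

(* Each tetrachord is paired with its set of components. *)
definition module_tetrachords ::
  "'a pit_structure \<Rightarrow> 'a set \<Rightarrow> real list \<Rightarrow> ((real \<times> real \<times> real) \<times> 'a set set) set" where
  "module_tetrachords M T rs =
     {((rs ! (k - 2), rs ! (k - 1), rs ! k), components M T rs {k - 2..k + 1}) | k.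
        1 < k \<and> k < length rs}"

fun tetrachords ::
  "'a pit_structure \<Rightarrow> 'a scale \<Rightarrow> ((real \<times> real \<times> real) \<times> 'a set set) set" where
  "tetrachords M (T, rs, rs') = module_tetrachords M T rs \<union> module_tetrachords M T rs'"

definition has_disjoint_equal_tetrachords :: "'a pit_structure \<Rightarrow> 'a scale \<Rightarrow> bool" where
  "has_disjoint_equal_tetrachords M \<sigma> \<longleftrightarrow>
     (\<exists>t C C'. (t, C) \<in> tetrachords M \<sigma> \<and> (t, C') \<in> tetrachords M \<sigma> \<and> C \<inter> C' \<subseteq> {fst \<sigma>})"

definition triad :: "'a pit_structure \<Rightarrow> 'a \<Rightarrow> 'a \<Rightarrow> 'a \<Rightarrow> bool" where
  "triad M x y z \<longleftrightarrow>
     x \<in> sounds M \<and> y \<in> sounds M \<and> z \<in> sounds M \<and>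
     (x, y) \<in> lower M \<and> (y, z) \<in> lower M \<and>
     ival M x y \<in> harmonic M \<and> ival M y z \<in> harmonic M"

definition major_triad :: "'a pit_structure \<Rightarrow> 'a \<Rightarrow> 'a \<Rightarrow> 'a \<Rightarrow> bool" where
  "major_triad M x y z \<longleftrightarrow>
     triad M x y z \<and>
     imeasure M (ival M x y) = semitone M * imeasure M (ival M y z) \<and>
     ival M x z \<in> harmonic M \<and>
     imeasure M (ival M x z) = semitone M * sqrt 2"

definition scale_based :: "'a pit_structure \<Rightarrow> 'a scale \<Rightarrow> 'a \<Rightarrow> 'a \<Rightarrow> 'a \<Rightarrow> bool" where
  "scale_based M \<sigma> x y z \<longleftrightarrow>
     (\<exists>s\<in>sounds M. \<exists>u\<in>sounds M. \<exists>v\<in>sounds M. tone M s = fst \<sigma> \<and>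
        imeasure M (ival M s u) = imeasure M (ival M x y) \<and>
        imeasure M (ival M u v) = imeasure M (ival M y z) \<and>
        {tone M s, tone M u, tone M v} \<subseteq> asc_components M \<sigma>)"

definition scale_axiom :: "'a pit_structure \<Rightarrow> bool" where
  "scale_axiom M \<longleftrightarrow>
     (\<exists>I\<in>harmonic M. imeasure M I > 1) \<and>
     (\<exists>\<sigma>. is_scale M \<sigma> \<and> heptatonic \<sigma> \<and> compatible \<sigma> \<and>
        maximally_even M (asc_mode \<sigma>) \<and> maximally_even M (desc_mode \<sigma>) \<and>
        asc_sensible M \<sigma> \<and> \<not> desc_sensible M \<sigma> \<and>
        has_disjoint_equal_tetrachords M \<sigma> \<and>
        (\<exists>x y z. major_triad M x y z \<and> scale_based M \<sigma> x y z))"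

definition pit_model :: "real \<Rightarrow> real \<Rightarrow> 'a pit_structure \<Rightarrow> bool" where
  "pit_model f0 \<iota>0 M \<longleftrightarrow>
     pit_wf M \<and> pitch_axioms M \<and> interval_axioms M \<and> dedekind_axiom M \<and> tonality_axioms M \<and>
     loudness_colour_axioms f0 \<iota>0 M \<and> harmony_axioms M \<and> scale_axiom M"

definition pit_isomorphism ::
  "'a pit_structure \<Rightarrow> 'b pit_structure \<Rightarrow> ('a \<Rightarrow> 'b) \<Rightarrow> bool" where
  "pit_isomorphism M N h \<longleftrightarrow>
     bij_betw h (sounds M) (sounds N) \<and>
     (\<forall>x\<in>sounds M. \<forall>y\<in>sounds M. (x, y) \<in> lower M \<longleftrightarrow> (h x, h y) \<in> lower N) \<and>
     (\<forall>a\<in>sounds M. \<forall>b\<in>sounds M. \<forall>c\<in>sounds M. \<forall>d\<in>sounds M.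
        (ival M a b, ival M c d) \<in> icong M \<longleftrightarrow>
        (ival N (h a) (h b), ival N (h c) (h d)) \<in> icong N) \<and>
     (\<forall>x\<in>sounds M. \<forall>y\<in>sounds M. (x, y) \<in> equitonal M \<longleftrightarrow> (h x, h y) \<in> equitonal N) \<and>
     (\<forall>a\<in>sounds M. \<forall>b\<in>sounds M.
        ival M a b \<in> harmonic M \<longleftrightarrow> ival N (h a) (h b) \<in> harmonic N)"

definition pit_isomorphic :: "'a pit_structure \<Rightarrow> 'b pit_structure \<Rightarrow> bool" where
  "pit_isomorphic M N \<longleftrightarrow> (\<exists>h. pit_isomorphism M N h)"

end

theory Submission
  imports Defs "HOL-Algebra.Group" "HOL-Library.Periodic_Fun"
begin

text \<open>
  Frequency governs everything. In a model of the pitch, interval and Dedekind axioms, fix a pitch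
  class; the intervals that start there act on the pitch classes by translation, and this turns the
  pitch classes into an ordered group. The group is abelian because congruent intervals may be
  summed in either order, and archimedean because a bounded sequence of equal steps would leave a
  Dedekind cut that its own translate contradicts (\<open>archimedean_translations\<close>). Hoelder's theorem
  (\<open>real_embedding\<close>) embeds the group in the additive reals, and exponentiation gives an interval
  measure. Two measures agree, since both are 2 on octaves and a power of 2 fits strictly between
  the \<open>n\<close>-th powers of two distinct numbers above 1 once \<open>n\<close> is large (\<open>imeasure_le\<close>).

  Every other relation is then a condition on measures. Sounds are equitonal iff their interval
  measures an integer power of 2 (\<open>equitonal_iff\<close>). The harmonic measures form a discrete
  multiplicative group, hence are the powers of the semitone \<open>\<epsilon>\<close>, and the scale axiom forces
  \<open>\<epsilon> ^ 12 = 2\<close> (\<open>semitone_eq\<close>): maximal evenness with a sensible in one direction only makes every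
  step \<open>\<epsilon>\<close> or \<open>\<epsilon>\<^sup>2\<close>, the first being \<open>\<epsilon>\<^sup>2\<close> and the last \<open>\<epsilon>\<close>; disjoint equal tetrachords must
  occupy the two ends of the octave, so steps 1 to 3 repeat as steps 5 to 7 and the octave has
  9 to 12 semitones; and a major triad, whose upper interval \<open>w\<close> satisfies \<open>w\<^sup>4 = 2\<close>, makes this
  number divisible by 4.

  Since the colour function is a bijection onto the periodic functions that turns frequency into
  least period, following one model's colour function by the inverse of the other's preserves
  frequency, hence measures, hence all relations (\<open>pit_models_isomorphic\<close>). A model exists because
  the periodic functions themselves can serve as sounds, with the least period as frequency and
  twelve-tone equal temperament as harmony (\<open>pit_model_exists\<close>).
\<close>

section \<open>Archimedean ordered groups embed in the reals\<close>

locale archimedean_group = comm_group G for G (structure) +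
  fixes P :: "'a set"
  assumes pos_carrier: "P \<subseteq> carrier G"
    and pos_mult: "x \<in> P \<Longrightarrow> y \<in> P \<Longrightarrow> x \<otimes> y \<in> P"
    and one_not_pos: "\<one> \<notin> P"
    and pos_total: "x \<in> carrier G \<Longrightarrow> x \<in> P \<or> x = \<one> \<or> inv x \<in> P"
    and archimedean: "x \<in> P \<Longrightarrow> y \<in> carrier G \<Longrightarrow> \<exists>n::nat. x [^] n \<otimes> inv y \<in> P"
begin

text \<open>
  The integer part of \<open>x\<close> in units of \<open>e\<close>, where \<open>insert \<one> P\<close> plays the role of the nonnegative
  elements.
\<close>
definition floor_rel :: "'a \<Rightarrow> 'a \<Rightarrow> int \<Rightarrow> bool" where
  "floor_rel e x k \<longleftrightarrow> x \<otimes> e [^] (- k) \<in> insert \<one> P \<and> e [^] (k + 1) \<otimes> inv x \<in> P"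

lemma pos_in_carrier [simp]: "x \<in> P \<Longrightarrow> x \<in> carrier G"
  using pos_carrier by blast

lemma not_pos_inv: "x \<in> P \<Longrightarrow> inv x \<notin> P"
  using pos_mult[of x "inv x"] one_not_pos by (auto simp: r_inv)

lemma nonneg_mult: "x \<in> insert \<one> P \<Longrightarrow> y \<in> insert \<one> P \<Longrightarrow> x \<otimes> y \<in> insert \<one> P"
  using pos_mult by auto

lemma pos_nonneg_mult: "x \<in> P \<Longrightarrow> y \<in> insert \<one> P \<Longrightarrow> x \<otimes> y \<in> P"
  using pos_mult by auto

lemma pos_pow_Suc: "x \<in> P \<Longrightarrow> x [^] Suc n \<in> P"
  by (induction n) (auto intro: pos_mult)

lemma pos_int_pow_iff:
  assumes "e \<in> P" shows "e [^] (k::int) \<in> P \<longleftrightarrow> k > 0"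
proof -
  have pos: "e [^] j \<in> P" if "j > 0" for j :: int
  proof -
    have "j = int (Suc (nat j - 1))" using that by simp
    then obtain n where "j = int (Suc n)" ..
    then show ?thesis using pos_pow_Suc[OF assms, of n] by (simp only: int_pow_int)
  qed
  show ?thesis
  proof
    assume A: "e [^] k \<in> P"
    show "k > 0"
    proof (rule ccontr)
      assume "\<not> k > 0"
      then consider "k = 0" | "- k > 0" by linarith
      then show False
      proof cases
        case 1 then show False using A one_not_pos by simp
      next
        case 2
        then have "inv (e [^] k) \<in> P" using pos[OF 2] assms by (simp add: int_pow_neg)
        then show False using A not_pos_inv by blast
      qed
    qed
  qed (rule pos)
qed

lemma floor_rel_exists:
  assumes e: "e \<in> P" and x: "x \<in> carrier G"
  shows "\<exists>k. floor_rel e x k"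
proof -
  have ec: "e \<in> carrier G" using e by simp
  obtain m :: nat where m: "e [^] m \<otimes> inv (inv x) \<in> P" using archimedean[OF e, of "inv x"] x by auto
  obtain n :: nat where n: "e [^] n \<otimes> inv x \<in> P" using archimedean[OF e x] by auto
  \<comment> \<open>The shift by \<open>m\<close> turns the search for an integer part, possibly negative, into one over \<open>nat\<close>.\<close>
  define j where "j = (LEAST j. e [^] (int j - int m) \<otimes> inv x \<in> P)"
  have "e [^] (int (n + m) - int m) \<otimes> inv x \<in> P" using n by (simp add: int_pow_int)
  then have j: "e [^] (int j - int m) \<otimes> inv x \<in> P"
    unfolding j_def by (rule LeastI)
  have "j \<noteq> 0"
  proof
    assume "j = 0"
    then have "e [^] (- int m) \<otimes> inv x \<in> P" using j by simp
    also have "e [^] (- int m) \<otimes> inv x = inv (e [^] m \<otimes> inv (inv x))"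
      using ec x by (simp add: int_pow_neg int_pow_int inv_mult)
    finally show False using m not_pos_inv by blast
  qed
  then have "e [^] (int (j - 1) - int m) \<otimes> inv x \<notin> P"
    using not_less_Least[of "j - 1" "\<lambda>j. e [^] (int j - int m) \<otimes> inv x \<in> P"]
    by (simp add: j_def)
  moreover have "int (j - 1) - int m = int j - int m - 1" using \<open>j \<noteq> 0\<close> by simp
  ultimately have nj: "e [^] (int j - int m - 1) \<otimes> inv x \<notin> P" by metis
  define k where "k = int j - int m - 1"
  have "inv (e [^] k \<otimes> inv x) = x \<otimes> e [^] (- k)"
    using ec x by (simp add: inv_mult int_pow_neg m_comm)
  moreover have "e [^] k \<otimes> inv x = \<one> \<or> inv (e [^] k \<otimes> inv x) \<in> P"
    using pos_total[of "e [^] k \<otimes> inv x"] nj ec x by (auto simp: k_def)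
  ultimately have "x \<otimes> e [^] (- k) \<in> insert \<one> P" by auto
  moreover have "e [^] (k + 1) \<otimes> inv x \<in> P" using j by (simp add: k_def)
  ultimately show ?thesis unfolding floor_rel_def by blast
qed

lemma floor_rel_mono:
  assumes e: "e \<in> P" and x: "x \<in> carrier G"
    and "x \<otimes> e [^] (- j) \<in> insert \<one> P" "e [^] k \<otimes> inv x \<in> P"
  shows "j < (k::int)"
proof -
  have ec: "e \<in> carrier G" using e by simp
  have "(e [^] k \<otimes> inv x) \<otimes> (x \<otimes> e [^] (- j)) \<in> P" using pos_nonneg_mult assms by blast
  also have "(e [^] k \<otimes> inv x) \<otimes> (x \<otimes> e [^] (- j)) = e [^] k \<otimes> (inv x \<otimes> x) \<otimes> e [^] (- j)"
    using ec x by (simp only: m_assoc m_closed inv_closed int_pow_closed)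
  also have "\<dots> = e [^] (k - j)" using ec x by (simp add: int_pow_mult[symmetric])
  finally show ?thesis using pos_int_pow_iff[OF e] by simp
qed

text \<open>
  The integer part is additive up to an error of at most 1, so that it can be made additive by
  averaging over large powers.
\<close>
lemma floor_rel_mult:
  assumes e: "e \<in> P" and x: "x \<in> carrier G" and y: "y \<in> carrier G"
    and kx: "floor_rel e x k" and ly: "floor_rel e y l" and m: "floor_rel e (x \<otimes> y) m"
  shows "k + l \<le> m" "m \<le> k + l + 1"
proof -
  have ec: "e \<in> carrier G" using e by simp
  have "(x \<otimes> e [^] (- k)) \<otimes> (y \<otimes> e [^] (- l)) = (x \<otimes> y) \<otimes> (e [^] (- k) \<otimes> e [^] (- l))"
    using x y ec by (simp add: m_ac)
  also have "\<dots> = (x \<otimes> y) \<otimes> e [^] (- (k + l))" using ec by (simp add: int_pow_mult[symmetric])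
  finally have "(x \<otimes> y) \<otimes> e [^] (- (k + l)) \<in> insert \<one> P"
    using nonneg_mult kx ly unfolding floor_rel_def by metis
  then have "k + l < m + 1" using floor_rel_mono[OF e] x y m unfolding floor_rel_def by blast
  then show "k + l \<le> m" by simp
  have "(e [^] (k + 1) \<otimes> inv x) \<otimes> (e [^] (l + 1) \<otimes> inv y)
      = (e [^] (k + 1) \<otimes> e [^] (l + 1)) \<otimes> inv (x \<otimes> y)"
    using x y ec by (simp add: m_ac inv_mult)
  also have "\<dots> = e [^] (k + l + 2) \<otimes> inv (x \<otimes> y)" using ec by (simp add: int_pow_mult[symmetric] algebra_simps)
  finally have "e [^] (k + l + 2) \<otimes> inv (x \<otimes> y) \<in> P"
    using pos_mult kx ly unfolding floor_rel_def by metis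
  then have "m < k + l + 2" using floor_rel_mono[OF e] x y m unfolding floor_rel_def by blast
  then show "m \<le> k + l + 1" by simp
qed

lemma floor_rel_pow: "e \<in> P \<Longrightarrow> floor_rel e (e [^] (n::nat)) (int n)"
proof -
  assume e: "e \<in> P"
  have ec: "e \<in> carrier G" using e by simp
  have "e [^] (int n + 1) = e [^] n \<otimes> e" using ec by (simp add: int_pow_mult int_pow_int)
  moreover have "e [^] n \<otimes> e \<otimes> inv (e [^] n) = e" using ec
    by (simp add: m_comm[of "e [^] n" e] m_assoc)
  ultimately show ?thesis unfolding floor_rel_def using e ec by (simp add: int_pow_neg int_pow_int)
qed

text \<open>
  Hoelder's theorem. The value of \<open>x\<close> is the limit of the integer parts, measured in units of \<open>e\<close>, of
  \<open>x ^ (2 ^ n)\<close> divided by \<open>2 ^ n\<close>. Doubling the exponent never lowers the quotient and raises it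
  by at most \<open>1 / 2 ^ (n + 1)\<close>, hence it converges, and the error in additivity vanishes in the limit. Strict
  positivity is the archimedean property: some power of \<open>x\<close> exceeds \<open>e\<close>.
\<close>
theorem real_embedding:
  assumes e: "e \<in> P"
  obtains \<phi> :: "'a \<Rightarrow> real"
  where "\<And>x y. x \<in> carrier G \<Longrightarrow> y \<in> carrier G \<Longrightarrow> \<phi> (x \<otimes> y) = \<phi> x + \<phi> y"
    and "\<And>x. x \<in> P \<Longrightarrow> \<phi> x > 0" and "\<phi> e = 1"
proof -
  define F where "F x = (SOME k. floor_rel e x k)" for x
  have F: "floor_rel e x (F x)" if "x \<in> carrier G" for x
    unfolding F_def using floor_rel_exists[OF e that] by (rule someI_ex)
  have F1: "F x + F y \<le> F (x \<otimes> y)" and F2: "F (x \<otimes> y) \<le> F x + F y + 1"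
    if "x \<in> carrier G" "y \<in> carrier G" for x y
    using floor_rel_mult[OF e that F F F] that by auto
  define a where "a x n = of_int (F (x [^] (2 ^ n :: nat))) / (2 ^ n :: real)" for x n
  have step: "a x n \<le> a x (Suc n)" "a x (Suc n) \<le> a x n + 1 / 2 ^ Suc n"
    if x: "x \<in> carrier G" for x n
  proof -
    have eq: "x [^] (2 ^ Suc n :: nat) = x [^] (2 ^ n :: nat) \<otimes> x [^] (2 ^ n :: nat)"
      using x by (simp add: nat_pow_mult mult_2)
    have "2 * F (x [^] (2 ^ n :: nat)) \<le> F (x [^] (2 ^ Suc n :: nat))"
      "F (x [^] (2 ^ Suc n :: nat)) \<le> 2 * F (x [^] (2 ^ n :: nat)) + 1"
      unfolding eq using F1[of "x [^] (2 ^ n :: nat)" "x [^] (2 ^ n :: nat)"]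
        F2[of "x [^] (2 ^ n :: nat)" "x [^] (2 ^ n :: nat)"] x
      by simp_all
    then have "2 * real_of_int (F (x [^] (2 ^ n :: nat))) \<le> real_of_int (F (x [^] (2 ^ Suc n :: nat)))"
      "real_of_int (F (x [^] (2 ^ Suc n :: nat))) \<le> 2 * real_of_int (F (x [^] (2 ^ n :: nat))) + 1"
      by linarith+
    then show "a x n \<le> a x (Suc n)" "a x (Suc n) \<le> a x n + 1 / 2 ^ Suc n"
      unfolding a_def by (simp_all add: field_simps)
  qed
  have bound: "a x n \<le> a x 0 + 1 - 1 / 2 ^ n" if x: "x \<in> carrier G" for x n
  proof (induction n)
    case (Suc n)
    then show ?case using step(2)[OF x, of n] by (simp add: field_simps)
  qed simp
  define \<phi> where "\<phi> x = lim (a x)" for x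
  have lim: "a x \<longlonglongrightarrow> \<phi> x" if x: "x \<in> carrier G" for x
  proof -
    have "incseq (a x)" by (rule incseq_SucI) (rule step[OF x])
    moreover have "\<forall>n. a x n \<le> a x 0 + 1"
      using bound[OF x] by (smt (verit) divide_nonneg_nonneg zero_le_power)
    ultimately obtain L where "a x \<longlonglongrightarrow> L" by (rule incseq_convergent)
    then show ?thesis unfolding \<phi>_def using limI by blast
  qed
  have add: "\<phi> (x \<otimes> y) = \<phi> x + \<phi> y" if x: "x \<in> carrier G" and y: "y \<in> carrier G" for x y
  proof -
    let ?d = "\<lambda>n. a (x \<otimes> y) n - (a x n + a y n)"
    have "?d \<longlonglongrightarrow> \<phi> (x \<otimes> y) - (\<phi> x + \<phi> y)"
      using x y by (intro tendsto_intros lim) auto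
    moreover have "?d \<longlonglongrightarrow> 0"
    proof (rule tendsto_sandwich)
      have "0 \<le> ?d n \<and> ?d n \<le> 1 / 2 ^ n" for n
      proof -
        have "(x \<otimes> y) [^] (2 ^ n :: nat) = x [^] (2 ^ n :: nat) \<otimes> y [^] (2 ^ n :: nat)"
          using x y by (rule nat_pow_distrib)
        then have "F (x [^] (2 ^ n :: nat)) + F (y [^] (2 ^ n :: nat)) \<le> F ((x \<otimes> y) [^] (2 ^ n :: nat))"
          "F ((x \<otimes> y) [^] (2 ^ n :: nat)) \<le> F (x [^] (2 ^ n :: nat)) + F (y [^] (2 ^ n :: nat)) + 1"
          using F1 F2 x y by auto
        then have "real_of_int (F (x [^] (2 ^ n :: nat))) + F (y [^] (2 ^ n :: nat)) \<le> F ((x \<otimes> y) [^] (2 ^ n :: nat))"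
          "real_of_int (F ((x \<otimes> y) [^] (2 ^ n :: nat))) \<le> real_of_int (F (x [^] (2 ^ n :: nat))) + F (y [^] (2 ^ n :: nat)) + 1"
          by linarith+
        moreover have "?d n = (real_of_int (F ((x \<otimes> y) [^] (2 ^ n :: nat)))
            - (real_of_int (F (x [^] (2 ^ n :: nat))) + F (y [^] (2 ^ n :: nat)))) / 2 ^ n"
          unfolding a_def by (simp add: diff_divide_distrib add_divide_distrib)
        ultimately show ?thesis by (simp add: divide_right_mono)
      qed
      then show "eventually (\<lambda>n. 0 \<le> ?d n) sequentially" "eventually (\<lambda>n. ?d n \<le> 1 / 2 ^ n) sequentially"
        by auto
      show "(\<lambda>n. 1 / 2 ^ n) \<longlonglongrightarrow> (0::real)"
        using LIMSEQ_power_zero[of "1/2::real"] by (simp add: power_one_over)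
    qed simp
    ultimately have "\<phi> (x \<otimes> y) - (\<phi> x + \<phi> y) = 0" by (rule LIMSEQ_unique)
    then show ?thesis by simp
  qed
  have "\<phi> \<one> = 0" using add[of \<one> \<one>] by simp
  have \<phi>e: "\<phi> e = 1"
  proof -
    have "F (e [^] n) = int n" for n :: nat
    proof -
      have en: "e [^] n \<in> carrier G" using e by simp
      have "F (e [^] n) < int n + 1" "int n < F (e [^] n) + 1"
        using F[OF en] floor_rel_pow[OF e, of n] floor_rel_mono[OF e en]
        unfolding floor_rel_def by blast+
      then show ?thesis by simp
    qed
    then have "a e = (\<lambda>n. 1)" unfolding a_def by auto
    then have "(\<lambda>n. 1) \<longlonglongrightarrow> \<phi> e" using lim[of e] e by simp
    then show ?thesis by (simp add: LIMSEQ_const_iff)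
  qed
  have nonneg: "\<phi> x \<ge> 0" if x: "x \<in> P" for x
  proof -
    have "F y \<ge> 0" if y: "y \<in> P" for y
      using floor_rel_mono[OF e, of y 0] F[of y] y unfolding floor_rel_def by fastforce
    moreover have "x [^] (2 ^ n :: nat) \<in> P" for n
      using pos_pow_Suc[OF x, of "2 ^ n - 1"] by simp
    ultimately have "0 \<le> a x n" for n unfolding a_def by simp
    then show ?thesis using lim[of x] x by (intro LIMSEQ_le_const) auto
  qed
  have pow: "\<phi> (x [^] n) = real n * \<phi> x" if "x \<in> carrier G" for x and n :: nat
    by (induction n) (use \<open>\<phi> \<one> = 0\<close> that add in \<open>auto simp: algebra_simps\<close>)
  have pos: "\<phi> x > 0" if x: "x \<in> P" for x
  proof -
    obtain n :: nat where n: "x [^] n \<otimes> inv e \<in> P" using archimedean[OF x, of e] e by auto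
    have "\<phi> e + \<phi> (inv e) = 0" using add[of e "inv e"] e \<open>\<phi> \<one> = 0\<close> by simp
    then have "real n * \<phi> x \<ge> 1"
      using nonneg[OF n] add[of "x [^] n" "inv e"] x e pow[of x n] \<phi>e by simp
    then show ?thesis using nonneg[OF x] by (cases "\<phi> x = 0") auto
  qed
  show ?thesis using that add pos \<phi>e by blast
qed

end

section \<open>Congruence geometry of the pitch line\<close>

text \<open>
  The order and congruence axioms after passage to pitch classes, where sounds of the same pitch are
  equal; \<open>cong a b c d\<close> says that the interval from \<open>a\<close> to \<open>b\<close> is congruent to that from \<open>c\<close> to \<open>d\<close>.
\<close>
locale pitch_line =
  fixes Q :: "'q set"
    and less :: "'q \<Rightarrow> 'q \<Rightarrow> bool" (infix "\<lessdot>" 50)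
    and cong :: "'q \<Rightarrow> 'q \<Rightarrow> 'q \<Rightarrow> 'q \<Rightarrow> bool"
  assumes irrefl: "a \<in> Q \<Longrightarrow> \<not> a \<lessdot> a"
    and less_trans: "a \<in> Q \<Longrightarrow> b \<in> Q \<Longrightarrow> c \<in> Q \<Longrightarrow> a \<lessdot> b \<Longrightarrow> b \<lessdot> c \<Longrightarrow> a \<lessdot> c"
    and linear: "a \<in> Q \<Longrightarrow> b \<in> Q \<Longrightarrow> a \<lessdot> b \<or> a = b \<or> b \<lessdot> a"
    and cong_refl: "a \<in> Q \<Longrightarrow> b \<in> Q \<Longrightarrow> cong a b a b"
    and cong_trans: "a \<in> Q \<Longrightarrow> b \<in> Q \<Longrightarrow> c \<in> Q \<Longrightarrow> d \<in> Q \<Longrightarrow> p \<in> Q \<Longrightarrow> q \<in> Q \<Longrightarrow>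
      cong a b c d \<Longrightarrow> cong c d p q \<Longrightarrow> cong a b p q"
    and transport: "x \<in> Q \<Longrightarrow> y \<in> Q \<Longrightarrow> a \<in> Q \<Longrightarrow> \<exists>b\<in>Q. cong x y a b"
    and transport_unique: "x \<in> Q \<Longrightarrow> y \<in> Q \<Longrightarrow> a \<in> Q \<Longrightarrow> b \<in> Q \<Longrightarrow> b' \<in> Q \<Longrightarrow>
      cong x y a b \<Longrightarrow> cong x y a b' \<Longrightarrow> b = b'"
    and cong_less: "a \<in> Q \<Longrightarrow> b \<in> Q \<Longrightarrow> c \<in> Q \<Longrightarrow> d \<in> Q \<Longrightarrow> a \<lessdot> b \<Longrightarrow> cong a b c d \<Longrightarrow> c \<lessdot> d"
    and cong_rev_pos: "a \<in> Q \<Longrightarrow> b \<in> Q \<Longrightarrow> c \<in> Q \<Longrightarrow> d \<in> Q \<Longrightarrow> a \<lessdot> b \<Longrightarrow>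
      cong a b c d \<longleftrightarrow> cong b a d c"
    and cong_add_pos: "a \<in> Q \<Longrightarrow> b \<in> Q \<Longrightarrow> c \<in> Q \<Longrightarrow> a' \<in> Q \<Longrightarrow> b' \<in> Q \<Longrightarrow> c' \<in> Q \<Longrightarrow>
      a \<lessdot> b \<Longrightarrow> b \<lessdot> c \<Longrightarrow> cong a b a' b' \<Longrightarrow> cong b c b' c' \<Longrightarrow> cong a c a' c'"
    and cong_swap_pos: "a \<in> Q \<Longrightarrow> b \<in> Q \<Longrightarrow> c \<in> Q \<Longrightarrow> a' \<in> Q \<Longrightarrow> b' \<in> Q \<Longrightarrow> c' \<in> Q \<Longrightarrow>
      a \<lessdot> b \<Longrightarrow> b \<lessdot> c \<Longrightarrow> cong a b b' a' \<Longrightarrow> cong b c c' b' \<Longrightarrow> cong a c c' a'"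
    and dedekind: "A \<union> B = Q \<Longrightarrow> A \<inter> B = {} \<Longrightarrow> A \<noteq> {} \<Longrightarrow> B \<noteq> {} \<Longrightarrow>
      \<forall>p\<in>A. \<forall>q\<in>B. \<not> q \<lessdot> p \<Longrightarrow> \<exists>\<theta>\<in>Q. \<forall>s\<in>Q. (s \<lessdot> \<theta> \<longrightarrow> s \<in> A) \<and> (\<theta> \<lessdot> s \<longrightarrow> s \<in> B)"
begin

text \<open>
  Transporting \<open>[c, d]\<close> back to \<open>a\<close> gives, by transitivity, an interval congruent to \<open>[a, b]\<close> with the
  same start, and transport is unique.
\<close>
lemma cong_sym:
  assumes Q: "a \<in> Q" "b \<in> Q" "c \<in> Q" "d \<in> Q" and C: "cong a b c d"
  shows "cong c d a b"
proof -
  obtain b' where b': "b' \<in> Q" "cong c d a b'" using transport Q by blast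
  then have "cong a b a b'" using cong_trans C Q by blast
  then have "b = b'" using transport_unique[OF Q(1,2,1,2) b'(1)] cong_refl Q by blast
  then show ?thesis using b' by simp
qed

lemma cong_rev:
  assumes Q: "a \<in> Q" "b \<in> Q" "c \<in> Q" "d \<in> Q" and C: "cong a b c d"
  shows "cong b a d c"
proof -
  consider "a \<lessdot> b" | "c \<lessdot> d" | "b \<lessdot> a" | "d \<lessdot> c" | "a = b" "c = d" using linear Q by blast
  then show ?thesis
  proof cases
    case 1 then show ?thesis using cong_rev_pos Q C by blast
  next
    case 2 then show ?thesis using cong_rev_pos[of c d a b] cong_sym Q C by blast
  next
    case 3 then show ?thesis using cong_rev_pos[of b a d c] Q C by blast
  next
    case 4 then show ?thesis using cong_rev_pos[of d c b a] cong_sym Q C by blast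
  next
    case 5 then show ?thesis using C by simp
  qed
qed

lemma cong_less_iff:
  assumes Q: "a \<in> Q" "b \<in> Q" "c \<in> Q" "d \<in> Q" and C: "cong a b c d"
  shows "a \<lessdot> b \<longleftrightarrow> c \<lessdot> d"
  using cong_less cong_sym C Q by blast

lemma cong_eq_iff:
  assumes Q: "a \<in> Q" "b \<in> Q" "c \<in> Q" "d \<in> Q" and C: "cong a b c d"
  shows "a = b \<longleftrightarrow> c = d"
  using cong_less_iff[OF Q C] cong_less_iff[OF Q(2,1,4,3) cong_rev[OF Q C]] linear irrefl Q by metis

lemma cong_unison: "a \<in> Q \<Longrightarrow> b \<in> Q \<Longrightarrow> cong a a b b"
  using transport cong_eq_iff by metis

lemma cong_cancel_left_pos:
  assumes Q: "x \<in> Q" "y \<in> Q" "z \<in> Q" "x' \<in> Q" "y' \<in> Q" "z' \<in> Q"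
    and "x \<lessdot> y" "y \<lessdot> z" and "cong x y x' y'" "cong x z x' z'"
  shows "cong y z y' z'"
proof -
  obtain z'' where z'': "z'' \<in> Q" "cong y z y' z''" using transport Q by blast
  then have "cong x z x' z''" using cong_add_pos assms by blast
  then have "z'' = z'" using transport_unique Q assms z'' by blast
  then show ?thesis using z'' by simp
qed

lemma cong_cancel_right_pos:
  assumes Q: "x \<in> Q" "y \<in> Q" "z \<in> Q" "x' \<in> Q" "y' \<in> Q" "z' \<in> Q"
    and "x \<lessdot> y" "y \<lessdot> z" and yz: "cong y z y' z'" and xz: "cong x z x' z'"
  shows "cong x y x' y'"
proof -
  obtain y'' where y'': "y'' \<in> Q" "cong x y x' y''" using transport Q by blast
  then have "cong y z y'' z'" using cong_cancel_left_pos assms by blast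
  then have "cong z y z' y''" "cong z y z' y'" using cong_rev Q y'' yz by blast+
  then have "y'' = y'" using transport_unique[of z y z'] Q y'' by blast
  then show ?thesis using y'' by simp
qed

text \<open>
  The axiom covers two ascending intervals. The mixed signs reduce to it by reversal and cancellation,
  according to which of the three points is in the middle.
\<close>
lemma cong_add:
  assumes Q: "a \<in> Q" "b \<in> Q" "c \<in> Q" "a' \<in> Q" "b' \<in> Q" "c' \<in> Q"
    and ab: "cong a b a' b'" and bc: "cong b c b' c'"
  shows "cong a c a' c'"
proof -
  note ba = cong_rev[OF Q(1,2,4,5) ab] and cb = cong_rev[OF Q(2,3,5,6) bc]
  consider "a = b" | "b = c" | "a = c" | "a \<lessdot> b" "b \<lessdot> c" | "c \<lessdot> b" "b \<lessdot> a"
    | "a \<lessdot> c" "c \<lessdot> b" | "c \<lessdot> a" "a \<lessdot> b" | "b \<lessdot> a" "a \<lessdot> c" | "b \<lessdot> c" "c \<lessdot> a"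
    using linear Q by metis
  then show ?thesis
  proof cases
    case 1 then show ?thesis using cong_eq_iff[OF Q(1,2,4,5) ab] bc by simp
  next
    case 2 then show ?thesis using cong_eq_iff[OF Q(2,3,5,6) bc] ab by simp
  next
    case 3
    then have "a' = c'" using transport_unique[OF Q(2,3,5,4,6)] ba bc by blast
    then show ?thesis using 3 cong_unison Q by simp
  next
    case 4 then show ?thesis using cong_add_pos[OF Q] ab bc by blast
  next
    case 5
    then have "cong c a c' a'" using cong_add_pos[OF Q(3,2,1,6,5,4)] ba cb by blast
    then show ?thesis using cong_rev Q by blast
  next
    case 6 then show ?thesis using cong_cancel_right_pos[OF Q(1,3,2,4,6,5)] ab cb by blast
  next
    case 7
    then have "cong c a c' a'" using cong_cancel_right_pos[OF Q(3,1,2,6,4,5)] ab cb by blast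
    then show ?thesis using cong_rev Q by blast
  next
    case 8 then show ?thesis using cong_cancel_left_pos[OF Q(2,1,3,5,4,6)] ba bc by blast
  next
    case 9
    then have "cong c a c' a'" using cong_cancel_left_pos[OF Q(2,3,1,5,6,4)] ba bc by blast
    then show ?thesis using cong_rev Q by blast
  qed
qed

text \<open>
  This parallelogram law is the commutativity of the group of translations; it is where the second
  half of the additivity axiom enters, through \<open>cong_swap_pos\<close>.
\<close>
lemma cong_alternate:
  assumes Q: "a \<in> Q" "b \<in> Q" "c \<in> Q" "d \<in> Q" and C: "cong a b c d"
  shows "cong a c b d"
proof -
  have upward: "cong a c b d" if Q: "a \<in> Q" "b \<in> Q" "c \<in> Q" "d \<in> Q"
    and C: "cong a b c d" and "a \<lessdot> b" "a \<lessdot> c" for a b c d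
  proof -
    obtain e where e: "e \<in> Q" "cong a c b e" using transport Q by blast
    then have "b \<lessdot> e" using cong_less Q that by blast
    moreover have "cong b e a c" using cong_sym e Q by blast
    ultimately have "cong a e a d" using cong_swap_pos[of a b e d c a] C Q e \<open>a \<lessdot> b\<close> by blast
    then have "e = d" using transport_unique[of a e a e d] cong_refl Q e by blast
    then show ?thesis using e by simp
  qed
  have positive: "cong a c b d" if Q: "a \<in> Q" "b \<in> Q" "c \<in> Q" "d \<in> Q"
    and C: "cong a b c d" and ab: "a \<lessdot> b" for a b c d
  proof -
    consider "a \<lessdot> c" | "a = c" | "c \<lessdot> a" using linear Q by blast
    then show ?thesis
    proof cases
      case 1 then show ?thesis using upward Q C ab by blast
    next
      case 2
      then have "b = d" using transport_unique[of a b a b d] cong_refl Q C by blast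
      then show ?thesis using 2 cong_unison Q by simp
    next
      case 3
      have "cong c a d b" using upward[of c d a b] cong_sym cong_less C Q ab 3 by blast
      then show ?thesis using cong_rev Q by blast
    qed
  qed
  consider "a \<lessdot> b" | "a = b" | "b \<lessdot> a" using linear Q by blast
  then show ?thesis
  proof cases
    case 1 then show ?thesis using positive Q C by blast
  next
    case 2
    then have "c = d" using cong_eq_iff Q C by blast
    then show ?thesis using 2 cong_refl Q by simp
  next
    case 3
    then have "cong b d a c" using positive[of b a d c] cong_rev C Q by blast
    then show ?thesis using cong_sym Q by blast
  qed
qed

text \<open>
  The sum of \<open>a\<close> and \<open>b\<close> when \<open>o'\<close> serves as origin.
\<close>
definition translate :: "'q \<Rightarrow> 'q \<Rightarrow> 'q \<Rightarrow> 'q" where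
  "translate o' a b = (SOME c. c \<in> Q \<and> cong o' a b c)"

definition translation_group :: "'q \<Rightarrow> 'q monoid" where
  "translation_group o' = \<lparr>carrier = Q, mult = translate o', one = o'\<rparr>"

lemma translate:
  assumes "o' \<in> Q" "a \<in> Q" "b \<in> Q"
  shows "translate o' a b \<in> Q" "cong o' a b (translate o' a b)"
proof -
  have "\<exists>c. c \<in> Q \<and> cong o' a b c" using transport assms by blast
  from someI_ex[OF this] show "translate o' a b \<in> Q" "cong o' a b (translate o' a b)"
    unfolding translate_def by auto
qed

lemma translate_eqI:
  "o' \<in> Q \<Longrightarrow> a \<in> Q \<Longrightarrow> b \<in> Q \<Longrightarrow> c \<in> Q \<Longrightarrow> cong o' a b c \<Longrightarrow> translate o' a b = c"
  using translate[of o' a b] transport_unique by blast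

lemma comm_group_translation_group:
  assumes o': "o' \<in> Q" shows "comm_group (translation_group o')"
proof (rule comm_groupI)
  fix x y z assume *: "x \<in> carrier (translation_group o')" "y \<in> carrier (translation_group o')"
    "z \<in> carrier (translation_group o')"
  then have Q: "x \<in> Q" "y \<in> Q" "z \<in> Q" by (auto simp: translation_group_def)
  let ?t = "translate o'"
  note t = translate[OF o']
  have tQ: "?t y z \<in> Q" "?t x y \<in> Q" "?t x (?t y z) \<in> Q" using t(1) Q by simp_all
  have "cong y (?t x y) o' x" using cong_sym[OF o' Q(1,2) tQ(2)] t(2) Q by simp
  then have "cong y (?t x y) (?t y z) (?t x (?t y z))"
    using cong_trans[OF Q(2) tQ(2) o' Q(1) tQ(1,3)] t(2)[OF Q(1) tQ(1)] by simp
  moreover have "cong o' y z (?t y z)" using t(2) Q by simp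
  ultimately have "cong o' (?t x y) z (?t x (?t y z))"
    using cong_add[OF o' Q(2) tQ(2) Q(3) tQ(1,3)] by simp
  then have "?t (?t x y) z = ?t x (?t y z)" using translate_eqI[OF o' tQ(2) Q(3) tQ(3)] by simp
  then show "(x \<otimes>\<^bsub>translation_group o'\<^esub> y) \<otimes>\<^bsub>translation_group o'\<^esub> z =
      x \<otimes>\<^bsub>translation_group o'\<^esub> (y \<otimes>\<^bsub>translation_group o'\<^esub> z)"
    by (simp add: translation_group_def)
next
  fix x y assume *: "x \<in> carrier (translation_group o')" "y \<in> carrier (translation_group o')"
  then have Q: "x \<in> Q" "y \<in> Q" by (auto simp: translation_group_def)
  then have "cong o' x y (translate o' y x)"
    using cong_alternate[of o' y x "translate o' y x"] translate[OF o'] o' by blast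
  then show "x \<otimes>\<^bsub>translation_group o'\<^esub> y = y \<otimes>\<^bsub>translation_group o'\<^esub> x"
    using translate_eqI translate[OF o'] Q o' by (simp add: translation_group_def)
  show "x \<otimes>\<^bsub>translation_group o'\<^esub> y \<in> carrier (translation_group o')"
    using translate[OF o'] Q by (simp add: translation_group_def)
next
  fix x assume *: "x \<in> carrier (translation_group o')"
  then have Q: "x \<in> Q" by (auto simp: translation_group_def)
  then show "\<one>\<^bsub>translation_group o'\<^esub> \<otimes>\<^bsub>translation_group o'\<^esub> x = x"
    using translate_eqI cong_unison o' by (simp add: translation_group_def)
  obtain y where y: "y \<in> Q" "cong x o' o' y" using transport Q o' by blast
  then have "translate o' y x = o'" using translate_eqI cong_sym Q o' by blast
  then show "\<exists>y\<in>carrier (translation_group o'). y \<otimes>\<^bsub>translation_group o'\<^esub> x = \<one>\<^bsub>translation_group o'\<^esub>"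
    using y by (auto simp: translation_group_def)
qed (use o' in \<open>simp add: translation_group_def\<close>)

text \<open>
  Were all multiples of some \<open>x\<close> above the origin bounded by \<open>y\<close>, the classes below some multiple of
  \<open>x\<close> would form the lower part of a Dedekind cut. That part is closed under translation by \<open>x\<close>
  and contains \<open>\<theta> - x\<close>, which lies below the cut point \<open>\<theta>\<close>; hence it contains \<open>\<theta> + x\<close>, which lies
  above the cut.
\<close>
theorem archimedean_translations:
  assumes o': "o' \<in> Q" shows "archimedean_group (translation_group o') {a \<in> Q. o' \<lessdot> a}"
proof -
  interpret comm_group "translation_group o'" by (rule comm_group_translation_group[OF o'])
  let ?G = "translation_group o'"
  have car [simp]: "carrier ?G = Q" and one [simp]: "\<one>\<^bsub>?G\<^esub> = o'"
    and mul [simp]: "x \<otimes>\<^bsub>?G\<^esub> y = translate o' x y" for x y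
    by (auto simp: translation_group_def)
  note t = translate[OF o']
  have less_shift: "b \<lessdot> translate o' a b \<longleftrightarrow> o' \<lessdot> a" if "a \<in> Q" "b \<in> Q" for a b
    using cong_less_iff[of o' a b "translate o' a b"] t that o' by blast
  have inv_shift: "translate o' (inv\<^bsub>?G\<^esub> a) a = o'" "inv\<^bsub>?G\<^esub> a \<in> Q" if "a \<in> Q" for a
    using l_inv[of a] inv_closed[of a] that by auto
  have pos_quot: "o' \<lessdot> translate o' a (inv\<^bsub>?G\<^esub> b) \<longleftrightarrow> b \<lessdot> a" if ab: "a \<in> Q" "b \<in> Q" for a b
  proof -
    have "(a \<otimes>\<^bsub>?G\<^esub> inv\<^bsub>?G\<^esub> b) \<otimes>\<^bsub>?G\<^esub> b = a" 
      using m_assoc[of a "inv\<^bsub>?G\<^esub> b" b] l_inv[of b] r_one[of a] inv_shift(2)[of b] ab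
      by (metis car)
    then show ?thesis using less_shift[of "translate o' a (inv\<^bsub>?G\<^esub> b)" b] t ab inv_shift by simp
  qed
  show ?thesis
  proof unfold_locales
    show "{a \<in> Q. o' \<lessdot> a} \<subseteq> carrier ?G" by auto
    show "x \<otimes>\<^bsub>?G\<^esub> y \<in> {a \<in> Q. o' \<lessdot> a}" if "x \<in> {a \<in> Q. o' \<lessdot> a}" "y \<in> {a \<in> Q. o' \<lessdot> a}" for x y
      using that less_shift[of x y] less_trans[OF o', of y "translate o' x y"] t by auto
    show "\<one>\<^bsub>?G\<^esub> \<notin> {a \<in> Q. o' \<lessdot> a}" using irrefl o' by simp
    show "x \<in> {a \<in> Q. o' \<lessdot> a} \<or> x = \<one>\<^bsub>?G\<^esub> \<or> inv\<^bsub>?G\<^esub> x \<in> {a \<in> Q. o' \<lessdot> a}" if x: "x \<in> carrier ?G" for x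
    proof -
      have "x \<lessdot> o' \<longleftrightarrow> o' \<lessdot> inv\<^bsub>?G\<^esub> x"
        using less_shift[of "inv\<^bsub>?G\<^esub> x" x] inv_shift x by simp
      then show ?thesis using linear[of x o'] x o' inv_shift by auto
    qed
    show "\<exists>n::nat. x [^]\<^bsub>?G\<^esub> n \<otimes>\<^bsub>?G\<^esub> inv\<^bsub>?G\<^esub> y \<in> {a \<in> Q. o' \<lessdot> a}"
      if x: "x \<in> {a \<in> Q. o' \<lessdot> a}" and y: "y \<in> carrier ?G" for x y
    proof (rule ccontr)
      assume no: "\<not> ?thesis"
      have xQ: "x \<in> Q" and ox: "o' \<lessdot> x" using x by auto
      have pw: "x [^]\<^bsub>?G\<^esub> n \<in> Q" for n :: nat using nat_pow_closed[of x n] xQ by simp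
      have ny: "\<not> y \<lessdot> x [^]\<^bsub>?G\<^esub> n" for n :: nat
        using no pos_quot[OF pw, of y n] t pw inv_shift y by auto
      define A where "A = {a \<in> Q. \<exists>n::nat. a \<lessdot> x [^]\<^bsub>?G\<^esub> n}"
      have "x [^]\<^bsub>?G\<^esub> (1::nat) = x" using l_one[of x] xQ by simp
      then have "o' \<in> A" unfolding A_def using ox o' by (metis (mono_tags, lifting) mem_Collect_eq)
      moreover have "y \<in> Q - A" unfolding A_def using ny y by simp
      moreover have "\<forall>p\<in>A. \<forall>q\<in>Q - A. \<not> q \<lessdot> p"
        unfolding A_def using less_trans pw by blast
      moreover have "A \<union> (Q - A) = Q" "A \<inter> (Q - A) = {}" unfolding A_def by blast+
      ultimately have "\<exists>\<theta>\<in>Q. \<forall>s\<in>Q. (s \<lessdot> \<theta> \<longrightarrow> s \<in> A) \<and> (\<theta> \<lessdot> s \<longrightarrow> s \<in> Q - A)"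
        by (intro dedekind) blast+
      then obtain \<theta> where th: "\<theta> \<in> Q"
        and below: "\<And>s. s \<in> Q \<Longrightarrow> s \<lessdot> \<theta> \<Longrightarrow> s \<in> A" and above: "\<And>s. s \<in> Q \<Longrightarrow> \<theta> \<lessdot> s \<Longrightarrow> s \<notin> A"
        by blast
      have stepA: "translate o' x s \<in> A" if sA: "s \<in> A" for s
      proof -
        obtain n :: nat where s: "s \<in> Q" "s \<lessdot> x [^]\<^bsub>?G\<^esub> n" using sA by (auto simp: A_def)
        have tQ: "translate o' x s \<in> Q" "translate o' x (x [^]\<^bsub>?G\<^esub> n) \<in> Q"
          using t(1) s pw xQ by simp_all
        have "cong s (translate o' x s) o' x"
          using cong_sym[OF o' xQ s(1) tQ(1)] t(2)[OF xQ s(1)] by simp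
        then have "cong s (translate o' x s) (x [^]\<^bsub>?G\<^esub> n) (translate o' x (x [^]\<^bsub>?G\<^esub> n))"
          using cong_trans[OF s(1) tQ(1) o' xQ pw[of n] tQ(2)] t(2)[OF xQ pw[of n]] by simp
        then have "cong s (x [^]\<^bsub>?G\<^esub> n) (translate o' x s) (translate o' x (x [^]\<^bsub>?G\<^esub> n))"
          using cong_alternate[OF s(1) tQ(1) pw[of n] tQ(2)] by simp
        then have "translate o' x s \<lessdot> translate o' x (x [^]\<^bsub>?G\<^esub> n)"
          using cong_less[OF s(1) pw[of n] tQ s(2)] by simp
        moreover have "translate o' x (x [^]\<^bsub>?G\<^esub> n) = x [^]\<^bsub>?G\<^esub> Suc n"
          using m_comm[of x "x [^]\<^bsub>?G\<^esub> n"] pw xQ by simp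
        ultimately have "translate o' x s \<lessdot> x [^]\<^bsub>?G\<^esub> Suc n" by (simp only:)
        then show ?thesis unfolding A_def using tQ(1) by blast
      qed
      let ?l = "translate o' (inv\<^bsub>?G\<^esub> x) \<theta>"
      have lQ: "?l \<in> Q" using t th inv_shift xQ by simp
      have xl: "translate o' x ?l = \<theta>"
        using m_assoc[of x "inv\<^bsub>?G\<^esub> x" \<theta>] xQ th inv_shift r_inv[of x] l_one[of \<theta>] by simp
      then have "?l \<lessdot> \<theta>" using less_shift[of x ?l] xQ lQ ox by simp
      then have "translate o' x \<theta> \<in> A" using stepA below lQ xl by metis
      moreover have "\<theta> \<lessdot> translate o' x \<theta>" using less_shift[of x \<theta>] xQ th ox by simp
      ultimately show False using above t th xQ by blast
    qed
  qed
qed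

text \<open>
  A logarithmic measure, with the interval from \<open>u\<close> to \<open>v\<close> as unit.
\<close>
theorem measure_exists:
  assumes u: "u \<in> Q" "v \<in> Q" "u \<lessdot> v"
  obtains \<phi> :: "'q \<Rightarrow> real"
  where "\<And>a b. a \<in> Q \<Longrightarrow> b \<in> Q \<Longrightarrow> \<phi> a < \<phi> b \<longleftrightarrow> a \<lessdot> b"
    and "\<And>a b c d. a \<in> Q \<Longrightarrow> b \<in> Q \<Longrightarrow> c \<in> Q \<Longrightarrow> d \<in> Q \<Longrightarrow>
      \<phi> b - \<phi> a = \<phi> d - \<phi> c \<longleftrightarrow> cong a b c d"
    and "\<phi> v - \<phi> u = 1"
proof -
  interpret archimedean_group "translation_group u" "{a \<in> Q. u \<lessdot> a}"
    by (rule archimedean_translations[OF u(1)])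
  have "v \<in> {a \<in> Q. u \<lessdot> a}" using u by simp
  from real_embedding[OF this] obtain \<phi> :: "'q \<Rightarrow> real" where
    hom: "\<And>x y. x \<in> carrier (translation_group u) \<Longrightarrow> y \<in> carrier (translation_group u) \<Longrightarrow>
      \<phi> (x \<otimes>\<^bsub>translation_group u\<^esub> y) = \<phi> x + \<phi> y"
    and hom_pos: "\<And>x. x \<in> {a \<in> Q. u \<lessdot> a} \<Longrightarrow> \<phi> x > 0" and v: "\<phi> v = 1"
    by blast
  have add: "\<phi> (translate u x y) = \<phi> x + \<phi> y" if "x \<in> Q" "y \<in> Q" for x y
    using hom[of x y] that by (simp add: translation_group_def)
  have pos: "\<phi> x > 0" if "x \<in> Q" "u \<lessdot> x" for x using hom_pos that by simp
  have "translate u u u = u" using translate_eqI cong_refl u by blast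
  then have u0: "\<phi> u = 0" using add[of u u] u by simp
  have diff: "\<phi> b - \<phi> a = \<phi> c" if "a \<in> Q" "b \<in> Q" "c \<in> Q" "cong u c a b" for a b c
    using translate_eqI[of u c a b] add[of c a] that u by simp
  have less: "\<phi> a < \<phi> b" if "a \<in> Q" "b \<in> Q" "a \<lessdot> b" for a b
  proof -
    obtain c where c: "c \<in> Q" "cong a b u c" using transport \<open>a \<in> Q\<close> \<open>b \<in> Q\<close> u by blast
    then have "u \<lessdot> c" "cong u c a b" using cong_less cong_sym that u by blast+
    then show ?thesis using pos[of c] diff[of a b c] c that by simp
  qed
  have less_iff: "\<phi> a < \<phi> b \<longleftrightarrow> a \<lessdot> b" if "a \<in> Q" "b \<in> Q" for a b
    using less[of a b] less[of b a] linear[of a b] that by fastforce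
  have "\<phi> b - \<phi> a = \<phi> d - \<phi> c \<longleftrightarrow> cong a b c d"
    if Q: "a \<in> Q" "b \<in> Q" "c \<in> Q" "d \<in> Q" for a b c d
  proof -
    obtain d' where d': "d' \<in> Q" "cong a b c d'" using transport Q by blast
    obtain e where e: "e \<in> Q" "cong a b u e" using transport Q u by blast
    then have "cong u e a b" "cong u e c d'"
      using cong_sym cong_trans[of u e a b c d'] d' Q u by blast+
    then have eq: "\<phi> b - \<phi> a = \<phi> d' - \<phi> c" using diff e d' Q by metis
    show ?thesis
    proof
      assume "cong a b c d"
      then show "\<phi> b - \<phi> a = \<phi> d - \<phi> c" using transport_unique d' Q eq by metis
    next
      assume "\<phi> b - \<phi> a = \<phi> d - \<phi> c"
      then have "\<phi> d = \<phi> d'" using eq by simp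
      then have "d = d'" using less_iff linear[of d d'] d' Q by force
      then show "cong a b c d" using d' by simp
    qed
  qed
  with less_iff u0 v show ?thesis by (intro that[of \<phi>]) auto
qed

end

section \<open>Pitch classes of a structure\<close>

text \<open>
  The part of the theory that determines the measure; loudness, colour and harmony are left out
  because their axioms mention the measure.
\<close>
locale pit_frame =
  fixes M :: "'a pit_structure"
  assumes wf: "pit_wf M" and pitch: "pitch_axioms M" and intv: "interval_axioms M"
    and ded: "dedekind_axiom M" and ton: "tonality_axioms M"
begin

abbreviation "S \<equiv> sounds M"
abbreviation "L \<equiv> lower M"
abbreviation "pc a \<equiv> same_pitch M `` {a}"

lemma lower_sounds: "(a, b) \<in> L \<Longrightarrow> a \<in> S \<and> b \<in> S"
  using wf unfolding pit_wf_def by blast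

lemma lower_irrefl: "(a, a) \<notin> L"
  using pitch lower_sounds unfolding pitch_axioms_def by blast

lemma lower_trans: "(a, b) \<in> L \<Longrightarrow> (b, c) \<in> L \<Longrightarrow> (a, c) \<in> L"
  using pitch unfolding pitch_axioms_def by (meson transD)

lemma same_pitch_iff: "(a, b) \<in> same_pitch M \<longleftrightarrow> a \<in> S \<and> b \<in> S \<and> (a, b) \<notin> L \<and> (b, a) \<notin> L"
  unfolding same_pitch_def by auto

lemma lower_no_common:
  assumes "(a, b) \<in> L" "(a, c) \<in> same_pitch M" shows "(b, c) \<notin> same_pitch M"
proof -
  have "\<forall>x\<in>S. \<forall>y\<in>S. (x, y) \<in> L \<longrightarrow>
      \<not> (\<exists>z\<in>S. (x, z) \<in> same_pitch M \<and> (y, z) \<in> same_pitch M)"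
    using pitch unfolding pitch_axioms_def by (elim conjE)
  moreover have "a \<in> S" "b \<in> S" "c \<in> S" using assms lower_sounds same_pitch_iff by blast+
  ultimately show ?thesis using assms by blast
qed

lemma equiv_same_pitch: "equiv S (same_pitch M)"
proof (rule equivI)
  show "same_pitch M \<subseteq> S \<times> S" unfolding same_pitch_def by auto
  show "refl_on S (same_pitch M)" using lower_irrefl by (auto intro!: refl_onI simp: same_pitch_iff)
  show "sym (same_pitch M)" by (auto intro!: symI simp: same_pitch_iff)
  show "trans (same_pitch M)"
  proof (rule transI)
    fix x y z assume "(x, y) \<in> same_pitch M" "(y, z) \<in> same_pitch M"
    then show "(x, z) \<in> same_pitch M"
      using lower_no_common[of x z y] lower_no_common[of z x y] by (auto simp: same_pitch_iff)
  qed
qed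

lemma pc_eq_iff: "a \<in> S \<Longrightarrow> b \<in> S \<Longrightarrow> pc a = pc b \<longleftrightarrow> (a, b) \<in> same_pitch M"
  using eq_equiv_class_iff[OF equiv_same_pitch] .

lemma lower_cong:
  assumes ab: "(a, b) \<in> L" and a: "(a, a') \<in> same_pitch M" and b: "(b, b') \<in> same_pitch M"
  shows "(a', b') \<in> L"
proof -
  have S: "a' \<in> S" "b \<in> S" "b' \<in> S" using a b by (auto simp: same_pitch_iff)
  have "(b, a') \<notin> L" using lower_trans[OF ab, of a'] a by (auto simp: same_pitch_iff)
  then have left: "(a', b) \<in> L"
    using lower_no_common[OF ab a] S by (auto simp: same_pitch_iff)
  have "(b', a') \<notin> L" using lower_trans[of b' a' b] left b by (auto simp: same_pitch_iff)
  moreover have "(a', b') \<notin> same_pitch M" using lower_no_common[OF left] b by blast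
  ultimately show ?thesis using S by (auto simp: same_pitch_iff)
qed

definition pcs :: "'a set set" where "pcs = S // same_pitch M"

definition pc_less :: "'a set \<Rightarrow> 'a set \<Rightarrow> bool" where
  "pc_less A B \<longleftrightarrow> (\<exists>a\<in>A. \<exists>b\<in>B. (a, b) \<in> L)"

definition pc_cong :: "'a set \<Rightarrow> 'a set \<Rightarrow> 'a set \<Rightarrow> 'a set \<Rightarrow> bool" where
  "pc_cong A B C D \<longleftrightarrow> ((A, B), (C, D)) \<in> icong M"

lemma pcsE: assumes "A \<in> pcs" obtains a where "a \<in> S" "A = pc a"
  using assms unfolding pcs_def by (rule quotientE)

lemma pcs_rep: "A \<in> pcs \<Longrightarrow> \<exists>a\<in>S. A = pc a"
  by (auto elim: pcsE)

lemma pc_in_pcs [simp]: "a \<in> S \<Longrightarrow> pc a \<in> pcs"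
  unfolding pcs_def by (rule quotientI)

lemma intervals_eq: "intervals M = pcs \<times> pcs"
  unfolding intervals_def pcs_def by simp

lemma ival_in_intervals [simp]: "a \<in> S \<Longrightarrow> b \<in> S \<Longrightarrow> ival M a b \<in> intervals M"
  by (simp add: intervals_eq ival_def)

lemma intervalsE:
  assumes "I \<in> intervals M" obtains a b where "a \<in> S" "b \<in> S" "I = ival M a b"
  using assms unfolding intervals_eq ival_def by (auto elim!: pcsE)

lemma pc_cong_ival: "pc_cong (pc a) (pc b) (pc c) (pc d) \<longleftrightarrow> (ival M a b, ival M c d) \<in> icong M"
  by (simp add: pc_cong_def ival_def)

lemma pc_less_iff:
  assumes "a \<in> S" "b \<in> S" shows "pc_less (pc a) (pc b) \<longleftrightarrow> (a, b) \<in> L"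
proof
  assume "pc_less (pc a) (pc b)"
  then obtain a' b' where "(a, a') \<in> same_pitch M" "(b, b') \<in> same_pitch M" "(a', b') \<in> L"
    unfolding pc_less_def by auto
  then show "(a, b) \<in> L" using lower_cong[of a' b' a b] by (auto simp: same_pitch_iff)
next
  assume "(a, b) \<in> L"
  then show "pc_less (pc a) (pc b)"
    unfolding pc_less_def using assms lower_irrefl
    by (intro bexI[of _ a] bexI[of _ b]) (auto simp: same_pitch_iff)
qed

lemma cong_transport:
  assumes "x \<in> S" "y \<in> S" "a \<in> S"
  obtains b where "b \<in> S" "(ival M x y, ival M a b) \<in> icong M"
    "\<And>b'. b' \<in> S \<Longrightarrow> (ival M x y, ival M a b') \<in> icong M \<Longrightarrow> (b, b') \<in> same_pitch M"
proof -
  have "\<forall>x\<in>S. \<forall>y\<in>S. \<forall>a\<in>S. \<exists>b\<in>S. (ival M x y, ival M a b) \<in> icong M \<and>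
      (\<forall>b'\<in>S. (ival M x y, ival M a b') \<in> icong M \<longrightarrow> (b, b') \<in> same_pitch M)"
    using intv unfolding interval_axioms_def by (elim conjE)
  then show ?thesis using assms that by blast
qed

lemma cong_signed:
  assumes "a \<in> S" "b \<in> S" "c \<in> S" "d \<in> S" "(a, b) \<in> L"
  shows "(ival M a b, ival M c d) \<in> icong M \<Longrightarrow> (c, d) \<in> L"
    "(ival M a b, ival M c d) \<in> icong M \<longleftrightarrow> (ival M b a, ival M d c) \<in> icong M"
proof -
  have "\<forall>a\<in>S. \<forall>b\<in>S. \<forall>c\<in>S. \<forall>d\<in>S. (a, b) \<in> L \<longrightarrow>
        ((ival M a b, ival M c d) \<in> icong M \<longrightarrow> (c, d) \<in> L) \<and>
        ((ival M a b, ival M c d) \<in> icong M \<longleftrightarrow> (ival M b a, ival M d c) \<in> icong M)"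
    using intv unfolding interval_axioms_def by (elim conjE)
  note ax = this[rule_format, OF assms]
  show "(ival M a b, ival M c d) \<in> icong M \<Longrightarrow> (c, d) \<in> L" using ax by (elim conjE) (rule mp)
  show "(ival M a b, ival M c d) \<in> icong M \<longleftrightarrow> (ival M b a, ival M d c) \<in> icong M"
    using ax by (elim conjE)
qed

lemma cong_sums:
  assumes "a \<in> S" "b \<in> S" "c \<in> S" "a' \<in> S" "b' \<in> S" "c' \<in> S" "(a, b) \<in> L" "(b, c) \<in> L"
  shows "(ival M a b, ival M a' b') \<in> icong M \<Longrightarrow> (ival M b c, ival M b' c') \<in> icong M \<Longrightarrow>
      (ival M a c, ival M a' c') \<in> icong M"
    "(ival M a b, ival M b' a') \<in> icong M \<Longrightarrow> (ival M b c, ival M c' b') \<in> icong M \<Longrightarrow>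
      (ival M a c, ival M c' a') \<in> icong M"
proof -
  have "\<forall>a\<in>S. \<forall>b\<in>S. \<forall>c\<in>S. \<forall>a'\<in>S. \<forall>b'\<in>S. \<forall>c'\<in>S. (a, b) \<in> L \<and> (b, c) \<in> L \<longrightarrow>
        ((ival M a b, ival M a' b') \<in> icong M \<and> (ival M b c, ival M b' c') \<in> icong M \<longrightarrow>
           (ival M a c, ival M a' c') \<in> icong M) \<and>
        ((ival M a b, ival M b' a') \<in> icong M \<and> (ival M b c, ival M c' b') \<in> icong M \<longrightarrow>
           (ival M a c, ival M c' a') \<in> icong M)"
    using intv unfolding interval_axioms_def by (elim conjE)
  note ax = this[rule_format, OF assms(1-6) conjI, OF assms(7,8)]
  show "(ival M a b, ival M a' b') \<in> icong M \<Longrightarrow> (ival M b c, ival M b' c') \<in> icong M \<Longrightarrow>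
      (ival M a c, ival M a' c') \<in> icong M" using ax by simp
  show "(ival M a b, ival M b' a') \<in> icong M \<Longrightarrow> (ival M b c, ival M c' b') \<in> icong M \<Longrightarrow>
      (ival M a c, ival M c' a') \<in> icong M" using ax by simp
qed

sublocale pitch_line pcs pc_less pc_cong
proof unfold_locales
  fix A B assume "A \<in> pcs" "B \<in> pcs"
  then obtain a b where ab: "a \<in> S" "A = pc a" "b \<in> S" "B = pc b"
    using pcs_rep[of A] pcs_rep[of B] by blast
  then show "pc_less A B \<or> A = B \<or> pc_less B A"
    by (simp add: pc_less_iff pc_eq_iff same_pitch_iff) blast
  show "pc_cong A B A B"
    using intv ab ival_in_intervals unfolding interval_axioms_def by (simp add: pc_cong_ival)
next
  fix A assume "A \<in> pcs"
  then show "\<not> pc_less A A" using pc_less_iff lower_irrefl pcs_rep[of A] by blast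
next
  fix A B C assume "A \<in> pcs" "B \<in> pcs" "C \<in> pcs" and less: "pc_less A B" "pc_less B C"
  then obtain a b c where *: "a \<in> S" "A = pc a" "b \<in> S" "B = pc b" "c \<in> S" "C = pc c"
    using pcs_rep[of A] pcs_rep[of B] pcs_rep[of C] by blast
  then show "pc_less A C" using less lower_trans[of a b c] by (simp add: pc_less_iff)
next
  fix A B C D P R assume "pc_cong A B C D" "pc_cong C D P R"
  then show "pc_cong A B P R"
    using intv unfolding interval_axioms_def pc_cong_def by (blast dest: transD)
next
  fix X Y A assume "X \<in> pcs" "Y \<in> pcs" "A \<in> pcs"
  then obtain x y a where *: "x \<in> S" "X = pc x" "y \<in> S" "Y = pc y" "a \<in> S" "A = pc a"
    using pcs_rep[of X] pcs_rep[of Y] pcs_rep[of A] by blast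
  obtain b where b: "b \<in> S" "(ival M x y, ival M a b) \<in> icong M"
    and unique: "\<And>b'. b' \<in> S \<Longrightarrow> (ival M x y, ival M a b') \<in> icong M \<Longrightarrow> (b, b') \<in> same_pitch M"
    using cong_transport[OF *(1,3,5)] by blast
  show "\<exists>B\<in>pcs. pc_cong X Y A B"
    using b * by (intro bexI[of _ "pc b"]) (simp_all add: pc_cong_ival)
  fix B B' assume B: "B \<in> pcs" "B' \<in> pcs" "pc_cong X Y A B" "pc_cong X Y A B'"
  then obtain c c' where c: "c \<in> S" "B = pc c" "c' \<in> S" "B' = pc c'"
    using pcs_rep[of B] pcs_rep[of B'] by blast
  have "(b, c) \<in> same_pitch M" "(b, c') \<in> same_pitch M"
    using unique B * c by (auto simp: pc_cong_ival)
  then show "B = B'" using pc_eq_iff b(1) c by metis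
next
  fix A B C D assume "A \<in> pcs" "B \<in> pcs" "C \<in> pcs" "D \<in> pcs" and less: "pc_less A B"
  then obtain a b c d where *: "a \<in> S" "A = pc a" "b \<in> S" "B = pc b" "c \<in> S" "C = pc c"
    "d \<in> S" "D = pc d"
    using pcs_rep[of A] pcs_rep[of B] pcs_rep[of C] pcs_rep[of D] by blast
  then have ab: "(a, b) \<in> L" using less by (simp add: pc_less_iff)
  show "pc_cong A B C D \<Longrightarrow> pc_less C D" "pc_cong A B C D \<longleftrightarrow> pc_cong B A D C"
    using cong_signed[OF *(1,3,5,7) ab] * by (simp_all add: pc_cong_ival pc_less_iff)
next
  fix A B C A' B' C' assume "A \<in> pcs" "B \<in> pcs" "C \<in> pcs" "A' \<in> pcs" "B' \<in> pcs" "C' \<in> pcs"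
    and less: "pc_less A B" "pc_less B C"
  then obtain a b c a' b' c' where *: "a \<in> S" "A = pc a" "b \<in> S" "B = pc b" "c \<in> S" "C = pc c"
    "a' \<in> S" "A' = pc a'" "b' \<in> S" "B' = pc b'" "c' \<in> S" "C' = pc c'"
    using pcs_rep[of A] pcs_rep[of B] pcs_rep[of C] pcs_rep[of A'] pcs_rep[of B'] pcs_rep[of C'] by blast
  have ab: "(a, b) \<in> L" and bc: "(b, c) \<in> L" using less * by (simp_all add: pc_less_iff)
  show "pc_cong A B A' B' \<Longrightarrow> pc_cong B C B' C' \<Longrightarrow> pc_cong A C A' C'"
    "pc_cong A B B' A' \<Longrightarrow> pc_cong B C C' B' \<Longrightarrow> pc_cong A C C' A'"
    using cong_sums[OF *(1,3,5,7,9,11) ab bc] * by (simp_all add: pc_cong_ival)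
next
  fix A B assume AB: "A \<union> B = pcs" "A \<inter> B = {}" "A \<noteq> {}" "B \<noteq> {}"
    and cut: "\<forall>p\<in>A. \<forall>q\<in>B. \<not> pc_less q p"
  let ?P = "{s \<in> S. pc s \<in> A}" and ?Q = "{s \<in> S. pc s \<in> B}"
  have "?P \<union> ?Q = S" "?P \<inter> ?Q = {}" using AB pc_in_pcs by auto
  moreover have "?P \<noteq> {}" "?Q \<noteq> {}"
  proof -
    obtain a b where "a \<in> A" "b \<in> B" using AB by blast
    then have "a \<in> pcs" "b \<in> pcs" using AB by blast+
    then show "?P \<noteq> {}" "?Q \<noteq> {}" using \<open>a \<in> A\<close> \<open>b \<in> B\<close> by (auto elim!: pcsE)
  qed
  moreover have "\<not> (\<exists>q\<in>?Q. \<exists>p\<in>?P. (q, p) \<in> L)" using cut pc_less_iff by auto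
  ultimately have "\<exists>\<theta>\<in>S. \<forall>s\<in>S. ((s, \<theta>) \<in> L \<longrightarrow> s \<in> ?P) \<and> ((\<theta>, s) \<in> L \<longrightarrow> s \<in> ?Q)"
    by (intro ded[unfolded dedekind_axiom_def, THEN spec, THEN spec, THEN mp] conjI)
  then obtain t where t: "t \<in> S"
    and ts: "\<And>s. s \<in> S \<Longrightarrow> ((s, t) \<in> L \<longrightarrow> s \<in> ?P) \<and> ((t, s) \<in> L \<longrightarrow> s \<in> ?Q)"
    by blast
  have "\<forall>s\<in>pcs. (pc_less s (pc t) \<longrightarrow> s \<in> A) \<and> (pc_less (pc t) s \<longrightarrow> s \<in> B)"
  proof
    fix s assume "s \<in> pcs"
    then obtain x where "x \<in> S" "s = pc x" by (rule pcsE)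
    then show "(pc_less s (pc t) \<longrightarrow> s \<in> A) \<and> (pc_less (pc t) s \<longrightarrow> s \<in> B)"
      using ts[of x] t by (simp add: pc_less_iff)
  qed
  then show "\<exists>\<theta>\<in>pcs. \<forall>s\<in>pcs. (pc_less s \<theta> \<longrightarrow> s \<in> A) \<and> (pc_less \<theta> s \<longrightarrow> s \<in> B)"
    using t by (intro bexI[of _ "pc t"]) auto
qed

end

section \<open>The interval measure\<close>

context pit_frame begin

lemma equitonal_sounds: "(x, y) \<in> equitonal M \<Longrightarrow> x \<in> S \<and> y \<in> S"
  using wf unfolding pit_wf_def by blast

lemma same_pitch_equitonal: "(x, y) \<in> same_pitch M \<Longrightarrow> (x, y) \<in> equitonal M"
  using ton unfolding tonality_axioms_def by blast

lemma equitonal_euclidean: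
  assumes "(x, z) \<in> equitonal M" "(y, z) \<in> equitonal M" shows "(x, y) \<in> equitonal M"
proof -
  have "\<forall>x\<in>S. \<forall>y\<in>S. \<forall>z\<in>S.
      (x, z) \<in> equitonal M \<and> (y, z) \<in> equitonal M \<longrightarrow> (x, y) \<in> equitonal M"
    using ton unfolding tonality_axioms_def by (elim conjE)
  then show ?thesis using assms equitonal_sounds by blast
qed

lemma same_pitch_refl: "x \<in> S \<Longrightarrow> (x, x) \<in> same_pitch M"
  using lower_irrefl by (simp add: same_pitch_iff)

lemma same_pitch_sym: "(x, y) \<in> same_pitch M \<Longrightarrow> (y, x) \<in> same_pitch M"
  by (simp add: same_pitch_iff)

lemma equitonal_refl: "x \<in> S \<Longrightarrow> (x, x) \<in> equitonal M"
  by (intro same_pitch_equitonal same_pitch_refl)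

lemma equitonal_sym: "(x, y) \<in> equitonal M \<Longrightarrow> (y, x) \<in> equitonal M"
  using equitonal_euclidean[of y y x] equitonal_refl[of y] equitonal_sounds by blast

lemma equitonal_trans:
  "(x, y) \<in> equitonal M \<Longrightarrow> (y, z) \<in> equitonal M \<Longrightarrow> (x, z) \<in> equitonal M"
  using equitonal_euclidean[of x y z] equitonal_sym[of y z] by blast

lemma equitonal_above_cong:
  assumes "(s, s') \<in> same_pitch M" "t \<in> equitonal_above M s" "(t, t') \<in> same_pitch M"
  shows "t' \<in> equitonal_above M s'"
proof -
  have t: "(t, s) \<in> equitonal M" "(s, t) \<in> L" using assms(2) by (auto simp: equitonal_above_def)
  have "(t', t) \<in> equitonal M" "(s, s') \<in> equitonal M"
    using same_pitch_equitonal same_pitch_sym assms by blast+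
  then have "(t', s') \<in> equitonal M" using equitonal_trans t(1) by blast
  moreover have "(s', t') \<in> L" using lower_cong[OF t(2)] assms by blast
  ultimately show ?thesis using assms(3) by (auto simp: equitonal_above_def same_pitch_iff)
qed

lemma ival_eq_iff:
  assumes "a \<in> S" "b \<in> S" "c \<in> S" "d \<in> S"
  shows "ival M a b = ival M c d \<longleftrightarrow> (a, c) \<in> same_pitch M \<and> (b, d) \<in> same_pitch M"
  using assms by (simp add: ival_def pc_eq_iff)

lemma octave_iff:
  assumes st: "s \<in> S" "t \<in> S"
  shows "ival M s t \<in> octave_intervals M \<longleftrightarrow>
    t \<in> equitonal_above M s \<and> \<not> (\<exists>y\<in>equitonal_above M s. (y, t) \<in> L)"
proof
  assume "ival M s t \<in> octave_intervals M"
  then obtain a b where ab: "a \<in> S" "b \<in> equitonal_above M a" "ival M s t = ival M a b"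
    and minimal: "\<not> (\<exists>y\<in>equitonal_above M a. (y, b) \<in> L)"
    unfolding octave_intervals_def by blast
  then have "b \<in> S" by (simp add: equitonal_above_def)
  then have sp: "(s, a) \<in> same_pitch M" "(t, b) \<in> same_pitch M" using ab st ival_eq_iff by blast+
  have "t \<in> equitonal_above M s"
    using equitonal_above_cong[OF same_pitch_sym[OF sp(1)] ab(2) same_pitch_sym[OF sp(2)]] .
  moreover have "(y, t) \<notin> L" if y: "y \<in> equitonal_above M s" for y
  proof
    assume yt: "(y, t) \<in> L"
    then have yy: "(y, y) \<in> same_pitch M" using lower_sounds same_pitch_refl by blast
    then show False
      using equitonal_above_cong[OF sp(1) y yy] lower_cong[OF yt yy sp(2)] minimal by blast
  qed
  ultimately show "t \<in> equitonal_above M s \<and> \<not> (\<exists>y\<in>equitonal_above M s. (y, t) \<in> L)" by blast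
next
  assume "t \<in> equitonal_above M s \<and> \<not> (\<exists>y\<in>equitonal_above M s. (y, t) \<in> L)"
  then show "ival M s t \<in> octave_intervals M" unfolding octave_intervals_def using st by blast
qed

lemma octave_intervals_subset: "octave_intervals M \<subseteq> intervals M"
  unfolding octave_intervals_def equitonal_above_def by auto

lemma octave_cong_closed:
  "I \<in> octave_intervals M \<Longrightarrow> J \<in> intervals M \<Longrightarrow> (J, I) \<in> icong M \<Longrightarrow> J \<in> octave_intervals M"
  using ton unfolding tonality_axioms_def by blast

lemma icong_sym: "(I, J) \<in> icong M \<Longrightarrow> (J, I) \<in> icong M"
proof -
  assume IJ: "(I, J) \<in> icong M"
  obtain A B C D where eq: "I = (A, B)" "J = (C, D)" by fastforce
  have "I \<in> intervals M" "J \<in> intervals M" using wf IJ unfolding pit_wf_def by blast+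
  then show ?thesis using cong_sym[of A B C D] IJ by (simp add: intervals_eq eq pc_cong_def)
qed

lemma octave_transport:
  assumes I: "I \<in> octave_intervals M" and s: "s \<in> S"
  obtains t where "t \<in> S" "ival M s t \<in> octave_intervals M" "(I, ival M s t) \<in> icong M"
proof -
  obtain a b where ab: "a \<in> S" "b \<in> S" "I = ival M a b"
    using I octave_intervals_subset intervalsE by blast
  obtain t where t: "t \<in> S" "(ival M a b, ival M s t) \<in> icong M"
    using cong_transport[OF ab(1,2) s] by blast
  then have "ival M s t \<in> octave_intervals M"
    using octave_cong_closed[OF I] icong_sym ab s by simp
  then show ?thesis using that t ab by blast
qed

text \<open>
  Transport one octave to the start of the other. The result is again an octave interval, and two
  minimal equitonal sounds above the same sound have the same pitch.
\<close>
lemma octaves_congruent: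
  assumes I: "I \<in> octave_intervals M" and J: "J \<in> octave_intervals M" shows "(I, J) \<in> icong M"
proof -
  obtain s t where st: "s \<in> S" "t \<in> S" "J = ival M s t"
    using J octave_intervals_subset intervalsE by blast
  obtain t' where t': "t' \<in> S" "ival M s t' \<in> octave_intervals M" "(I, ival M s t') \<in> icong M"
    using octave_transport[OF I st(1)] .
  have "(t, t') \<notin> L" "(t', t) \<notin> L"
    using J t'(2) octave_iff[OF st(1,2)] octave_iff[OF st(1) t'(1)] st(3) by blast+
  then have "J = ival M s t'" using st t'(1) same_pitch_refl by (simp add: ival_eq_iff same_pitch_iff)
  then show ?thesis using t'(3) by simp
qed

lemma octave_exists: "\<exists>I. I \<in> octave_intervals M"
  using ton unfolding tonality_axioms_def by blast

lemma is_imeasureD: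
  assumes "is_imeasure M \<mu>"
  shows "I \<in> intervals M \<Longrightarrow> \<mu> I > 0"
    and "I \<in> octave_intervals M \<Longrightarrow> \<mu> I = 2"
    and "a \<in> S \<Longrightarrow> b \<in> S \<Longrightarrow> \<mu> (ival M a b) > 1 \<longleftrightarrow> (a, b) \<in> L"
    and "a \<in> S \<Longrightarrow> b \<in> S \<Longrightarrow> \<mu> (ival M a b) = 1 \<longleftrightarrow> (a, b) \<in> same_pitch M"
    and "a \<in> S \<Longrightarrow> b \<in> S \<Longrightarrow> \<mu> (ival M a b) < 1 \<longleftrightarrow> (b, a) \<in> L"
    and "I \<in> intervals M \<Longrightarrow> J \<in> intervals M \<Longrightarrow> \<mu> I = \<mu> J \<longleftrightarrow> (I, J) \<in> icong M"
    and "a \<in> S \<Longrightarrow> b \<in> S \<Longrightarrow> c \<in> S \<Longrightarrow> \<mu> (ival M a c) = \<mu> (ival M a b) * \<mu> (ival M b c)"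
  using assms unfolding is_imeasure_def by blast+

text \<open>
  With the octave as the unit of the logarithmic measure, exponentiation to base 2 assigns 2 to every
  octave interval.
\<close>
lemma imeasure_exists: "\<exists>\<mu>. is_imeasure M \<mu>"
proof -
  obtain I where I: "I \<in> octave_intervals M" using octave_exists by blast
  then obtain s t where st: "s \<in> S" "t \<in> S" "I = ival M s t"
    using octave_intervals_subset intervalsE by blast
  have "(s, t) \<in> L" using I st octave_iff by (auto simp: equitonal_above_def)
  then have less: "pc s \<in> pcs" "pc t \<in> pcs" "pc_less (pc s) (pc t)" using st pc_less_iff by auto
  obtain \<phi> :: "'a set \<Rightarrow> real" where
    \<phi>_less: "\<And>A B. A \<in> pcs \<Longrightarrow> B \<in> pcs \<Longrightarrow> \<phi> A < \<phi> B \<longleftrightarrow> pc_less A B" and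
    \<phi>_cong: "\<And>A B C D. A \<in> pcs \<Longrightarrow> B \<in> pcs \<Longrightarrow> C \<in> pcs \<Longrightarrow> D \<in> pcs \<Longrightarrow>
      \<phi> B - \<phi> A = \<phi> D - \<phi> C \<longleftrightarrow> pc_cong A B C D" and
    \<phi>_oct: "\<phi> (pc t) - \<phi> (pc s) = 1"
    using measure_exists[OF less] by blast
  define \<mu> where "\<mu> = (\<lambda>I. 2 powr (\<phi> (snd I) - \<phi> (fst I)))"
  have \<mu>_ival: "\<mu> (ival M a b) = 2 powr (\<phi> (pc b) - \<phi> (pc a))" for a b
    by (simp add: \<mu>_def ival_def)
  have one: "\<mu> (ival M a b) > 1 \<longleftrightarrow> \<phi> (pc a) < \<phi> (pc b)" "\<mu> (ival M a b) < 1 \<longleftrightarrow> \<phi> (pc b) < \<phi> (pc a)"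
    for a b
    using powr_less_cancel_iff[of 2 0 "\<phi> (pc b) - \<phi> (pc a)"]
      powr_less_cancel_iff[of 2 "\<phi> (pc b) - \<phi> (pc a)" 0] by (simp_all add: \<mu>_ival)
  have \<mu>_cong: "\<mu> I = \<mu> J \<longleftrightarrow> (I, J) \<in> icong M" if IJ: "I \<in> intervals M" "J \<in> intervals M" for I J
  proof -
    obtain A B C D where "I = (A, B)" "J = (C, D)" by fastforce
    then show ?thesis using \<phi>_cong[of A B C D] IJ
      by (simp add: \<mu>_def intervals_eq pc_cong_def powr_inj)
  qed
  have "\<mu> J = 2" if J: "J \<in> octave_intervals M" for J
  proof -
    have "\<mu> J = \<mu> I" using \<mu>_cong octaves_congruent I J octave_intervals_subset by blast
    then show ?thesis using \<phi>_oct by (simp add: st \<mu>_ival)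
  qed
  moreover have "\<mu> I > 0" for I by (simp add: \<mu>_def)
  moreover have "\<mu> (ival M a c) = \<mu> (ival M a b) * \<mu> (ival M b c)" for a b c
    by (simp add: \<mu>_ival powr_add[symmetric])
  moreover have "\<mu> (ival M a b) > 1 \<longleftrightarrow> (a, b) \<in> L" "\<mu> (ival M a b) < 1 \<longleftrightarrow> (b, a) \<in> L"
    if "a \<in> S" "b \<in> S" for a b
    unfolding one using that \<phi>_less pc_less_iff by auto
  moreover from this have "\<mu> (ival M a b) = 1 \<longleftrightarrow> (a, b) \<in> same_pitch M" if "a \<in> S" "b \<in> S" for a b
    using that unfolding same_pitch_iff by (metis less_irrefl linorder_neqE_linordered_idom)
  ultimately have "is_imeasure M \<mu>" unfolding is_imeasure_def using \<mu>_cong by blast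
  then show ?thesis by blast
qed

text \<open>
  Copies of an interval are stacked by congruence alone, so one end point \<open>c\<close> serves both measures.
\<close>
lemma imeasure_chain:
  assumes \<mu>: "is_imeasure M \<mu>" and \<nu>: "is_imeasure M \<nu>" and ab: "a \<in> S" "b \<in> S" "x \<in> S"
  shows "\<exists>c\<in>S. \<mu> (ival M x c) = \<mu> (ival M a b) ^ n \<and> \<nu> (ival M x c) = \<nu> (ival M a b) ^ n"
proof (induction n)
  case 0
  show ?case using is_imeasureD(4)[OF \<mu>] is_imeasureD(4)[OF \<nu>] ab same_pitch_refl
    by (intro bexI[of _ x]) auto
next
  case (Suc n)
  then obtain c where c: "c \<in> S" "\<mu> (ival M x c) = \<mu> (ival M a b) ^ n"
    "\<nu> (ival M x c) = \<nu> (ival M a b) ^ n" by blast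
  obtain d where d: "d \<in> S" "(ival M a b, ival M c d) \<in> icong M"
    using cong_transport[OF ab(1,2) c(1)] by blast
  have "\<mu> (ival M a b) = \<mu> (ival M c d)" "\<nu> (ival M a b) = \<nu> (ival M c d)"
    using is_imeasureD(6)[OF \<mu>] is_imeasureD(6)[OF \<nu>] d ab c by simp_all
  then show ?case
    using is_imeasureD(7)[OF \<mu> ab(3) c(1) d(1)] is_imeasureD(7)[OF \<nu> ab(3) c(1) d(1)] c d(1)
    by (intro bexI[of _ d]) (auto simp: mult_ac)
qed

lemma power_of_two_between:
  fixes x y :: real
  assumes "1 < x" "x < y" obtains m n :: nat where "x ^ n < 2 ^ m" "2 ^ m < y ^ n"
proof -
  have l: "0 < log 2 x" "log 2 x < log 2 y" using assms by simp_all
  obtain n :: nat where n: "1 < real n * (log 2 y - log 2 x)"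
    using reals_Archimedean3[of "log 2 y - log 2 x"] l by auto
  define m where "m = nat (\<lceil>real n * log 2 y\<rceil> - 1)"
  have pos: "real n * log 2 x \<ge> 0" using l by simp
  then have "real n * log 2 y > 1" using n by (simp add: algebra_simps)
  then have "real m = of_int \<lceil>real n * log 2 y\<rceil> - 1" unfolding m_def by (simp add: of_nat_nat)
  then have m: "real m < real n * log 2 y" "real n * log 2 x < real m"
    using n by (simp_all add: algebra_simps) linarith+
  have pw: "z ^ n = 2 powr (real n * log 2 z)" if "z > 1" for z :: real
    using that by (simp add: powr_mult_base powr_powr[symmetric] powr_realpow mult.commute[of "real n"])
  have "2 ^ m = (2::real) powr m" by (simp add: powr_realpow)
  then have "x ^ n < 2 ^ m" "2 ^ m < y ^ n" using m pw[of x] pw[of y] assms by simp_all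
  then show ?thesis by (rule that)
qed

text \<open>
  If \<open>\<mu> < \<nu>\<close> on \<open>[a, b]\<close>, choose \<open>\<mu> ^ n < 2 ^ m < \<nu> ^ n\<close>. Then \<open>n\<close> copies of \<open>[a, b]\<close> end below \<open>m\<close>
  octaves according to \<open>\<mu>\<close> and above them according to \<open>\<nu>\<close>, while the order of the two end points
  is the same for both.
\<close>
lemma imeasure_le:
  assumes \<mu>: "is_imeasure M \<mu>" and \<nu>: "is_imeasure M \<nu>" and ab: "(a, b) \<in> L"
  shows "\<nu> (ival M a b) \<le> \<mu> (ival M a b)"
proof (rule ccontr)
  assume less: "\<not> ?thesis"
  have S: "a \<in> S" "b \<in> S" using ab lower_sounds by auto
  have "1 < \<mu> (ival M a b)" using is_imeasureD(3)[OF \<mu> S] ab by simp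
  then obtain m n :: nat where mn: "\<mu> (ival M a b) ^ n < 2 ^ m" "2 ^ m < \<nu> (ival M a b) ^ n"
    using power_of_two_between less by (metis not_le)
  obtain I where I: "I \<in> octave_intervals M" using octave_exists by blast
  obtain s t where st: "s \<in> S" "t \<in> S" "I = ival M s t"
    using I octave_intervals_subset intervalsE by blast
  obtain c where c: "c \<in> S" "\<mu> (ival M a c) = \<mu> (ival M a b) ^ n" "\<nu> (ival M a c) = \<nu> (ival M a b) ^ n"
    using imeasure_chain[OF \<mu> \<nu> S S(1)] by blast
  obtain d where d: "d \<in> S" "\<mu> (ival M a d) = 2 ^ m" "\<nu> (ival M a d) = 2 ^ m"
    using imeasure_chain[OF \<mu> \<nu> st(1,2) S(1)] is_imeasureD(2)[OF \<mu> I] is_imeasureD(2)[OF \<nu> I] st(3)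
    by metis
  have pos: "\<mu> (ival M a c) > 0" "\<nu> (ival M a c) > 0"
    using is_imeasureD(1)[OF \<mu>] is_imeasureD(1)[OF \<nu>] S c(1) by auto
  have "\<mu> (ival M a c) * 1 < \<mu> (ival M a c) * \<mu> (ival M c d)"
    using is_imeasureD(7)[OF \<mu> S(1) c(1) d(1)] c d mn by simp
  then have "(c, d) \<in> L" using is_imeasureD(3)[OF \<mu> c(1) d(1)] pos by simp
  moreover have "\<nu> (ival M a c) * \<nu> (ival M c d) < \<nu> (ival M a c) * 1"
    using is_imeasureD(7)[OF \<nu> S(1) c(1) d(1)] c d mn by simp
  then have "(d, c) \<in> L" using is_imeasureD(5)[OF \<nu> c(1) d(1)] pos by simp
  ultimately show False using lower_trans lower_irrefl by blast
qed

lemma imeasure_unique: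
  assumes \<mu>: "is_imeasure M \<mu>" and \<nu>: "is_imeasure M \<nu>" and I: "I \<in> intervals M"
  shows "\<mu> I = \<nu> I"
proof -
  obtain a b where S: "a \<in> S" "b \<in> S" and I_eq: "I = ival M a b" using I by (rule intervalsE)
  have up: "\<mu> (ival M x y) = \<nu> (ival M x y)" if "(x, y) \<in> L" for x y
    using imeasure_le[OF \<mu> \<nu> that] imeasure_le[OF \<nu> \<mu> that] by simp
  consider "(a, b) \<in> L" | "(b, a) \<in> L" | "(a, b) \<in> same_pitch M" using S by (auto simp: same_pitch_iff)
  then show ?thesis
  proof cases
    case 1 then show ?thesis using up I_eq by simp
  next
    case 2
    have inv: "\<kappa> (ival M a b) = 1 / \<kappa> (ival M b a)" if \<kappa>: "is_imeasure M \<kappa>" for \<kappa>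
    proof -
      have "1 = \<kappa> (ival M a b) * \<kappa> (ival M b a)"
        using is_imeasureD(4)[OF \<kappa> S(1) S(1)] is_imeasureD(7)[OF \<kappa> S S(1)] same_pitch_refl S by simp
      then show ?thesis using is_imeasureD(1)[OF \<kappa>, of "ival M b a"] S by (simp add: field_simps)
    qed
    show ?thesis using up[OF 2] inv[OF \<mu>] inv[OF \<nu>] I_eq by simp
  next
    case 3 then show ?thesis using is_imeasureD(4)[OF \<mu> S] is_imeasureD(4)[OF \<nu> S] I_eq by simp
  qed
qed

lemma is_imeasure_restrict:
  assumes "is_imeasure M \<mu>" shows "is_imeasure M (restrict \<mu> (intervals M))"
proof -
  have oct: "I \<in> intervals M" if "I \<in> octave_intervals M" for I
    using that octave_intervals_subset by blast
  note D = is_imeasureD[OF assms]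
  show ?thesis unfolding is_imeasure_def
    by (intro conjI ballI; simp only: restrict_apply' ival_in_intervals oct; rule D; assumption)
qed

text \<open>
  Existence and uniqueness together discharge the definite description; extensionality settles the
  values off the intervals.
\<close>
theorem is_imeasure_imeasure: "is_imeasure M (imeasure M)"
proof -
  obtain \<mu> where "is_imeasure M \<mu>" using imeasure_exists by blast
  then have \<mu>: "restrict \<mu> (intervals M) \<in> extensional (intervals M) \<and>
      is_imeasure M (restrict \<mu> (intervals M))"
    using is_imeasure_restrict by simp
  have "\<exists>!\<nu>. \<nu> \<in> extensional (intervals M) \<and> is_imeasure M \<nu>"
  proof (rule ex1I)
    show "restrict \<mu> (intervals M) \<in> extensional (intervals M) \<and>
      is_imeasure M (restrict \<mu> (intervals M))" by (fact \<mu>)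
    show "\<nu> = restrict \<mu> (intervals M)" if \<nu>: "\<nu> \<in> extensional (intervals M) \<and> is_imeasure M \<nu>" for \<nu>
    proof (rule extensionalityI[of _ "intervals M"])
      show "\<nu> I = restrict \<mu> (intervals M) I" if "I \<in> intervals M" for I
        using imeasure_unique[OF conjunct2[OF \<nu>] conjunct2[OF \<mu>] that] .
    qed (use \<mu> \<nu> in blast)+
  qed
  from theI'[OF this] show ?thesis unfolding imeasure_def ..
qed

end

section \<open>Equitonality, harmonic intervals and the semitone\<close>

context pit_frame begin

abbreviation "msr a b \<equiv> imeasure M (ival M a b)"

lemmas msr_interval_pos = is_imeasureD(1)[OF is_imeasure_imeasure]
lemmas msr_octave = is_imeasureD(2)[OF is_imeasure_imeasure]
lemmas msr_gt_1 = is_imeasureD(3)[OF is_imeasure_imeasure]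
lemmas msr_eq_1 = is_imeasureD(4)[OF is_imeasure_imeasure]
lemmas msr_cong = is_imeasureD(6)[OF is_imeasure_imeasure]
lemmas msr_mult = is_imeasureD(7)[OF is_imeasure_imeasure]

lemma msr_pos: "a \<in> S \<Longrightarrow> b \<in> S \<Longrightarrow> msr a b > 0"
  by (simp add: msr_interval_pos)

lemma msr_refl: "a \<in> S \<Longrightarrow> msr a a = 1"
  using msr_eq_1[of a a] same_pitch_refl by blast

lemma msr_rev: "a \<in> S \<Longrightarrow> b \<in> S \<Longrightarrow> msr b a = inverse (msr a b)"
  using msr_mult[of a b a] msr_refl[of a] msr_pos[of a b] by (simp add: field_simps)

lemma msr_transport:
  assumes "a \<in> S" "b \<in> S" "x \<in> S" obtains c where "c \<in> S" "msr x c = msr a b"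
proof -
  obtain c where c: "c \<in> S" "(ival M a b, ival M x c) \<in> icong M"
    using cong_transport[OF assms] by blast
  then have "msr a b = msr x c" using msr_cong[of "ival M a b" "ival M x c"] assms by simp
  then show ?thesis using that c(1) by simp
qed

lemma octave_iff_msr:
  assumes "a \<in> S" "b \<in> S" shows "ival M a b \<in> octave_intervals M \<longleftrightarrow> msr a b = 2"
proof
  obtain I where I: "I \<in> octave_intervals M" using octave_exists by blast
  assume "msr a b = 2"
  then have "(ival M a b, I) \<in> icong M"
    using msr_octave[OF I] msr_cong[of "ival M a b" I] I octave_intervals_subset assms by auto
  then show "ival M a b \<in> octave_intervals M" using octave_cong_closed[OF I] assms by simp
qed (rule msr_octave)

lemma octave_equitonal: "a \<in> S \<Longrightarrow> b \<in> S \<Longrightarrow> msr a b = 2 \<Longrightarrow> (a, b) \<in> equitonal M"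
  using octave_iff_msr[of a b] octave_iff[of a b] equitonal_sym by (auto simp: equitonal_above_def)

lemma equitonal_powers:
  assumes x: "x \<in> S" shows "\<exists>y\<in>S. msr x y = 2 powr of_int k \<and> (x, y) \<in> equitonal M"
proof (induction k rule: int_induct[where k = 0])
  case base
  then show ?case using msr_refl equitonal_refl x by auto
next
  case (step1 k)
  then obtain y where y: "y \<in> S" "msr x y = 2 powr of_int k" "(x, y) \<in> equitonal M" by blast
  obtain I where I: "I \<in> octave_intervals M" using octave_exists by blast
  obtain z where z: "z \<in> S" "ival M y z \<in> octave_intervals M" using octave_transport[OF I y(1)] by blast
  then have "msr y z = 2" by (simp add: msr_octave)
  then show ?case
    using msr_mult[OF x y(1) z(1)] y octave_equitonal[OF y(1) z(1)] equitonal_trans[of x y z] z(1)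
    by (intro bexI[of _ z]) (auto simp: powr_add)
next
  case (step2 k)
  then obtain y where y: "y \<in> S" "msr x y = 2 powr of_int k" "(x, y) \<in> equitonal M" by blast
  obtain I where I: "I \<in> octave_intervals M" using octave_exists by blast
  obtain z where z: "z \<in> S" "ival M y z \<in> octave_intervals M" using octave_transport[OF I y(1)] by blast
  obtain w where w: "w \<in> S" "msr y w = msr z y" using msr_transport[OF z(1) y(1) y(1)] by blast
  have "msr y z = 2" using z by (simp add: msr_octave)
  then have yw: "msr y w = 1 / 2" using w msr_rev[OF y(1) z(1)] by simp
  then have "msr w y = 2" by (simp only: msr_rev[OF y(1) w(1)]) simp
  then have "(y, w) \<in> equitonal M" using octave_equitonal[OF w(1) y(1)] equitonal_sym by blast
  then show ?case
    using msr_mult[OF x y(1) w(1)] y yw equitonal_trans[of x y w] w(1)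
    by (intro bexI[of _ w]) (auto simp: powr_diff)
qed

text \<open>
  Octaves can be stacked in both directions from any sound. A sound equitonal to \<open>x\<close> but strictly
  between two successive octave points would lie below the upper one and above the lower, against the
  minimality in the definition of octave intervals.
\<close>
theorem equitonal_iff:
  assumes xy: "x \<in> S" "y \<in> S"
  shows "(x, y) \<in> equitonal M \<longleftrightarrow> (\<exists>k::int. msr x y = 2 powr of_int k)"
proof
  assume "\<exists>k::int. msr x y = 2 powr of_int k"
  then obtain k :: int where k: "msr x y = 2 powr of_int k" ..
  obtain z where z: "z \<in> S" "msr x z = 2 powr of_int k" "(x, z) \<in> equitonal M"
    using equitonal_powers[OF xy(1)] by blast
  have "msr z y = 1" using msr_mult[OF xy(1) z(1) xy(2)] z(2) k by simp
  then show "(x, y) \<in> equitonal M"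
    using msr_eq_1[OF z(1) xy(2)] same_pitch_equitonal z(3) equitonal_trans by blast
next
  assume eq: "(x, y) \<in> equitonal M"
  define k where "k = \<lfloor>log 2 (msr x y)\<rfloor>"
  obtain z where z: "z \<in> S" "msr x z = 2 powr of_int k" "(x, z) \<in> equitonal M"
    using equitonal_powers[OF xy(1)] by blast
  have zy: "msr x y = 2 powr of_int k * msr z y" using msr_mult[OF xy(1) z(1) xy(2)] z(2) by simp
  have "2 powr of_int k \<le> msr x y"
    using powr_mono[of "of_int k" "log 2 (msr x y)" 2] msr_pos[OF xy] by (simp add: k_def)
  then have ge: "msr z y \<ge> 1" unfolding zy by simp
  have "msr x y < 2 powr of_int (k + 1)"
    using powr_less_mono[of "log 2 (msr x y)" "of_int (k + 1)" 2] msr_pos[OF xy] unfolding k_def by simp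
  then have lt: "msr z y < 2" unfolding zy by (simp add: powr_add)
  have "\<not> msr z y > 1"
  proof
    assume gt: "msr z y > 1"
    obtain I where I: "I \<in> octave_intervals M" using octave_exists by blast
    obtain t where t: "t \<in> S" "ival M z t \<in> octave_intervals M" using octave_transport[OF I z(1)] by blast
    have "msr z y * msr y t = 2" using msr_mult[OF z(1) xy(2) t(1)] t by (simp add: msr_octave)
    moreover have "msr z y * msr y t \<le> msr z y" if "msr y t \<le> 1"
      using mult_left_mono[OF that, of "msr z y"] gt by simp
    ultimately have "msr y t > 1" using lt by linarith
    then have yt: "(y, t) \<in> L" using msr_gt_1[OF xy(2) t(1)] by blast
    have "(y, z) \<in> equitonal M" using equitonal_trans[OF equitonal_sym[OF eq] z(3)] .
    then have "y \<in> equitonal_above M z"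
      using xy gt msr_gt_1[OF z(1) xy(2)] by (simp add: equitonal_above_def)
    then show False using octave_iff[OF z(1) t(1)] t(2) yt by blast
  qed
  then have "msr x y = 2 powr of_int k" using ge zy by simp
  then show "\<exists>k::int. msr x y = 2 powr of_int k" ..
qed

lemma sound_sequence_msr:
  assumes "length ss = length qs + 1" "set ss \<subseteq> S" "\<forall>i<length qs. msr (ss ! i) (ss ! (i + 1)) = qs ! i"
    and "i \<le> length qs"
  shows "msr (ss ! 0) (ss ! i) = prod_list (take i qs)"
  using assms(4)
proof (induction i)
  case 0
  have "ss ! 0 \<in> S" using assms(1,2) by (auto simp: subset_iff)
  then show ?case by (simp add: msr_refl)
next
  case (Suc i)
  have "ss ! 0 \<in> S" "ss ! i \<in> S" "ss ! Suc i \<in> S" using assms(1,2) Suc.prems by (auto simp: subset_iff)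
  then show ?case using msr_mult[of "ss ! 0" "ss ! i" "ss ! Suc i"] Suc assms(3)
    by (simp add: take_Suc_conv_app_nth)
qed

lemma tone_eq_iff: "x \<in> S \<Longrightarrow> y \<in> S \<Longrightarrow> tone M x = tone M y \<longleftrightarrow> (x, y) \<in> equitonal M"
  unfolding tone_def using equitonal_refl equitonal_sym equitonal_trans by blast

end

lemma prod_list_gt_1:
  fixes xs :: "real list"
  assumes "xs \<noteq> []" "\<forall>x\<in>set xs. x > 1" shows "prod_list xs > 1"
  using assms
proof (induction xs)
  case (Cons x xs)
  then show ?case by (cases "xs = []") (auto intro: less_1_mult)
qed simp

lemma prod_list_inverse:
  fixes xs :: "'a :: field list"
  shows "prod_list (map inverse xs) = inverse (prod_list xs)"
  by (induction xs) auto

lemma partial_product_between: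
  fixes xs :: "real list"
  assumes "\<forall>x\<in>set xs. x > 1" "0 < i" "i < length xs"
  shows "1 < prod_list (take i xs)" "prod_list (take i xs) < prod_list xs"
proof -
  show 1: "1 < prod_list (take i xs)"
    using assms by (intro prod_list_gt_1) (auto dest: in_set_takeD)
  have "1 < prod_list (drop i xs)"
    using assms by (intro prod_list_gt_1) (auto dest: in_set_dropD)
  then have "prod_list (take i xs) * 1 < prod_list (take i xs) * prod_list (drop i xs)"
    using 1 by (intro mult_strict_left_mono) auto
  also have "\<dots> = prod_list (take i xs @ drop i xs)" by (simp only: prod_list.append)
  finally show "prod_list (take i xs) < prod_list xs" by simp
qed

text \<open>
  Inside a scale the intermediate sounds lie strictly within one octave of the tonic, above it when
  ascending and below it when descending.
\<close>
lemma partial_product_not_power_of_2: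
  fixes xs :: "real list"
  assumes gt: "\<forall>x\<in>set xs. x > 1" and i: "0 < i" "i < length xs" and p: "prod_list xs = 2"
  shows "prod_list (take i xs) \<noteq> 2 powr of_int k"
    "prod_list (take i (map inverse xs)) \<noteq> 2 powr of_int k"
proof -
  have no: "prod_list (take i xs) \<noteq> 2 powr of_int k" for k :: int
  proof
    assume "prod_list (take i xs) = 2 powr of_int k"
    then have "2 powr 0 < 2 powr real_of_int k" "2 powr real_of_int k < 2 powr 1"
      using partial_product_between[OF gt i] p by auto
    then have "0 < real_of_int k" "real_of_int k < 1" by (simp_all only: powr_less_cancel_iff)
    then have "0 < k" "k < 1" by simp_all
    then show False by linarith
  qed
  show "prod_list (take i xs) \<noteq> 2 powr of_int k" by (rule no)
  show "prod_list (take i (map inverse xs)) \<noteq> 2 powr of_int k"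
  proof
    assume "prod_list (take i (map inverse xs)) = 2 powr of_int k"
    then have "inverse (prod_list (take i xs)) = 2 powr of_int k"
      by (simp add: take_map prod_list_inverse)
    then have "prod_list (take i xs) = 2 powr of_int (- k)"
      by (metis inverse_inverse_eq of_int_minus powr_minus)
    then show False using no by blast
  qed
qed

locale pit_harmony = pit_frame +
  assumes har: "harmony_axioms M" and sca: "scale_axiom M"
begin

abbreviation "H \<equiv> harmonic_measures M"

lemma harmonic_interval: "I \<in> harmonic M \<Longrightarrow> I \<in> intervals M"
  using wf unfolding pit_wf_def by blast

lemma harmonic_measuresE:
  assumes "r \<in> H" obtains a b where "a \<in> S" "b \<in> S" "ival M a b \<in> harmonic M" "r = msr a b"
proof -
  obtain I where I: "I \<in> harmonic M" "r = imeasure M I" using assms unfolding harmonic_measures_def by blast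
  from harmonic_interval[OF I(1)] obtain a b where "a \<in> S" "b \<in> S" "I = ival M a b" by (rule intervalsE)
  then show ?thesis using that I by blast
qed

lemma harmonic_msr: "ival M a b \<in> harmonic M \<Longrightarrow> msr a b \<in> H"
  unfolding harmonic_measures_def by blast

lemma harmonic_rev:
  assumes "a \<in> S" "b \<in> S" "ival M a b \<in> harmonic M" shows "ival M b a \<in> harmonic M"
proof (cases "(a, b) \<in> same_pitch M")
  case True
  then have "ival M b a = ival M a b" using assms ival_eq_iff same_pitch_sym by blast
  then show ?thesis using assms by simp
next
  case False
  have "\<forall>a\<in>S. \<forall>b\<in>S. ival M a b \<in> harmonic M \<and> (a, b) \<notin> same_pitch M \<longrightarrow> ival M b a \<in> harmonic M"
    using har unfolding harmony_axioms_def by (elim conjE)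
  then show ?thesis using False assms by blast
qed

lemma harmonic_product:
  assumes "I \<in> harmonic M" "J \<in> harmonic M" "imeasure M I > 1" "imeasure M J \<noteq> 1"
    "K \<in> intervals M" "imeasure M K = imeasure M I * imeasure M J"
  shows "K \<in> harmonic M"
proof -
  have "\<forall>I\<in>harmonic M. \<forall>J\<in>harmonic M. imeasure M I > 1 \<and> imeasure M J \<noteq> 1 \<longrightarrow>
        (\<forall>K\<in>intervals M. imeasure M K = imeasure M I * imeasure M J \<longrightarrow> K \<in> harmonic M)"
    using har unfolding harmony_axioms_def by (elim conjE)
  then show ?thesis using assms by blast
qed

lemma harmonic_ascending:
  assumes "a \<in> S" "b \<in> S" "c \<in> S" "e \<in> S" "msr a b > 1" "msr a b = msr c e" "ival M c e \<in> harmonic M"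
  shows "ival M a b \<in> harmonic M"
proof -
  have ax: "\<forall>a\<in>S. \<forall>b\<in>S. \<forall>c\<in>S. \<forall>d\<in>S.
        (a, b) \<in> L \<and> (ival M a b, ival M c d) \<in> icong M \<and> ival M a b \<in> harmonic M \<longrightarrow>
        ival M c d \<in> harmonic M"
    using har unfolding harmony_axioms_def by (elim conjE)
  have "(c, e) \<in> L" using msr_gt_1[of c e] assms by simp
  moreover have "(ival M c e, ival M a b) \<in> icong M"
    using msr_cong[of "ival M c e" "ival M a b"] assms by simp
  ultimately show ?thesis using ax assms by blast
qed

text \<open>
  The axiom transfers harmonicity along congruence for ascending intervals only. A descending interval
  is reversed first; a unison is the composition of a harmonic interval with its reverse.
\<close>
lemma harmonic_iff:
  assumes ab: "a \<in> S" "b \<in> S" shows "ival M a b \<in> harmonic M \<longleftrightarrow> msr a b \<in> H"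
proof (rule iffI, erule harmonic_msr)
  assume "msr a b \<in> H"
  then obtain c e where ce: "c \<in> S" "e \<in> S" "ival M c e \<in> harmonic M" "msr a b = msr c e"
    by (rule harmonic_measuresE)
  consider "msr a b > 1" | "msr a b < 1" | "msr a b = 1" by linarith
  then show "ival M a b \<in> harmonic M"
  proof cases
    case 1 then show ?thesis using harmonic_ascending ab ce by blast
  next
    case 2
    have "msr b a > 1" using 2 msr_rev[OF ab] msr_pos[OF ab] by (simp add: one_less_inverse_iff)
    moreover have "msr b a = msr e c" using msr_rev[OF ab] msr_rev[OF ce(1,2)] ce(4) by simp
    ultimately have "ival M b a \<in> harmonic M"
      using harmonic_ascending[OF ab(2,1) ce(2,1)] harmonic_rev[OF ce(1-3)] by blast
    then show ?thesis using harmonic_rev ab by blast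
  next
    case 3
    obtain I where I: "I \<in> harmonic M" "imeasure M I > 1" using sca unfolding scale_axiom_def by blast
    then obtain c e where ce: "c \<in> S" "e \<in> S" "I = ival M c e" using harmonic_interval intervalsE by blast
    have "ival M e c \<in> harmonic M" using harmonic_rev ce I by blast
    moreover have "msr e c \<noteq> 1" "1 = imeasure M I * msr e c"
      using msr_rev[OF ce(1,2)] I ce by auto
    ultimately show ?thesis using harmonic_product[OF I(1) _ I(2), of "ival M e c" "ival M a b"] ab 3 by simp
  qed
qed

lemma H_pos: "r \<in> H \<Longrightarrow> r > 0"
  by (erule harmonic_measuresE) (simp add: msr_pos)

lemma H_inverse: "r \<in> H \<Longrightarrow> inverse r \<in> H"
proof (erule harmonic_measuresE)
  fix a b assume "a \<in> S" "b \<in> S" "ival M a b \<in> harmonic M" "r = msr a b"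
  then show "inverse r \<in> H" using harmonic_msr[of b a] harmonic_rev[of a b] msr_rev[of a b] by simp
qed

lemma H_mult_gt_1:
  assumes "r \<in> H" "s \<in> H" "r > 1" shows "r * s \<in> H"
proof (cases "s = 1")
  case False
  obtain a b where ab: "a \<in> S" "b \<in> S" "ival M a b \<in> harmonic M" "r = msr a b"
    using assms(1) by (rule harmonic_measuresE)
  obtain c e where ce: "c \<in> S" "e \<in> S" "ival M c e \<in> harmonic M" "s = msr c e"
    using assms(2) by (rule harmonic_measuresE)
  obtain x where x: "x \<in> S" "msr b x = msr c e" using msr_transport[OF ce(1,2) ab(2)] by blast
  have eq: "msr a x = r * s" using msr_mult[OF ab(1,2) x(1)] x ab ce by simp
  then have "ival M a x \<in> harmonic M"
    using harmonic_product[OF ab(3) ce(3), of "ival M a x"] assms(3) False ab ce x by simp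
  then show ?thesis using harmonic_msr[of a x] eq by simp
qed (use assms in simp)

lemma H_mult: "r \<in> H \<Longrightarrow> s \<in> H \<Longrightarrow> r * s \<in> H"
proof -
  assume rs: "r \<in> H" "s \<in> H"
  consider "r > 1" | "s > 1" | "r = 1" | "r < 1" "s \<le> 1" by linarith
  then show "r * s \<in> H"
  proof cases
    case 4
    have "inverse r > 1" using 4 H_pos[OF rs(1)] by (simp add: one_less_inverse_iff)
    then have "inverse (inverse r * inverse s) \<in> H" using H_mult_gt_1 H_inverse rs by blast
    then show ?thesis by simp
  qed (use H_mult_gt_1[of r s] H_mult_gt_1[of s r] rs in \<open>simp_all add: mult.commute\<close>)
qed

abbreviation "\<epsilon> \<equiv> semitone M"

lemma semitone_le: "r \<in> H \<Longrightarrow> r > 1 \<Longrightarrow> \<epsilon> \<le> r"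
  unfolding semitone_def by (rule cInf_lower) (auto intro: bdd_belowI[of _ 1])

text \<open>
  A discrete multiplicative group of positive numbers is cyclic: dividing \<open>r\<close> by the greatest power of
  the semitone below it leaves a harmonic measure in \<open>[1, \<epsilon>)\<close>, which is 1.
\<close>
lemma semitone_powers:
  assumes \<epsilon>: "\<epsilon> \<in> H" "\<epsilon> > 1" shows "r \<in> H \<longleftrightarrow> (\<exists>k::int. r = \<epsilon> powr of_int k)"
proof
  have pow: "\<epsilon> powr of_int k \<in> H" for k :: int
  proof (induction k rule: int_induct[where k = 0])
    case base show ?case using H_mult[OF \<epsilon>(1) H_inverse[OF \<epsilon>(1)]] \<epsilon>(2) by simp
  next
    case (step1 k) then show ?case using H_mult[OF _ \<epsilon>(1)] \<epsilon>(2) by (auto simp: powr_add)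
  next
    case (step2 k)
    then show ?case using H_mult[OF _ H_inverse[OF \<epsilon>(1)]] \<epsilon>(2)
      by (auto simp: powr_diff divide_inverse)
  qed
  show "\<exists>k::int. r = \<epsilon> powr of_int k \<Longrightarrow> r \<in> H" using pow by blast
  assume r: "r \<in> H"
  define k where "k = \<lfloor>log \<epsilon> r\<rfloor>"
  have r_eq: "r = \<epsilon> powr log \<epsilon> r" using \<epsilon>(2) H_pos[OF r] by simp
  have "r * inverse (\<epsilon> powr of_int k) \<in> H" using H_mult[OF r H_inverse[OF pow]] .
  moreover have q: "r * inverse (\<epsilon> powr of_int k) = \<epsilon> powr (log \<epsilon> r - of_int k)"
    by (subst r_eq) (simp add: powr_diff divide_inverse)
  moreover have "\<epsilon> powr (log \<epsilon> r - of_int k) < \<epsilon> powr 1"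
    using \<epsilon>(2) by (simp only: powr_less_cancel_iff) (simp add: k_def, linarith)
  then have "\<epsilon> powr (log \<epsilon> r - of_int k) < \<epsilon>" using \<epsilon>(2) by simp
  ultimately have "\<not> \<epsilon> powr (log \<epsilon> r - of_int k) > 1" using semitone_le by force
  then have "\<not> \<epsilon> powr 0 < \<epsilon> powr (log \<epsilon> r - of_int k)" using \<epsilon>(2) by simp
  then have "log \<epsilon> r \<le> of_int k" using \<epsilon>(2) by (simp only: powr_less_cancel_iff)
  then have "log \<epsilon> r = of_int k" unfolding k_def using of_int_floor_le[of "log \<epsilon> r"] by linarith
  then show "\<exists>k::int. r = \<epsilon> powr of_int k" using r_eq by metis
qed

lemma sound_sequence_exists:
  assumes "s \<in> S" "set qs \<subseteq> H"
  shows "\<exists>ss. length ss = length qs + 1 \<and> set ss \<subseteq> S \<and> ss ! 0 = s \<and>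
    (\<forall>i<length qs. msr (ss ! i) (ss ! (i + 1)) = qs ! i)"
  using assms
proof (induction qs arbitrary: s)
  case Nil
  then show ?case by (intro exI[of _ "[s]"]) auto
next
  case (Cons q qs)
  then have "q \<in> H" by simp
  then obtain a b where ab: "a \<in> S" "b \<in> S" "q = msr a b" by (rule harmonic_measuresE)
  obtain c where "c \<in> S" "msr s c = msr a b" using msr_transport[OF ab(1,2) Cons.prems(1)] by blast
  then have c: "c \<in> S" "msr s c = q" using ab(3) by simp_all
  obtain ss where ss: "length ss = length qs + 1" "set ss \<subseteq> S" "ss ! 0 = c"
    "\<forall>i<length qs. msr (ss ! i) (ss ! (i + 1)) = qs ! i"
    using Cons.IH[OF c(1)] Cons.prems(2) by auto
  have "\<forall>i<length (q # qs). msr ((s # ss) ! i) ((s # ss) ! (i + 1)) = (q # qs) ! i"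
    using ss c by (auto simp: nth_Cons less_Suc_eq_0_disj split: nat.split)
  then show ?case using ss Cons.prems by (intro exI[of _ "s # ss"]) auto
qed

text \<open>
  Only the tonic may be shared, and of the eight sounds of a module it is only the two outer ones that
  are equitonal to the tonic. Four consecutive positions out of eight, twice, without common inner
  position leave only the two halves.
\<close>
lemma disjoint_tetrachord_positions:
  assumes s: "s \<in> S" and qs: "set qs \<subseteq> H" "length qs = 7"
    and no: "\<And>i k. 0 < i \<Longrightarrow> i < 7 \<Longrightarrow> prod_list (take i qs) \<noteq> 2 powr of_int (k::int)"
    and k: "1 < k" "k < 7" "1 < k'" "k' < 7"
    and disj: "components M (tone M s) qs {k - 2..k + 1} \<inter> components M (tone M s) qs {k' - 2..k' + 1}
      \<subseteq> {tone M s}"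
  shows "k = 2 \<and> k' = 6 \<or> k = 6 \<and> k' = 2"
proof -
  obtain ss where ss: "length ss = length qs + 1" "set ss \<subseteq> S" "ss ! 0 = s"
    "\<forall>i<length qs. msr (ss ! i) (ss ! (i + 1)) = qs ! i"
    using sound_sequence_exists[OF s qs(1)] by blast
  have "note_seq M (tone M s) qs ss"
    unfolding note_seq_def tone_def using ss equitonal_refl[OF s] by auto
  then have comp: "tone M (ss ! i) \<in> components M (tone M s) qs A" if "i \<in> A" for i A
    unfolding components_def using that by blast
  have apart: "i \<notin> {k - 2..k + 1} \<inter> {k' - 2..k' + 1}" if i: "0 < i" "i < 7" for i
  proof
    assume "i \<in> {k - 2..k + 1} \<inter> {k' - 2..k' + 1}"
    then have "tone M (ss ! i) = tone M s" using comp disj by blast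
    moreover have iS: "ss ! i \<in> S" using ss i qs by (auto simp: subset_iff)
    ultimately have "(s, ss ! i) \<in> equitonal M" using tone_eq_iff s by metis
    then obtain j :: int where "msr s (ss ! i) = 2 powr of_int j" using equitonal_iff s iS by blast
    then have "prod_list (take i qs) = 2 powr of_int j"
      using sound_sequence_msr[OF ss(1,2,4), of i] ss(3) i qs(2) by simp
    then show False using no[OF i] by blast
  qed
  show ?thesis
  proof (cases "k \<le> k'")
    case True
    \<comment> \<open>Were the tetrachords less than four positions apart, this inner position would belong to both.\<close>
    define i where "i = max 1 (k' - 2)"
    have i: "0 < i" "i < 7" using k by (simp_all add: i_def)
    have "\<not> (k - 2 \<le> i \<and> i \<le> k + 1 \<and> k' - 2 \<le> i \<and> i \<le> k' + 1)"
      using apart[OF i] unfolding Int_iff atLeastAtMost_iff by blast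
    then show ?thesis using True k unfolding i_def by arith
  next
    case False
    define i where "i = max 1 (k - 2)"
    have i: "0 < i" "i < 7" using k by (simp_all add: i_def)
    have "\<not> (k - 2 \<le> i \<and> i \<le> k + 1 \<and> k' - 2 \<le> i \<and> i \<le> k' + 1)"
      using apart[OF i] unfolding Int_iff atLeastAtMost_iff by blast
    then show ?thesis using False k unfolding i_def by arith
  qed
qed

text \<open>
  Step by step, with \<open>k\<close> semitones in the smaller step: the last step is \<open>\<epsilon>\<close> and the first is not, so
  \<open>k = 0\<close> would force a step of measure 1 and \<open>k = 1\<close> remains. The octave is then \<open>\<epsilon> ^ n\<close> with
  \<open>n = 6 + 2 a + b\<close>, where the second and fourth steps have \<open>a\<close> and \<open>b\<close> semitones, and the triad leaves
  \<open>n = 12\<close>.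
\<close>
theorem semitone_eq: "\<epsilon> \<in> H \<and> \<epsilon> = 2 powr (1 / 12)"
proof -
  obtain \<sigma> where \<sigma>: "is_scale M \<sigma>" "heptatonic \<sigma>" "compatible \<sigma>"
    "maximally_even M (asc_mode \<sigma>)" "asc_sensible M \<sigma>" "\<not> desc_sensible M \<sigma>"
    "has_disjoint_equal_tetrachords M \<sigma>" and "\<exists>x y z. major_triad M x y z \<and> scale_based M \<sigma> x y z"
    using sca unfolding scale_axiom_def by blast
  then obtain x y z where xyz: "major_triad M x y z" by blast
  obtain T rs rs' where \<sigma>_eq: "\<sigma> = (T, rs, rs')" by (cases \<sigma>)
  obtain s where s: "s \<in> S" "T = tone M s" using \<sigma>(1) \<sigma>_eq by auto
  have rs: "\<forall>r\<in>set rs. r > 1" "set rs \<subseteq> H" "prod_list rs = 2" "length rs = 7"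
    and rs': "\<forall>r\<in>set rs'. r < 1" "set rs' \<subseteq> H" "length rs' = 7"
    using \<sigma>(1,2) \<sigma>_eq by auto
  have rs'_nth: "rs' ! i = inverse (rs ! (6 - i))" if "i < 7" for i
    using \<sigma>(3) \<sigma>_eq rs' that by auto
  have rs'_eq: "rs' = map inverse (rev rs)"
    using rs(4) rs'(3) rs'_nth by (intro nth_equalityI) (auto simp: rev_nth)
  have mem: "rs ! i \<in> set rs" if "i < 7" for i using rs(4) that by simp
  have last: "rs ! 6 = \<epsilon>" using \<sigma>(5) \<sigma>_eq rs(4) last_conv_nth[of rs] by (cases rs) auto
  have first: "rs ! 0 \<noteq> \<epsilon>"
    using \<sigma>(6) \<sigma>_eq rs'(3) rs'_nth[of 6] last_conv_nth[of rs'] by (cases rs') auto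
  have \<epsilon>: "\<epsilon> \<in> H" "\<epsilon> > 1" using last rs(1,2) mem[of 6] by auto
  have inj: "\<epsilon> powr a = \<epsilon> powr b \<longleftrightarrow> a = b" for a b :: real using \<epsilon>(2) by (simp add: powr_inj)
  obtain k :: int where k: "set rs \<subseteq> {\<epsilon> powi k, \<epsilon> powi (k + 1)}"
    using \<sigma>(4) \<sigma>_eq unfolding maximally_even_def by auto
  have powi: "\<epsilon> powr of_int j = \<epsilon> powi j" for j using \<epsilon>(2) by (simp add: powr_real_of_int')
  have k_powr: "set rs \<subseteq> {\<epsilon> powr of_int k, \<epsilon> powr of_int (k + 1)}"
    using k by (simp only: powi)
  have "\<epsilon> powr 1 \<in> {\<epsilon> powr of_int k, \<epsilon> powr of_int (k + 1)}"
    using subsetD[OF k_powr mem[of 6]] last \<epsilon>(2) by simp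
  then have "real_of_int k = 1 \<or> real_of_int (k + 1) = 1" by (auto simp only: insert_iff empty_iff inj)
  then have k01: "k = 1 \<or> k = 0" by auto
  have "k \<noteq> 0"
  proof
    assume "k = 0"
    then have "rs ! 0 \<in> {1, \<epsilon>}" using subsetD[OF k mem[of 0]] by simp
    then show False using first rs(1) mem[of 0] by auto
  qed
  then have "k = 1" using k01 by simp
  then have two: "rs ! i = \<epsilon> \<or> rs ! i = \<epsilon> ^ 2" if "i < 7" for i
    using subsetD[OF k mem[OF that]] by (auto simp: power_int_def)
  have "rs ! 0 = rs ! 4 \<and> rs ! 1 = rs ! 5 \<and> rs ! 2 = rs ! 6"
  proof -
    have "\<exists>t C C'. (t, C) \<in> tetrachords M (T, rs, rs') \<and> (t, C') \<in> tetrachords M (T, rs, rs') \<and>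
        C \<inter> C' \<subseteq> {T}"
      using \<sigma>(7) unfolding has_disjoint_equal_tetrachords_def \<sigma>_eq fst_conv .
    then obtain t C C' where t: "(t, C) \<in> tetrachords M (T, rs, rs')"
      "(t, C') \<in> tetrachords M (T, rs, rs')" "C \<inter> C' \<subseteq> {T}" by blast
    obtain qs k where qs: "qs = rs \<or> qs = rs'" "1 < k" "k < length qs"
      "t = (qs ! (k - 2), qs ! (k - 1), qs ! k)" "C = components M T qs {k - 2..k + 1}"
      using t(1) unfolding tetrachords.simps module_tetrachords_def by blast
    obtain qs' k' where qs': "qs' = rs \<or> qs' = rs'" "1 < k'" "k' < length qs'"
      "t = (qs' ! (k' - 2), qs' ! (k' - 1), qs' ! k')" "C' = components M T qs' {k' - 2..k' + 1}"
      using t(2) unfolding tetrachords.simps module_tetrachords_def by blast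
    \<comment> \<open>Ascending steps exceed 1 and descending steps do not, so equal tetrachords lie in the same module.\<close>
    have "qs ! k \<in> set qs" "qs' ! k' \<in> set qs'" using qs(3) qs'(3) by (auto intro: nth_mem)
    moreover have "qs ! k = qs' ! k'" using qs(4) qs'(4) by simp
    ultimately have same: "qs' = qs" using qs(1) qs'(1) rs(1) rs'(1) by fastforce
    have len: "length qs = 7" and qsH: "set qs \<subseteq> H" using qs(1) rs rs' by auto
    \<comment> \<open>By compatibility the descending module is the ascending one reversed and inverted.\<close>
    have "prod_list (rev rs) = 2" using rs(3) by (simp add: prod_list.rev)
    then have "prod_list (take i qs) \<noteq> 2 powr of_int j" if "0 < i" "i < 7" for i and j :: int
      using qs(1) partial_product_not_power_of_2(1)[of rs i j] partial_product_not_power_of_2(2)[of "rev rs" i j]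
        rs that by (auto simp: rs'_eq)
    then have "k = 2 \<and> k' = 6 \<or> k = 6 \<and> k' = 2"
      using disjoint_tetrachord_positions[OF s(1) qsH len, of k k'] qs qs' same len s(2) t(3) by simp
    then have "qs ! 0 = qs ! 4 \<and> qs ! 1 = qs ! 5 \<and> qs ! 2 = qs ! 6"
      using qs(4) qs'(4) same by auto
    then show ?thesis using qs(1) rs'_nth[of 0] rs'_nth[of 1] rs'_nth[of 2] rs'_nth[of 4] rs'_nth[of 5] rs'_nth[of 6]
      by auto
  qed
  then have nth: "rs ! 4 = \<epsilon> ^ 2" "rs ! 0 = \<epsilon> ^ 2" "rs ! 2 = \<epsilon>" "rs ! 5 = rs ! 1"
    using two[of 0] first last by auto
  have rs_list: "rs = [rs ! 0, rs ! 1, rs ! 2, rs ! 3, rs ! 4, rs ! 5, rs ! 6]"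
    using rs(4) by (intro nth_equalityI) (auto simp: less_Suc_eq numeral_eq_Suc)
  have "prod_list rs = rs ! 0 * rs ! 1 * rs ! 2 * rs ! 3 * rs ! 4 * rs ! 5 * rs ! 6"
    by (rule trans[OF arg_cong[OF rs_list, of prod_list]]) (simp add: mult.assoc)
  then have prod: "\<epsilon> ^ 6 * (rs ! 1) ^ 2 * rs ! 3 = 2"
    using nth last rs(3) by (simp add: power2_eq_square power_numeral_reduce mult_ac)
  have tr: "x \<in> S" "y \<in> S" "z \<in> S" "ival M x z \<in> harmonic M" "msr x z = \<epsilon> * sqrt 2"
    "msr x y = \<epsilon> * msr y z" "ival M y z \<in> harmonic M"
    using xyz unfolding major_triad_def triad_def by auto
  obtain i :: int where i: "msr y z = \<epsilon> powr of_int i" using semitone_powers[OF \<epsilon>] harmonic_msr[OF tr(7)] by blast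
  \<comment> \<open>The two parts of the triad measure \<open>\<epsilon> w\<close> and \<open>w\<close>, and the whole \<open>\<epsilon> * sqrt 2\<close>, so \<open>w\<^sup>2 = sqrt 2\<close>.\<close>
  have "\<epsilon> * sqrt 2 = \<epsilon> * msr y z * msr y z" using msr_mult[OF tr(1-3)] tr by simp
  then have "sqrt 2 = msr y z ^ 2" using \<epsilon>(2) by (simp add: power2_eq_square)
  then have "(sqrt 2)^2 = (msr y z ^ 2) ^ 2" by simp
  then have "2 = msr y z ^ 4" by simp
  then have four: "2 = \<epsilon> powr (4 * of_int i)"
    using i \<epsilon>(2) by (simp add: powr_power mult.commute)
  have pw: "\<epsilon> ^ n = \<epsilon> powr real n" for n using \<epsilon>(2) by (simp add: powr_realpow)
  consider "rs ! 1 = \<epsilon> ^ 2" "rs ! 3 = \<epsilon> ^ 2" | "rs ! 1 = \<epsilon> ^ 2" "rs ! 3 = \<epsilon>"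
    | "rs ! 1 = \<epsilon>" "rs ! 3 = \<epsilon> ^ 2" | "rs ! 1 = \<epsilon>" "rs ! 3 = \<epsilon>"
    using two[of 1] two[of 3] by auto
  then obtain n :: nat where n: "n = 12 \<or> n = 11 \<or> n = 10 \<or> n = 9" "\<epsilon> ^ n = 2"
  proof cases
    case 1 show ?thesis by (rule that[of 12]) (use prod 1 in \<open>simp_all flip: power_add power_mult\<close>)
  next
    case 2 show ?thesis by (rule that[of 11]) (use prod 2 in \<open>simp_all flip: power_add power_mult power_Suc2\<close>)
  next
    case 3 show ?thesis by (rule that[of 10]) (use prod 3 in \<open>simp_all flip: power_add power_mult\<close>)
  next
    case 4 show ?thesis by (rule that[of 9]) (use prod 4 in \<open>simp_all flip: power_add power_mult power_Suc2\<close>)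
  qed
  have "real n = 4 * of_int i" using n(2) four pw inj by metis
  then have "int n = 4 * i" by linarith
  then have "n = 12" using n(1) by presburger
  then have "\<epsilon> powr 12 = 2" using n(2) pw[of 12] by simp
  then have "2 powr (1 / 12) = (\<epsilon> powr 12) powr (1 / 12)" by simp
  also have "\<dots> = \<epsilon>" using \<epsilon>(2) by (simp only: powr_powr) simp
  finally show ?thesis using \<epsilon>(1) by simp
qed

theorem harmonic_iff_semitones:
  assumes "a \<in> S" "b \<in> S"
  shows "ival M a b \<in> harmonic M \<longleftrightarrow> (\<exists>k::int. msr a b = 2 powr (of_int k / 12))"
proof -
  have \<epsilon>: "\<epsilon> \<in> H" "\<epsilon> = 2 powr (1 / 12)" using semitone_eq by auto
  then have "\<epsilon> > 1" by (simp add: gr_one_powr)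
  then show ?thesis using harmonic_iff[OF assms] semitone_powers[OF \<epsilon>(1)] \<epsilon>(2)
    by (simp add: powr_powr)
qed

end

section \<open>Isomorphism of models\<close>

lemma (in pit_frame) msr_frequency:
  assumes "f0 > 0" "x \<in> S" "y \<in> S"
  shows "msr x y = frequency f0 M y / frequency f0 M x"
proof -
  have b: "base_sound M \<in> S" using wf unfolding pit_wf_def by blast
  then show ?thesis
    using msr_mult[OF b assms(2,3)] msr_pos[OF b assms(2)] assms(1) by (simp add: frequency_def)
qed

lemma pit_harmony_of_model: "pit_model f0 \<iota>0 M \<Longrightarrow> pit_harmony M"
  unfolding pit_model_def by unfold_locales (elim conjE, assumption)+

lemma pit_model_colour:
  assumes "pit_model f0 \<iota>0 M"
  obtains \<Gamma> where "bij_betw \<Gamma> (sounds M) periodic_continuous"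
    and "\<And>x. x \<in> sounds M \<Longrightarrow> least_period (\<Gamma> x) = frequency f0 M x"
proof -
  have "loudness_colour_axioms f0 \<iota>0 M" using assms unfolding pit_model_def by (elim conjE)
  then obtain \<Gamma> where onto: "\<Gamma> ` sounds M = periodic_continuous"
    and per: "\<forall>x\<in>sounds M. least_period (\<Gamma> x) = frequency f0 M x"
    and inj: "\<forall>x\<in>sounds M. \<forall>y\<in>sounds M. \<Gamma> x = \<Gamma> y \<longrightarrow> x = y"
    unfolding loudness_colour_axioms_def by (elim exE conjE) (simp add: ball_conj_distrib)
  have "bij_betw \<Gamma> (sounds M) periodic_continuous"
    using onto inj unfolding bij_betw_def inj_on_def by simp
  then show ?thesis using that per by simp
qed

text \<open>
  Base sounds may have different colours in the two models and need not correspond: the base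
  sound drops out of the quotient of two frequencies.
\<close>
theorem pit_models_isomorphic:
  assumes f0: "f0 > 0" and M: "pit_model f0 \<iota>0 M" and N: "pit_model f0 \<iota>0 N"
  shows "pit_isomorphic M N"
proof -
  interpret M: pit_harmony M by (rule pit_harmony_of_model[OF M])
  interpret N: pit_harmony N by (rule pit_harmony_of_model[OF N])
  obtain \<Gamma> where \<Gamma>: "bij_betw \<Gamma> (sounds M) periodic_continuous"
    and \<Gamma>_per: "\<And>x. x \<in> sounds M \<Longrightarrow> least_period (\<Gamma> x) = frequency f0 M x"
    using pit_model_colour[OF M] by blast
  obtain \<Delta> where \<Delta>: "bij_betw \<Delta> (sounds N) periodic_continuous"
    and \<Delta>_per: "\<And>x. x \<in> sounds N \<Longrightarrow> least_period (\<Delta> x) = frequency f0 N x"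
    using pit_model_colour[OF N] by blast
  define h where "h = inv_into (sounds N) \<Delta> \<circ> \<Gamma>"
  have h: "bij_betw h (sounds M) (sounds N)"
    unfolding h_def by (rule bij_betw_trans[OF \<Gamma> bij_betw_inv_into[OF \<Delta>]])
  then have hN: "h x \<in> sounds N" if "x \<in> sounds M" for x using that by (rule bij_betw_apply)
  have "\<Delta> (h x) = \<Gamma> x" if "x \<in> sounds M" for x
    using bij_betw_inv_into_right[OF \<Delta>, of "\<Gamma> x"] bij_betw_apply[OF \<Gamma> that] by (simp add: h_def)
  then have freq: "frequency f0 N (h x) = frequency f0 M x" if "x \<in> sounds M" for x
    using \<Gamma>_per[OF that] \<Delta>_per[OF hN[OF that]] that by simp
  have msr: "N.msr (h x) (h y) = M.msr x y" if "x \<in> sounds M" "y \<in> sounds M" for x y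
    using M.msr_frequency[OF f0 that] N.msr_frequency[OF f0 hN hN, OF that] freq that by simp
  have "pit_isomorphism M N h"
    unfolding pit_isomorphism_def
  proof (intro conjI ballI)
    fix x y assume xy: "x \<in> sounds M" "y \<in> sounds M"
    note hxy = hN[OF xy(1)] hN[OF xy(2)]
    show "(x, y) \<in> lower M \<longleftrightarrow> (h x, h y) \<in> lower N"
      using M.msr_gt_1[OF xy] N.msr_gt_1[OF hxy] msr[OF xy] by simp
    show "(x, y) \<in> equitonal M \<longleftrightarrow> (h x, h y) \<in> equitonal N"
      using M.equitonal_iff[OF xy] N.equitonal_iff[OF hxy] msr[OF xy] by simp
    show "ival M x y \<in> harmonic M \<longleftrightarrow> ival N (h x) (h y) \<in> harmonic N"
      using M.harmonic_iff_semitones[OF xy] N.harmonic_iff_semitones[OF hxy] msr[OF xy] by simp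
    fix c d assume cd: "c \<in> sounds M" "d \<in> sounds M"
    show "(ival M x y, ival M c d) \<in> icong M \<longleftrightarrow> (ival N (h x) (h y), ival N (h c) (h d)) \<in> icong N"
      using M.msr_cong[of "ival M x y" "ival M c d"] N.msr_cong[of "ival N (h x) (h y)" "ival N (h c) (h d)"]
        msr[OF xy] msr[OF cd] xy cd hN by simp
  qed (rule h)
  then show ?thesis unfolding pit_isomorphic_def by blast
qed

section \<open>Periodic functions\<close>

lemma periodic_continuousD:
  assumes "g \<in> periodic_continuous"
  shows "continuous_on UNIV g" "\<not> g constant_on UNIV" "\<exists>p>0. \<forall>t. g (t + p) = g t"
  using assms unfolding periodic_continuous_def by auto

lemma period_reduce:
  fixes g :: "real \<Rightarrow> real"
  assumes "\<forall>t. g (t + p) = g t" "p > 0"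
  obtains s where "0 \<le> s" "s < p" "g (t - s) = g 0" "g s = g t"
proof -
  interpret periodic_fun_simple g p by unfold_locales (use assms in simp)
  define k where "k = \<lfloor>t / p\<rfloor>"
  have k: "of_int k * p \<le> t" "t < (of_int k + 1) * p"
    unfolding k_def using floor_divide_lower[OF assms(2)] floor_divide_upper[OF assms(2)] by blast+
  show ?thesis
  proof (rule that[of "t - of_int k * p"])
    show "g (t - of_int k * p) = g t" using minus_of_int[of t k] by simp
    show "g (t - (t - of_int k * p)) = g 0" using plus_of_int[of 0 k] by simp
  qed (use k in \<open>simp_all add: algebra_simps\<close>)
qed

text \<open>
  The infimum of the positive periods is a period because the periods form a closed set. It is not 0,
  since a continuous function with arbitrarily small periods takes its value at 0 arbitrarily close
  to every point and is constant.
\<close>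
lemma least_period_pos:
  assumes g: "g \<in> periodic_continuous"
  shows "least_period g > 0"
proof -
  note gD = periodic_continuousD[OF g]
  define A where "A = {p. p > 0 \<and> (\<forall>t. g (t + p) = g t)}"
  define q where "q = Inf A"
  have A: "A \<noteq> {}" "bdd_below A" using gD(3) unfolding A_def by (auto intro: bdd_belowI[of _ 0])
  have "closed {p. \<forall>t. g (t + p) = g t}"
    by (intro closed_Collect_all closed_Collect_eq continuous_intros
        continuous_on_compose2[OF gD(1)]) auto
  moreover have "A \<subseteq> {p. \<forall>t. g (t + p) = g t}" unfolding A_def by auto
  ultimately have q: "\<forall>t. g (t + q) = g t"
    using closure_minimal closure_contains_Inf[OF A] unfolding q_def by blast
  have q_le: "q \<le> p" if "p \<in> A" for p unfolding q_def using that A(2) by (rule cInf_lower)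
  have "q \<ge> 0" unfolding q_def using A(1) by (rule cInf_greatest) (simp add: A_def)
  moreover have "q \<noteq> 0"
  proof
    assume "q = 0"
    have "g x = g 0" for x
    proof (rule ccontr)
      assume ne: "g x \<noteq> g 0"
      have "continuous (at x) g" using gD(1) continuous_on_eq_continuous_at open_UNIV by blast
      then obtain \<delta> where \<delta>: "\<delta> > 0" "\<And>y. dist y x < \<delta> \<Longrightarrow> dist (g y) (g x) < dist (g 0) (g x)"
        using ne unfolding continuous_at_eps_delta by (metis zero_less_dist_iff)
      obtain p where "p \<in> A" "p < \<delta>"
        using cInf_lessD[OF A(1), of \<delta>] \<open>q = 0\<close> \<delta>(1) unfolding q_def by auto
      then obtain s where s: "0 \<le> s" "s < p" "g (x - s) = g 0"
        using period_reduce[of g p x] unfolding A_def by blast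
      then have "dist (x - s) x < \<delta>" using \<open>p < \<delta>\<close> by (simp add: dist_real_def)
      then show False using \<delta>(2) s(3) by fastforce
    qed
    then show False using gD(2) unfolding constant_on_def by blast
  qed
  ultimately have qA: "q \<in> A" unfolding A_def using q by simp
  have "least_period g = q"
    unfolding least_period_def by (rule Least_equality) (use qA q_le in \<open>auto simp: A_def\<close>)
  then show ?thesis using qA unfolding A_def by simp
qed

lemma amplitude_pos:
  assumes g: "g \<in> periodic_continuous" shows "amplitude g > 0"
proof -
  note gD = periodic_continuousD[OF g]
  obtain p where p: "p > 0" "\<forall>t. g (t + p) = g t" using gD(3) by blast
  have range: "range g = g ` {0..p}"
  proof
    show "range g \<subseteq> g ` {0..p}"
    proof
      fix y assume "y \<in> range g"
      then obtain t where "y = g t" by blast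
      moreover obtain s where "0 \<le> s" "s < p" "g s = g t" using period_reduce[OF p(2,1)] by metis
      ultimately show "y \<in> g ` {0..p}" by (intro image_eqI[of _ _ s]) auto
    qed
  qed auto
  have c: "compact (range g)" unfolding range
    by (rule compact_continuous_image) (use gD(1) continuous_on_subset in auto)
  obtain u where u: "u \<in> range g" "\<forall>y\<in>range g. y \<le> u" using compact_attains_sup[OF c] by blast
  obtain l where l: "l \<in> range g" "\<forall>y\<in>range g. l \<le> y" using compact_attains_inf[OF c] by blast
  have "(GREATEST y. y \<in> range g) = u" by (rule Greatest_equality) (use u in auto)
  moreover have "(LEAST y. y \<in> range g) = l" by (rule Least_equality) (use l in auto)
  moreover have "l \<noteq> u"
  proof
    assume "l = u"
    then have "g t = u" for t using u l by (intro antisym) auto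
    then show False using gD(2) unfolding constant_on_def by blast
  qed
  moreover have "l \<le> u" using u l by blast
  ultimately show ?thesis unfolding amplitude_def by simp
qed

definition pure_tone :: "real \<Rightarrow> real \<Rightarrow> real \<Rightarrow> real" where
  "pure_tone p a t = a / 2 * sin (2 * pi * t / p)"

context
  fixes p a :: real
  assumes p: "p > 0" and a: "a > 0"
begin

lemma pure_tone_periodic: "pure_tone p a (t + p) = pure_tone p a t"
proof -
  have "2 * pi * (t + p) / p = 2 * pi * t / p + 2 * pi" using p by (simp add: field_simps)
  then show ?thesis unfolding pure_tone_def by (simp only: sin_periodic)
qed

lemma pure_tone_quarter: "pure_tone p a (p / 4) = a / 2" "pure_tone p a (- (p / 4)) = - a / 2"
proof -
  have "2 * pi * (p / 4) / p = pi / 2" "2 * pi * (- (p / 4)) / p = - (pi / 2)"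
    using p by (simp_all add: field_simps)
  then show "pure_tone p a (p / 4) = a / 2" "pure_tone p a (- (p / 4)) = - a / 2"
    unfolding pure_tone_def by (simp_all only: sin_minus sin_pi_half)
qed

lemma pure_tone_in: "pure_tone p a \<in> periodic_continuous"
proof -
  have "continuous_on UNIV (pure_tone p a)" unfolding pure_tone_def by (intro continuous_intros) (use p in auto)
  moreover have "\<not> pure_tone p a constant_on UNIV"
  proof
    assume "pure_tone p a constant_on UNIV"
    then have "pure_tone p a (p / 4) = pure_tone p a (- (p / 4))" unfolding constant_on_def by (metis UNIV_I)
    then show False using a by (simp add: pure_tone_quarter)
  qed
  ultimately show ?thesis unfolding periodic_continuous_def using p pure_tone_periodic by auto
qed

lemma least_period_pure_tone: "least_period (pure_tone p a) = p"
  unfolding least_period_def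
proof (rule Least_equality)
  show "p > 0 \<and> (\<forall>t. pure_tone p a (t + p) = pure_tone p a t)" using p pure_tone_periodic by blast
  fix q assume q: "q > 0 \<and> (\<forall>t. pure_tone p a (t + q) = pure_tone p a t)"
  then have "pure_tone p a (p / 4 + q) = a / 2" using pure_tone_quarter by metis
  moreover have "2 * pi * (p / 4 + q) / p = 2 * pi * q / p + pi / 2" using p by (simp add: field_simps)
  ultimately have "cos (2 * pi * q / p) = 1"
    using a unfolding pure_tone_def by (simp add: sin_add)
  then obtain n :: int where "2 * pi * q / p = of_int n * 2 * pi" using cos_one_2pi_int by auto
  then have n: "q = of_int n * p" using p by (simp add: field_simps)
  then have "real_of_int n > 0" using q p by (simp add: zero_less_mult_iff)
  then have "of_int n \<ge> (1::real)" by simp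
  then show "p \<le> q" unfolding n using p by simp
qed

lemma amplitude_pure_tone: "amplitude (pure_tone p a) = a"
proof -
  have b: "\<bar>pure_tone p a t\<bar> \<le> a / 2" for t
    using mult_left_mono[OF abs_sin_le_one[of "2 * pi * t / p"], of "a / 2"] a
    by (simp add: pure_tone_def abs_mult)
  have le: "pure_tone p a t \<le> a / 2" and ge: "- a / 2 \<le> pure_tone p a t" for t
    using b[of t] by linarith+
  have "(GREATEST y. y \<in> range (pure_tone p a)) = a / 2"
  proof (rule Greatest_equality)
    show "a / 2 \<in> range (pure_tone p a)" using pure_tone_quarter(1) by (metis rangeI)
  qed (use le in auto)
  moreover have "(LEAST y. y \<in> range (pure_tone p a)) = - a / 2"
  proof (rule Least_equality)
    show "- a / 2 \<in> range (pure_tone p a)" using pure_tone_quarter(2) by (metis rangeI)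
    show "- a / 2 \<le> y" if "y \<in> range (pure_tone p a)" for y using that ge by auto
  qed
  ultimately show ?thesis unfolding amplitude_def by simp
qed

end

section \<open>The equally tempered model\<close>

text \<open>
  A set of sounds with a positive frequency that takes all positive values. All axioms but loudness and
  colour hold for ratios of frequencies, whatever the sounds are.
\<close>
locale frequency_space =
  fixes C :: "'a set" and f :: "'a \<Rightarrow> real" and x0 :: 'a
  assumes f_pos: "x \<in> C \<Longrightarrow> f x > 0" and f_onto: "r > 0 \<Longrightarrow> \<exists>x\<in>C. f x = r" and x0: "x0 \<in> C"
begin

definition pitch_class :: "'a \<Rightarrow> 'a set" where "pitch_class x = {y \<in> C. f y = f x}"

text \<open>
  Frequency is constant on a pitch class, so its image there is a singleton.
\<close>
definition ratio :: "'a set \<times> 'a set \<Rightarrow> real" where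
  "ratio I = the_elem (f ` snd I) / the_elem (f ` fst I)"

definition class_pairs :: "('a set \<times> 'a set) set" where
  "class_pairs = pitch_class ` C \<times> pitch_class ` C"

text \<open>
  Twelve-tone equal temperament on all of \<open>C\<close>.
\<close>
definition tempered :: "'a pit_structure" where
  "tempered = \<lparr>sounds = C, lower = {(x, y) \<in> C \<times> C. f x < f y},
     icong = {(I, J) \<in> class_pairs \<times> class_pairs. ratio I = ratio J},
     equitonal = {(x, y) \<in> C \<times> C. \<exists>k::int. f y / f x = 2 powr of_int k},
     harmonic = {I \<in> class_pairs. \<exists>k::int. ratio I = 2 powr (of_int k / 12)},
     base_sound = x0\<rparr>"

lemma tempered_simps [simp]:
  "sounds tempered = C" "base_sound tempered = x0"
  "(x, y) \<in> lower tempered \<longleftrightarrow> x \<in> C \<and> y \<in> C \<and> f x < f y"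
  "(I, J) \<in> icong tempered \<longleftrightarrow> I \<in> class_pairs \<and> J \<in> class_pairs \<and> ratio I = ratio J"
  "(x, y) \<in> equitonal tempered \<longleftrightarrow> x \<in> C \<and> y \<in> C \<and> (\<exists>k::int. f y / f x = 2 powr of_int k)"
  "I \<in> harmonic tempered \<longleftrightarrow> I \<in> class_pairs \<and> (\<exists>k::int. ratio I = 2 powr (of_int k / 12))"
  by (auto simp: tempered_def)

lemma same_pitch_tempered [simp]: "(x, y) \<in> same_pitch tempered \<longleftrightarrow> x \<in> C \<and> y \<in> C \<and> f x = f y"
  by (auto simp: same_pitch_def)

lemma same_pitch_class: "x \<in> C \<Longrightarrow> same_pitch tempered `` {x} = pitch_class x"
  by (auto simp: pitch_class_def)

lemma intervals_tempered: "intervals tempered = class_pairs"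
  unfolding intervals_def class_pairs_def quotient_def by (auto simp: same_pitch_class)

lemma ival_tempered: "a \<in> C \<Longrightarrow> b \<in> C \<Longrightarrow> ival tempered a b = (pitch_class a, pitch_class b)"
  by (simp add: ival_def same_pitch_class)

lemma ival_in [simp]: "a \<in> C \<Longrightarrow> b \<in> C \<Longrightarrow> ival tempered a b \<in> class_pairs"
  by (simp add: ival_tempered class_pairs_def)

lemma class_pairsE:
  assumes "I \<in> class_pairs" obtains a b where "a \<in> C" "b \<in> C" "I = ival tempered a b"
  using assms unfolding class_pairs_def by (auto simp: ival_tempered)

lemma ratio_ival [simp]:
  assumes "a \<in> C" "b \<in> C" shows "ratio (ival tempered a b) = f b / f a"
proof -
  have "f ` pitch_class x = {f x}" if "x \<in> C" for x unfolding pitch_class_def using that by auto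
  then show ?thesis using assms by (simp add: ival_tempered ratio_def)
qed

lemma f_neq_0: "x \<in> C \<Longrightarrow> f x \<noteq> 0"
  using f_pos by fastforce

lemma ratio_lemmas:
  assumes "a \<in> C" "b \<in> C"
  shows "f b / f a > 1 \<longleftrightarrow> f a < f b" "f b / f a < 1 \<longleftrightarrow> f b < f a" "f b / f a = 1 \<longleftrightarrow> f a = f b"
    "f b / f a > 0"
  using f_pos[OF assms(1)] f_pos[OF assms(2)] by (auto simp: field_simps)

lemma tempered_wf: "pit_wf tempered"
  unfolding pit_wf_def intervals_tempered using x0 by (auto simp del: tempered_simps(3-6)) (auto simp: tempered_def)

lemma tempered_pitch: "pitch_axioms tempered"
  unfolding pitch_axioms_def
proof (intro conjI ballI impI)
  show "trans (lower tempered)" by (rule transI) auto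
  show "\<exists>x\<in>sounds tempered. \<exists>y\<in>sounds tempered. (x, y) \<in> lower tempered \<or> (y, x) \<in> lower tempered"
    using f_onto[of 1] f_onto[of 2] by fastforce
  fix x assume "x \<in> sounds tempered"
  then have x: "x \<in> C" "f x > 0" using f_pos by auto
  obtain a where "a \<in> C" "f a = f x / 2" using f_onto[of "f x / 2"] x by auto
  moreover obtain b where "b \<in> C" "f b = f x * 2" using f_onto[of "f x * 2"] x by auto
  ultimately show "\<exists>a\<in>sounds tempered. \<exists>b\<in>sounds tempered. (a, x) \<in> lower tempered \<and> (x, b) \<in> lower tempered"
    using x by (intro bexI[of _ a] bexI[of _ b]) auto
  fix y assume "y \<in> sounds tempered" "(x, y) \<in> lower tempered"
  then have y: "y \<in> C" "f x < f y" by auto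
  obtain a where "a \<in> C" "f a = (f x + f y) / 2" using f_onto[of "(f x + f y) / 2"] x y by auto
  then show "\<exists>a\<in>sounds tempered. (x, a) \<in> lower tempered \<and> (a, y) \<in> lower tempered"
    using x y by (intro bexI[of _ a]) auto
qed auto

lemma tempered_interval: "interval_axioms tempered"
  unfolding interval_axioms_def
proof (intro conjI ballI impI)
  show "trans (icong tempered)" by (rule transI) auto
  show "(I, I) \<in> icong tempered" if "I \<in> intervals tempered" for I
    using that by (simp add: intervals_tempered)
  fix x y a assume "x \<in> sounds tempered" "y \<in> sounds tempered" "a \<in> sounds tempered"
  then have C: "x \<in> C" "y \<in> C" "a \<in> C" by auto
  obtain b where b: "b \<in> C" "f b = f a * (f y / f x)"
    using f_onto[of "f a * (f y / f x)"] f_pos C by (meson divide_pos_pos mult_pos_pos)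
  show "\<exists>b\<in>sounds tempered. (ival tempered x y, ival tempered a b) \<in> icong tempered \<and>
      (\<forall>b'\<in>sounds tempered. (ival tempered x y, ival tempered a b') \<in> icong tempered \<longrightarrow>
        (b, b') \<in> same_pitch tempered)"
    using b C f_neq_0[OF C(1)] f_neq_0[OF C(3)] by (intro bexI[of _ b]) (auto simp: field_simps)
next
  fix a b c d assume "a \<in> sounds tempered" "b \<in> sounds tempered" "c \<in> sounds tempered" "d \<in> sounds tempered"
    and ab: "(a, b) \<in> lower tempered"
  then have C: "a \<in> C" "b \<in> C" "c \<in> C" "d \<in> C" by auto
  show "(ival tempered a b, ival tempered c d) \<in> icong tempered \<Longrightarrow> (c, d) \<in> lower tempered"
    using C ab ratio_lemmas(1)[OF C(1,2)] ratio_lemmas(1)[OF C(3,4)] by simp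
  show "(ival tempered a b, ival tempered c d) \<in> icong tempered \<longleftrightarrow>
      (ival tempered b a, ival tempered d c) \<in> icong tempered"
    using C f_pos[OF C(1)] f_pos[OF C(2)] f_pos[OF C(3)] f_pos[OF C(4)] by (auto simp: field_simps)
next
  fix a b c a' b' c' assume "a \<in> sounds tempered" "b \<in> sounds tempered" "c \<in> sounds tempered"
    "a' \<in> sounds tempered" "b' \<in> sounds tempered" "c' \<in> sounds tempered"
  then have C: "a \<in> C" "b \<in> C" "c \<in> C" "a' \<in> C" "b' \<in> C" "c' \<in> C" by auto
  have mult: "f z / f x = (f y / f x) * (f z / f y)" if "x \<in> C" "y \<in> C" "z \<in> C" for x y z
    using f_neq_0[OF that(2)] by simp
  {
    assume "(ival tempered a b, ival tempered a' b') \<in> icong tempered \<and>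
      (ival tempered b c, ival tempered b' c') \<in> icong tempered"
    then show "(ival tempered a c, ival tempered a' c') \<in> icong tempered"
      using C mult[of a b c] mult[of a' b' c'] by simp
  }
  {
    assume "(ival tempered a b, ival tempered b' a') \<in> icong tempered \<and>
      (ival tempered b c, ival tempered c' b') \<in> icong tempered"
    then have eq: "f b / f a = f a' / f b'" "f c / f b = f b' / f c'" using C by simp_all
    have "f c / f a = (f a' / f b') * (f b' / f c')" unfolding mult[OF C(1-3)] eq ..
    also have "\<dots> = f a' / f c'" using f_neq_0[OF C(5)] by simp
    finally show "(ival tempered a c, ival tempered c' a') \<in> icong tempered" using C by simp
  }
qed

lemma tempered_dedekind: "dedekind_axiom tempered"
  unfolding dedekind_axiom_def
proof (intro allI impI)
  fix P Q
  assume "P \<union> Q = sounds tempered \<and> P \<inter> Q = {} \<and> P \<noteq> {} \<and> Q \<noteq> {} \<and>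
    \<not> (\<exists>q\<in>Q. \<exists>p\<in>P. (q, p) \<in> lower tempered)"
  then have PQ: "P \<union> Q = C" "P \<inter> Q = {}" "P \<noteq> {}" "Q \<noteq> {}"
    and cut: "\<And>p q. p \<in> P \<Longrightarrow> q \<in> Q \<Longrightarrow> f p \<le> f q" by (auto simp: not_less)
  have bdd: "bdd_above (f ` P)" 
  proof -
    obtain q where "q \<in> Q" using PQ(4) by blast
    then show ?thesis using cut by (intro bdd_aboveI2[of _ _ "f q"])
  qed
  have le: "f p \<le> Sup (f ` P)" if "p \<in> P" for p using that bdd by (intro cSup_upper) auto
  have ge: "Sup (f ` P) \<le> f q" if "q \<in> Q" for q using that PQ(3) cut by (intro cSup_least) auto
  obtain p where "p \<in> P" using PQ(3) by blast
  then have "Sup (f ` P) > 0" using le[of p] f_pos[of p] PQ(1) by auto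
  then obtain t where t: "t \<in> C" "f t = Sup (f ` P)" using f_onto by blast
  have "\<forall>s\<in>sounds tempered. ((s, t) \<in> lower tempered \<longrightarrow> s \<in> P) \<and> ((t, s) \<in> lower tempered \<longrightarrow> s \<in> Q)"
  proof
    fix s assume "s \<in> sounds tempered"
    then have "s \<in> P \<or> s \<in> Q" using PQ(1) by auto
    then show "((s, t) \<in> lower tempered \<longrightarrow> s \<in> P) \<and> ((t, s) \<in> lower tempered \<longrightarrow> s \<in> Q)"
      using le[of s] ge[of s] t(2) by auto
  qed
  then show "\<exists>\<theta>\<in>sounds tempered. \<forall>s\<in>sounds tempered.
      ((s, \<theta>) \<in> lower tempered \<longrightarrow> s \<in> P) \<and> ((\<theta>, s) \<in> lower tempered \<longrightarrow> s \<in> Q)"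
    using t(1) by (intro bexI[of _ t]) auto
qed

lemma equitonal_above_ge_octave:
  assumes "y \<in> equitonal_above tempered s" shows "2 * f s \<le> f y"
proof -
  \<comment> \<open>The exponent is that of the interval from \<open>y\<close> down to \<open>s\<close>, hence negative.\<close>
  obtain k :: int where k: "f s / f y = 2 powr of_int k" and C: "y \<in> C" "s \<in> C" and less: "f s < f y"
    using assms by (auto simp: equitonal_above_def)
  have "2 powr real_of_int k < 2 powr 0" using k ratio_lemmas(2)[OF C] less by simp
  then have "real_of_int k < 0" by (simp only: powr_less_cancel_iff)
  then have "k \<le> - 1" by simp
  then have "real_of_int k \<le> real_of_int (- 1)" by (simp only: of_int_le_iff)
  then have "f s / f y \<le> 2 powr real_of_int (- 1)" unfolding k by (intro powr_mono) simp_all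
  then show ?thesis using f_pos[OF C(1)] by (simp add: powr_minus field_simps)
qed

lemma octave_tempered:
  "I \<in> octave_intervals tempered \<longleftrightarrow> I \<in> class_pairs \<and> ratio I = 2"
proof
  assume "I \<in> octave_intervals tempered"
  then obtain s t where st: "I = ival tempered s t" "s \<in> C" "t \<in> equitonal_above tempered s"
    "\<not> (\<exists>y\<in>equitonal_above tempered s. (y, t) \<in> lower tempered)"
    unfolding octave_intervals_def by auto
  then have t: "t \<in> C" by (simp add: equitonal_above_def)
  obtain y where y: "y \<in> C" "f y = 2 * f s" using f_onto[of "2 * f s"] f_pos[OF st(2)] by auto
  have "f s / f y = 2 powr of_int (-1)" using y f_pos[OF st(2)] by (simp add: powr_minus)
  then have "y \<in> equitonal_above tempered s"
    using y st(2) f_pos[OF st(2)] by (auto simp: equitonal_above_def intro: exI[of _ "-1::int"])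
  then have "f t \<le> 2 * f s" using st(4) y t by fastforce
  then have "f t = 2 * f s" using equitonal_above_ge_octave[OF st(3)] by simp
  then show "I \<in> class_pairs \<and> ratio I = 2" using st(1,2) t f_neq_0 by simp
next
  assume I: "I \<in> class_pairs \<and> ratio I = 2"
  then obtain s t where st: "s \<in> C" "t \<in> C" "I = ival tempered s t" by (auto elim: class_pairsE)
  then have ft: "f t = 2 * f s" using I f_neq_0[OF st(1)] by (simp add: field_simps)
  then have "f s / f t = 2 powr of_int (-1)" using f_pos[OF st(1)] by (simp add: powr_minus)
  then have "t \<in> equitonal_above tempered s"
    using st ft f_pos[OF st(1)] by (auto simp: equitonal_above_def intro: exI[of _ "-1::int"])
  moreover have "\<not> (\<exists>y\<in>equitonal_above tempered s. (y, t) \<in> lower tempered)"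
    using equitonal_above_ge_octave ft by fastforce
  ultimately show "I \<in> octave_intervals tempered" unfolding octave_intervals_def using st by auto
qed

lemma tempered_tonality: "tonality_axioms tempered"
  unfolding tonality_axioms_def
proof (intro conjI ballI impI)
  show "same_pitch tempered \<subseteq> equitonal tempered"
  proof
    fix z assume "z \<in> same_pitch tempered"
    then obtain x y where "z = (x, y)" "x \<in> C" "y \<in> C" "f x = f y"
      by (cases z) auto
    then show "z \<in> equitonal tempered" using f_neq_0 by (auto intro!: exI[of _ "0::int"])
  qed
  show "octave_intervals tempered \<noteq> {}"
  proof -
    obtain y where "y \<in> C" "f y = 2 * f x0" using f_onto[of "2 * f x0"] f_pos[OF x0] by auto
    then have "ival tempered x0 y \<in> octave_intervals tempered" using x0 f_neq_0 by (simp add: octave_tempered)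
    then show ?thesis by blast
  qed
  show "J \<in> octave_intervals tempered"
    if "I \<in> octave_intervals tempered" "(J, I) \<in> icong tempered" for I J
    using that by (simp add: octave_tempered)
  fix x y z assume "x \<in> sounds tempered" "y \<in> sounds tempered" "z \<in> sounds tempered"
    and "(x, z) \<in> equitonal tempered \<and> (y, z) \<in> equitonal tempered"
  then obtain k l :: int where C: "x \<in> C" "y \<in> C" "z \<in> C"
    and kl: "f z / f x = 2 powr of_int k" "f z / f y = 2 powr of_int l" by auto
  have "f y / f x = (f z / f x) / (f z / f y)" using f_neq_0 C by simp
  also have "\<dots> = 2 powr of_int (k - l)" unfolding kl by (simp add: powr_diff)
  finally show "(x, y) \<in> equitonal tempered" unfolding tempered_simps using C by blast
qed

sublocale tuned: pit_frame tempered
  by unfold_locales (rule tempered_wf tempered_pitch tempered_interval tempered_dedekind tempered_tonality)+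

lemma is_imeasure_ratio: "is_imeasure tempered ratio"
  unfolding is_imeasure_def intervals_tempered
proof (intro conjI ballI)
  show "ratio I > 0" if "I \<in> class_pairs" for I
    using that by (rule class_pairsE) (simp add: ratio_lemmas)
  fix a b assume "a \<in> sounds tempered" "b \<in> sounds tempered"
  then have C: "a \<in> C" "b \<in> C" by auto
  show "ratio (ival tempered a b) > 1 \<longleftrightarrow> (a, b) \<in> lower tempered"
    "ratio (ival tempered a b) = 1 \<longleftrightarrow> (a, b) \<in> same_pitch tempered"
    "ratio (ival tempered a b) < 1 \<longleftrightarrow> (b, a) \<in> lower tempered"
    using C ratio_lemmas[OF C] by simp_all
  fix c assume "c \<in> sounds tempered"
  then show "ratio (ival tempered a c) = ratio (ival tempered a b) * ratio (ival tempered b c)"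
    using C f_neq_0 by simp
qed (auto simp: octave_tempered)

lemma imeasure_tempered [simp]:
  assumes "a \<in> C" "b \<in> C" shows "imeasure tempered (ival tempered a b) = f b / f a"
  using tuned.imeasure_unique[OF tuned.is_imeasure_imeasure is_imeasure_ratio, of "ival tempered a b"] assms
  by (simp add: intervals_tempered)

lemma frequency_tempered: "x \<in> C \<Longrightarrow> frequency (f x0) tempered x = f x"
  using x0 f_neq_0 by (simp add: frequency_def)

lemma harmonic_measures_tempered: "harmonic_measures tempered = {2 powr (of_int k / 12) | k::int. True}"
proof
  show "harmonic_measures tempered \<subseteq> {2 powr (of_int k / 12) | k::int. True}"
  proof
    fix r assume "r \<in> harmonic_measures tempered"
    then obtain I where I: "I \<in> harmonic tempered" "r = imeasure tempered I"
      unfolding harmonic_measures_def by blast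
    then obtain k :: int where k: "I \<in> class_pairs" "ratio I = 2 powr (of_int k / 12)" by auto
    have "r = 2 powr (of_int k / 12)" using k I(2) by (auto elim!: class_pairsE)
    then show "r \<in> {2 powr (of_int k / 12) | k::int. True}" by blast
  qed
  show "{2 powr (of_int k / 12) | k::int. True} \<subseteq> harmonic_measures tempered"
  proof
    fix r :: real assume "r \<in> {2 powr (of_int k / 12) | k::int. True}"
    then obtain k :: int where r: "r = 2 powr (of_int k / 12)" by blast
    obtain y where y: "y \<in> C" "f y = f x0 * r" using f_onto[of "f x0 * r"] f_pos[OF x0] r by auto
    then have "ival tempered x0 y \<in> harmonic tempered" "imeasure tempered (ival tempered x0 y) = r"
      using x0 f_neq_0[OF x0] r by auto
    then show "r \<in> harmonic_measures tempered" unfolding harmonic_measures_def by blast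
  qed
qed

lemma harmonic_measures_ge:
  assumes "r \<in> harmonic_measures tempered" "r > 1" shows "r \<ge> 2 powr (1 / 12)"
proof -
  obtain k :: int where k: "r = 2 powr (of_int k / 12)" using assms(1) unfolding harmonic_measures_tempered by blast
  then have "2 powr 0 < 2 powr (real_of_int k / 12)" using assms(2) by simp
  then have "0 < real_of_int k / 12" by (simp only: powr_less_cancel_iff)
  then have "1 / 12 \<le> real_of_int k / 12" by simp
  then show ?thesis unfolding k by (simp only: powr_mono)
qed

lemma tempered_harmony: "harmony_axioms tempered"
  unfolding harmony_axioms_def
proof (intro conjI ballI impI)
  fix a b assume "a \<in> sounds tempered" "b \<in> sounds tempered"
    "ival tempered a b \<in> harmonic tempered \<and> (a, b) \<notin> same_pitch tempered"
  then obtain k :: int where C: "a \<in> C" "b \<in> C" and k: "f b / f a = 2 powr (of_int k / 12)" by auto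
  have "f a / f b = inverse (f b / f a)" by simp
  also have "\<dots> = 2 powr (of_int (- k) / 12)" unfolding k by (simp add: powr_minus)
  finally show "ival tempered b a \<in> harmonic tempered"
    unfolding tempered_simps ratio_ival[OF C(2,1)] using ival_in[OF C(2,1)] by blast
next
  fix I J K assume IJK: "I \<in> harmonic tempered" "J \<in> harmonic tempered" "K \<in> intervals tempered"
    "imeasure tempered K = imeasure tempered I * imeasure tempered J"
  have eq: "imeasure tempered X = ratio X" if "X \<in> class_pairs" for X
    using that by (rule class_pairsE) simp
  obtain k l :: int where "ratio I = 2 powr (of_int k / 12)" "ratio J = 2 powr (of_int l / 12)"
    using IJK(1,2) by auto
  then have "ratio K = 2 powr (of_int (k + l) / 12)"
    using IJK eq by (simp add: intervals_tempered powr_add add_divide_distrib)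
  then show "K \<in> harmonic tempered"
    using IJK(3) unfolding tempered_simps intervals_tempered by blast
next
  show "\<exists>\<alpha>>1. \<not> (\<exists>\<beta>\<in>harmonic_measures tempered. 1 < \<beta> \<and> \<beta> < \<alpha>)"
    using harmonic_measures_ge by (intro exI[of _ "2 powr (1 / 12)"]) (force simp: gr_one_powr)
qed (auto, metis)

lemma semitone_tempered: "semitone tempered = 2 powr (1 / 12)"
  unfolding semitone_def
proof (rule cInf_eq_minimum)
  show "2 powr (1 / 12) \<in> {r \<in> harmonic_measures tempered. r > 1}"
    unfolding harmonic_measures_tempered by (auto simp: gr_one_powr intro: exI[of _ "1::int"])
qed (use harmonic_measures_ge in auto)

end

text \<open>
  The major scale, in semitones.
\<close>
definition diatonic_steps :: "nat list" where "diatonic_steps = [2, 2, 1, 2, 2, 2, 1]"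

lemma prod_list_power: "prod_list (map (\<lambda>n. e ^ n) ns) = (e::'a::comm_monoid_mult) ^ sum_list ns"
  by (induction ns) (auto simp: power_add)

text \<open>
  The major scale on \<open>x0\<close> is the required scale, its tetrachords at positions 2 and 6 are equal, and
  the triad consists of degrees 1, 3 and 5, that is, 0, 4 and 7 semitones above the tonic.
\<close>
lemma (in frequency_space) tempered_scale: "scale_axiom tempered"
proof -
  define e :: real where "e = 2 powr (1 / 12)"
  have e1: "e > 1" unfolding e_def by (simp add: gr_one_powr)
  have epow: "e ^ n = 2 powr (real n / 12)" for n
    unfolding e_def by (simp add: powr_power)
  have e12: "e ^ 12 = 2" by (simp add: epow)
  have eH: "e ^ n \<in> harmonic_measures tempered" "inverse (e ^ n) \<in> harmonic_measures tempered" for n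
  proof -
    have "e ^ n = 2 powr (of_int (int n) / 12)" by (simp add: epow)
    then show "e ^ n \<in> harmonic_measures tempered" unfolding harmonic_measures_tempered by blast
    have "inverse (e ^ n) = 2 powr (of_int (- int n) / 12)" by (simp add: epow powr_minus)
    then show "inverse (e ^ n) \<in> harmonic_measures tempered" unfolding harmonic_measures_tempered by blast
  qed
  have sem: "semitone tempered = e" by (simp add: semitone_tempered e_def)
  define rs where "rs = map (\<lambda>n. e ^ n) diatonic_steps"
  define T where "T = tone tempered x0"
  define \<sigma> where "\<sigma> = (T, rs, map inverse (rev rs))"
  have rs: "rs = [e ^ 2, e ^ 2, e, e ^ 2, e ^ 2, e ^ 2, e]" by (simp add: rs_def diatonic_steps_def)
  have e2: "e ^ 2 > 1" using e1 by simp
  have scale: "is_scale tempered \<sigma>"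
  proof -
    have "prod_list rs = 2"
      unfolding rs_def prod_list_power by (simp add: diatonic_steps_def e12)
    moreover from this have "prod_list (map inverse (rev rs)) = 1 / 2"
      by (simp add: prod_list_inverse prod_list.rev)
    moreover have "\<forall>r\<in>set rs. r \<in> harmonic_measures tempered \<and> r > 1"
      "\<forall>r\<in>set (map inverse (rev rs)). r \<in> harmonic_measures tempered \<and> r < 1"
      using e1 e2 eH[of 1] eH[of 2] unfolding rs by (auto simp: inverse_less_1_iff)
    ultimately show ?thesis unfolding \<sigma>_def T_def using x0 by auto
  qed
  have even: "maximally_even tempered (asc_mode \<sigma>)" "maximally_even tempered (desc_mode \<sigma>)"
  proof -
    show "maximally_even tempered (asc_mode \<sigma>)"
      unfolding maximally_even_def \<sigma>_def sem by (rule exI[of _ 1]) (auto simp: rs)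
    have "e powi (- 2) = inverse (e ^ 2)" "e powi (- 2 + 1) = inverse e"
      by (simp_all add: power_int_minus)
    then show "maximally_even tempered (desc_mode \<sigma>)"
      unfolding maximally_even_def \<sigma>_def sem by (intro exI[of _ "- 2"]) (auto simp: rs)
  qed
  have sens: "asc_sensible tempered \<sigma>" "\<not> desc_sensible tempered \<sigma>"
    unfolding \<sigma>_def using e1 by (simp_all add: rs sem power2_eq_square)
  have msr_seq: "f (ss ! i) / f (ss ! 0) = e ^ sum_list (take i diatonic_steps)"
    and seq_C: "ss ! i \<in> C" "ss ! 0 \<in> C" "(x0, ss ! 0) \<in> equitonal tempered"
    if "note_seq tempered T rs ss" "i \<le> 7" for ss i
  proof -
    have ns: "length ss = length rs + 1" "set ss \<subseteq> C" "ss ! 0 \<in> T"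
      "\<forall>i<length rs. imeasure tempered (ival tempered (ss ! i) (ss ! (i + 1))) = rs ! i"
      using that(1) unfolding note_seq_def by auto
    have len: "length rs = 7" by (simp add: rs)
    show C: "ss ! i \<in> C" "ss ! 0 \<in> C" using ns len that(2) by (auto simp: subset_iff)
    show "(x0, ss ! 0) \<in> equitonal tempered" using ns(3) unfolding T_def tone_def by blast
    have "imeasure tempered (ival tempered (ss ! 0) (ss ! i)) = prod_list (take i rs)"
      using tuned.sound_sequence_msr[of ss rs i] ns len that(2) by simp
    also have "\<dots> = e ^ sum_list (take i diatonic_steps)"
      unfolding rs_def take_map by (rule prod_list_power)
    finally show "f (ss ! i) / f (ss ! 0) = e ^ sum_list (take i diatonic_steps)" using C by simp
  qed
  have tetra: "has_disjoint_equal_tetrachords tempered \<sigma>"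
  proof -
    let ?t = "(e ^ 2, e ^ 2, e)"
    have 1: "(?t, components tempered T rs {0..3}) \<in> tetrachords tempered \<sigma>"
      unfolding \<sigma>_def tetrachords.simps module_tetrachords_def
      by (intro UnI1 CollectI exI[of _ 2]) (simp add: rs)
    have 2: "(?t, components tempered T rs {4..7}) \<in> tetrachords tempered \<sigma>"
      unfolding \<sigma>_def tetrachords.simps module_tetrachords_def
      by (intro UnI1 CollectI exI[of _ 6]) (simp add: rs)
    have "X = T" if X: "X \<in> components tempered T rs {0..3} \<inter> components tempered T rs {4..7}" for X
    proof -
      obtain ss i where i: "note_seq tempered T rs ss" "i \<in> {0..3}" "X = tone tempered (ss ! i)"
        using X unfolding components_def by blast
      obtain ts j where j: "note_seq tempered T rs ts" "j \<in> {4..7}" "X = tone tempered (ts ! j)"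
        using X unfolding components_def by blast
      have ij: "i \<le> 7" "j \<le> 7" using i j by auto
      let ?c = "\<lambda>i. sum_list (take i diatonic_steps)"
      note s = msr_seq[OF i(1) ij(1)] seq_C[OF i(1) ij(1)]
      note t = msr_seq[OF j(1) ij(2)] seq_C[OF j(1) ij(2)]
      have "(ss ! 0, ts ! 0) \<in> equitonal tempered"
        using tuned.equitonal_trans[OF tuned.equitonal_sym[OF s(4)] t(4)] .
      then obtain k :: int where k: "f (ts ! 0) / f (ss ! 0) = 2 powr of_int k" by auto
      have "(ss ! i, ts ! j) \<in> equitonal tempered"
        using tuned.tone_eq_iff[of "ss ! i" "ts ! j"] i(3) j(3) s(2) t(2) by simp
      then obtain l :: int where l: "f (ts ! j) / f (ss ! i) = 2 powr of_int l" by auto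
      have "f (ts ! j) / f (ss ! 0) = (f (ts ! j) / f (ts ! 0)) * (f (ts ! 0) / f (ss ! 0))"
        "f (ts ! j) / f (ss ! 0) = (f (ts ! j) / f (ss ! i)) * (f (ss ! i) / f (ss ! 0))"
        using f_neq_0 s(2,3) t(2,3) by simp_all
      then have "e ^ ?c j * 2 powr of_int k = 2 powr of_int l * e ^ ?c i"
        unfolding s(1) t(1) k l by simp
      then have "2 powr (real (?c j) / 12 + of_int k) = 2 powr (of_int l + real (?c i) / 12)"
        unfolding epow powr_add by simp
      then have "real (?c j) / 12 + of_int k = of_int l + real (?c i) / 12" by (simp add: powr_inj)
      then have "real (?c j) = 12 * (of_int l - of_int k) + real (?c i)" by simp
      then have "real_of_int (int (?c j)) = real_of_int (12 * (l - k) + int (?c i))" by simp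
      then have c: "int (?c j) = 12 * (l - k) + int (?c i)" by (simp only: of_int_eq_iff)
      have ci: "i = 0 \<or> i = 1 \<or> i = 2 \<or> i = 3" "j = 4 \<or> j = 5 \<or> j = 6 \<or> j = 7" using i(2) j(2) by auto
      have "i = 0"
      proof (rule ccontr)
        assume "i \<noteq> 0"
        \<comment> \<open>The numbers of semitones then differ by at least 2 and at most 10, not by a multiple of 12.\<close>
        then have "2 \<le> ?c i" "?c i \<le> 5" "7 \<le> ?c j" "?c j \<le> 12"
          using ci by (auto simp: diatonic_steps_def numeral_eq_Suc)
        then show False using c by presburger
      qed
      then have "X = tone tempered (ss ! 0)" using i(3) by simp
      also have "\<dots> = T" unfolding T_def
        using tuned.tone_eq_iff[of x0 "ss ! 0"] s(3,4) x0 by simp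
      finally show ?thesis .
    qed
    then show ?thesis using 1 2 unfolding has_disjoint_equal_tetrachords_def by (force simp: \<sigma>_def)
  qed
  define g where "g r = (SOME x. x \<in> C \<and> f x = r)" for r
  have g: "g r \<in> C" "f (g r) = r" if "r > 0" for r
    using someI_ex[of "\<lambda>x. x \<in> C \<and> f x = r"] f_onto[OF that] unfolding g_def by auto
  define chroma where "chroma n = g (f x0 * e ^ n)" for n :: nat
  have chroma_C: "chroma n \<in> C" and chroma_f: "f (chroma n) = f x0 * e ^ n" for n
    using g[of "f x0 * e ^ n"] f_pos[OF x0] e1 by (auto simp: chroma_def)
  have chroma_ratio: "f (chroma n) / f (chroma m) = e ^ (n - m)" if "m \<le> n" for m n
    using f_neq_0[OF x0] e1 that by (simp add: chroma_f power_diff)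
  have chroma_harmonic: "ival tempered (chroma m) (chroma n) \<in> harmonic tempered" if "m \<le> n" for m n
  proof -
    have "f (chroma n) / f (chroma m) = 2 powr (of_int (int (n - m)) / 12)"
      using chroma_ratio[OF that] by (simp add: epow)
    then show ?thesis
      unfolding tempered_simps ratio_ival[OF chroma_C chroma_C] using ival_in[OF chroma_C chroma_C] by blast
  qed
  have chroma_lower: "(chroma m, chroma n) \<in> lower tempered" if "m < n" for m n
    using that chroma_C f_pos[OF x0] e1 by (simp add: chroma_f)
  have triad: "major_triad tempered (chroma 0) (chroma 4) (chroma 7)"
  proof -
    have "e ^ 6 = sqrt 2" by (simp add: epow powr_half_sqrt)
    then have "e ^ 7 = e * sqrt 2" using power_Suc[of e 6] by simp
    then show ?thesis unfolding major_triad_def triad_def sem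
      using chroma_lower[of 0 4] chroma_lower[of 4 7] chroma_harmonic[of 0 4] chroma_harmonic[of 4 7]
        chroma_harmonic[of 0 7] chroma_C chroma_ratio[of 0 4] chroma_ratio[of 4 7] chroma_ratio[of 0 7]
      by (simp del: tempered_simps(3,6) flip: power_Suc)
  qed
  have based: "scale_based tempered \<sigma> (chroma 0) (chroma 4) (chroma 7)"
  proof -
    define ss where "ss = map (\<lambda>i. chroma (sum_list (take i diatonic_steps))) [0..<8]"
    have ss_nth: "ss ! i = chroma (sum_list (take i diatonic_steps))" if "i < 8" for i
      using that by (simp add: ss_def)
    have "(x0, chroma 0) \<in> equitonal tempered"
      using x0 chroma_C chroma_f[of 0] f_neq_0[OF x0] by (auto intro!: exI[of _ "0::int"])
    then have T: "chroma 0 \<in> T" "tone tempered (chroma 0) = T"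
      unfolding T_def using tuned.tone_eq_iff[of x0 "chroma 0"] x0 chroma_C by (auto simp: tone_def)
    have seq: "note_seq tempered T rs ss"
      unfolding note_seq_def
    proof (intro conjI allI impI)
      show "length ss = length rs + 1" by (simp add: ss_def rs)
      show "set ss \<subseteq> sounds tempered" using chroma_C by (auto simp: ss_def)
      show "ss ! 0 \<in> T" using T(1) by (simp add: ss_nth)
      fix i assume "i < length rs"
      then have i: "i < length diatonic_steps" "i < 7" by (simp_all add: rs_def diatonic_steps_def)
      let ?c = "sum_list (take i diatonic_steps)"
      have "sum_list (take (i + 1) diatonic_steps) = ?c + diatonic_steps ! i"
        using i by (simp add: take_Suc_conv_app_nth)
      then show "imeasure tempered (ival tempered (ss ! i) (ss ! (i + 1))) = rs ! i"
        using i chroma_C chroma_ratio[of ?c "?c + diatonic_steps ! i"] by (simp add: ss_nth rs_def)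
    qed
    have comp: "tone tempered (ss ! i) \<in> asc_components tempered \<sigma>" if "i \<le> 7" for i
    proof -
      have "i \<in> {0..length rs}" using that by (simp add: rs)
      then show ?thesis unfolding \<sigma>_def asc_components.simps components_def using seq by blast
    qed
    have "chroma 0 = ss ! 0" "chroma 4 = ss ! 2" "chroma 7 = ss ! 4"
      by (simp_all add: ss_nth diatonic_steps_def numeral_eq_Suc)
    then have "{tone tempered (chroma 0), tone tempered (chroma 4), tone tempered (chroma 7)}
        \<subseteq> asc_components tempered \<sigma>"
      using comp[of 0] comp[of 2] comp[of 4] by simp
    then show ?thesis unfolding scale_based_def
      using chroma_C T(2) by (intro bexI[of _ "chroma 0"] bexI[of _ "chroma 4"] bexI[of _ "chroma 7"]) (auto simp: \<sigma>_def)
  qed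
  have "\<exists>I\<in>harmonic tempered. imeasure tempered I > 1"
    using chroma_harmonic[of 0 1] chroma_ratio[of 0 1] chroma_C e1
    by (intro bexI[of _ "ival tempered (chroma 0) (chroma 1)"]) auto
  moreover have "heptatonic \<sigma>" "compatible \<sigma>"
    unfolding \<sigma>_def by (auto simp: rs less_Suc_eq numeral_eq_Suc)
  ultimately show ?thesis unfolding scale_axiom_def using scale even sens tetra triad based by blast
qed

text \<open>
  Each periodic function is its own colour, and its amplitude is its loudness. Sinusoids realize
  every pair of frequency and loudness.
\<close>
theorem pit_model_exists:
  assumes f0: "f0 > 0" and \<iota>0: "\<iota>0 > 0"
  shows "\<exists>M :: (real \<Rightarrow> real) pit_structure. pit_model f0 \<iota>0 M"
proof -
  let ?x0 = "pure_tone f0 \<iota>0"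
  interpret frequency_space periodic_continuous least_period ?x0
  proof
    show "least_period g > 0" if "g \<in> periodic_continuous" for g by (rule least_period_pos[OF that])
    show "\<exists>g\<in>periodic_continuous. least_period g = r" if "r > 0" for r
      using that pure_tone_in[of r 1] least_period_pure_tone[of r 1] by (intro bexI[of _ "pure_tone r 1"]) auto
    show "?x0 \<in> periodic_continuous" using f0 \<iota>0 by (rule pure_tone_in)
  qed
  have "loudness_colour_axioms f0 \<iota>0 tempered"
    unfolding loudness_colour_axioms_def
  proof (intro exI[of _ amplitude] exI[of _ "\<lambda>g. g"] conjI ballI allI impI)
    fix r :: real and s assume rs: "r > 0" "s \<in> sounds tempered"
    then have p: "least_period s > 0" by (simp add: f_pos)
    show "\<exists>g\<in>sounds tempered. (g, s) \<in> same_pitch tempered \<and> amplitude g = r"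
      using rs p pure_tone_in[OF p rs(1)] least_period_pure_tone[OF p rs(1)] amplitude_pure_tone[OF p rs(1)]
      by (intro bexI[of _ "pure_tone (least_period s) r"]) auto
  next
    fix g assume "g \<in> sounds tempered"
    then show "least_period g = frequency f0 tempered g"
      using frequency_tempered[of g] least_period_pure_tone[OF f0 \<iota>0] by simp
  qed (use amplitude_pos amplitude_pure_tone[OF f0 \<iota>0] in simp_all)
  then have "pit_model f0 \<iota>0 tempered"
    unfolding pit_model_def
    using tempered_wf tempered_pitch tempered_interval tempered_dedekind tempered_tonality
      tempered_harmony tempered_scale by blast
  then show ?thesis by blast
qed

theorem mainTheorem2:
  fixes f0 \<iota>0 :: real
  assumes "f0 > 0" and "\<iota>0 > 0"
  shows "(\<exists>M :: (real \<Rightarrow> real) pit_structure. pit_model f0 \<iota>0 M) \<and>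
    (\<forall>(M :: 'a pit_structure) (N :: 'b pit_structure).
       pit_model f0 \<iota>0 M \<and> pit_model f0 \<iota>0 N \<longrightarrow> pit_isomorphic M N)"
  using pit_model_exists[OF assms] pit_models_isomorphic[OF assms(1)] by blast

end
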